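(* Let $B$ be a finite left regular band monoid and $\Bbbk$ a field. Then $\mathrm{gl.dim}\,\Bbbk B\le L_\Bbbk(\Delta(B))$, where $\Delta(B)$ is the order complex of $B$ with respect to the $\mathcal R$-order.
   Context: A left regular band is a semigroup $B$ with $x^2=x$ and $xyx=xy$ for all $x,y$. The $\mathcal R$-order is $a\leq b$ iff $ba=a$; the order complex is the simplicial complex of finite chains. The $\Bbbk$-Leray number of a simplicial complex $K$ with vertex set $V$ is $L_\Bbbk(K)=\min\{d : \widetilde H^i(K[W],\Bbbk)=0 \text{ for all } i\ge d \text{ and all } W\subseteq V\}$, where $K[W]$ is the induced subcomplex on $W$ and $\widetilde H$ is reduced cohomology. Global dimension of a finite-dimensional algebra is the least $n$ with $\mathrm{Ext}^m(S_1,S_2)=0$ for all $m>n$ and all simple modules $S_1,S_2$. *)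

theory Defs
  imports "HOL-Algebra.Algebra" "HOL-Library.Extended_Nat"
begin

section \<open>Left regular bands and the R-order\<close>

locale left_regular_band_monoid = monoid B for B (structure) +
  assumes idem: "x \<in> carrier B \<Longrightarrow> x \<otimes> x = x"
    and left_regular: "\<lbrakk>x \<in> carrier B; y \<in> carrier B\<rbrakk> \<Longrightarrow> x \<otimes> y \<otimes> x = x \<otimes> y"

definition R_order :: "('b, 'y) monoid_scheme \<Rightarrow> 'b rel" where
  "R_order B = {(a, b). a \<in> carrier B \<and> b \<in> carrier B \<and> b \<otimes>\<^bsub>B\<^esub> a = a}"

section \<open>The monoid algebra\<close>

text \<open>Elements are coefficient functions on \<open>B\<close>.  No finite-support condition is imposed, so
  this is the monoid algebra only for finite \<open>B\<close>.\<close>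

definition monoid_algebra ::
    "('k, 'x) ring_scheme \<Rightarrow> ('b, 'y) monoid_scheme \<Rightarrow> ('b \<Rightarrow> 'k) ring" where
  "monoid_algebra K B =
    \<lparr>carrier = carrier B \<rightarrow>\<^sub>E carrier K,
     monoid.mult = (\<lambda>f g. \<lambda>x\<in>carrier B.
       \<Oplus>\<^bsub>K\<^esub>p\<in>{p \<in> carrier B \<times> carrier B. fst p \<otimes>\<^bsub>B\<^esub> snd p = x}. f (fst p) \<otimes>\<^bsub>K\<^esub> g (snd p)),
     one = (\<lambda>x\<in>carrier B. if x = \<one>\<^bsub>B\<^esub> then \<one>\<^bsub>K\<^esub> else \<zero>\<^bsub>K\<^esub>),
     ring.zero = (\<lambda>x\<in>carrier B. \<zero>\<^bsub>K\<^esub>),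
     ring.add = (\<lambda>f g. \<lambda>x\<in>carrier B. f x \<oplus>\<^bsub>K\<^esub> g x)\<rparr>"

section \<open>Modules over a not necessarily commutative ring\<close>

text \<open>The locale \<^locale>\<open>module\<close> requires a commutative ring; only its record type is reused.
  The multiplicative fields of that record play no role.\<close>

locale left_module = R?: ring R + M?: abelian_group M
    for R :: "('a, 'x) ring_scheme" (structure) and M :: "('a, 'm, 'z) module_scheme" (structure) +
  assumes smult_closed: "\<lbrakk>a \<in> carrier R; x \<in> carrier M\<rbrakk> \<Longrightarrow> a \<odot>\<^bsub>M\<^esub> x \<in> carrier M"
    and smult_l_distr: "\<lbrakk>a \<in> carrier R; b \<in> carrier R; x \<in> carrier M\<rbrakk> \<Longrightarrow>
      (a \<oplus>\<^bsub>R\<^esub> b) \<odot>\<^bsub>M\<^esub> x = a \<odot>\<^bsub>M\<^esub> x \<oplus>\<^bsub>M\<^esub> b \<odot>\<^bsub>M\<^esub> x"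
    and smult_r_distr: "\<lbrakk>a \<in> carrier R; x \<in> carrier M; y \<in> carrier M\<rbrakk> \<Longrightarrow>
      a \<odot>\<^bsub>M\<^esub> (x \<oplus>\<^bsub>M\<^esub> y) = a \<odot>\<^bsub>M\<^esub> x \<oplus>\<^bsub>M\<^esub> a \<odot>\<^bsub>M\<^esub> y"
    and smult_assoc: "\<lbrakk>a \<in> carrier R; b \<in> carrier R; x \<in> carrier M\<rbrakk> \<Longrightarrow>
      (a \<otimes>\<^bsub>R\<^esub> b) \<odot>\<^bsub>M\<^esub> x = a \<odot>\<^bsub>M\<^esub> (b \<odot>\<^bsub>M\<^esub> x)"
    and smult_one: "x \<in> carrier M \<Longrightarrow> \<one>\<^bsub>R\<^esub> \<odot>\<^bsub>M\<^esub> x = x"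

definition simple_module :: "('a, 'x) ring_scheme \<Rightarrow> ('a, 'm, 'z) module_scheme \<Rightarrow> bool" where
  "simple_module R M \<longleftrightarrow> left_module R M \<and> carrier M \<noteq> {\<zero>\<^bsub>M\<^esub>} \<and>
    (\<forall>N. submodule N R M \<longrightarrow> N = {\<zero>\<^bsub>M\<^esub>} \<or> N = carrier M)"

definition mod_hom ::
    "('a, 'x) ring_scheme \<Rightarrow> ('a, 'm, 'z) module_scheme \<Rightarrow> ('a, 'n, 'w) module_scheme
      \<Rightarrow> ('m \<Rightarrow> 'n) set" where
  "mod_hom R M N = {h \<in> hom (add_monoid M) (add_monoid N).
     \<forall>a\<in>carrier R. \<forall>x\<in>carrier M. h (a \<odot>\<^bsub>M\<^esub> x) = a \<odot>\<^bsub>N\<^esub> h x}"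

definition hom_group ::
    "('a, 'x) ring_scheme \<Rightarrow> ('a, 'm, 'z) module_scheme \<Rightarrow> ('a, 'n, 'w) module_scheme
      \<Rightarrow> ('m \<Rightarrow> 'n) monoid" where
  "hom_group R M N =
    \<lparr>carrier = mod_hom R M N \<inter> extensional (carrier M),
     monoid.mult = (\<lambda>f g. \<lambda>x\<in>carrier M. f x \<oplus>\<^bsub>N\<^esub> g x),
     one = (\<lambda>x\<in>carrier M. \<zero>\<^bsub>N\<^esub>)\<rparr>"

text \<open>The lifting property, with test modules restricted to the types \<open>'p \<Rightarrow> 'a\<close> and \<open>'p\<close>.
  This is no loss: the first type contains the free module on the carrier of \<open>P\<close>, and lifting
  the identity of \<open>P\<close> along its canonical projection makes \<open>P\<close> a direct summand of it.\<close>

definition projective_module :: "('a, 'x) ring_scheme \<Rightarrow> ('a, 'p, 'z) module_scheme \<Rightarrow> bool" where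
  "projective_module R P \<longleftrightarrow> left_module R P \<and>
    (\<forall>(M :: ('a, 'p \<Rightarrow> 'a) module) (N :: ('a, 'p) module) f g.
       left_module R M \<and> left_module R N \<and> f \<in> mod_hom R P N \<and>
       g \<in> mod_hom R M N \<and> g ` carrier M = carrier N \<longrightarrow>
       (\<exists>h \<in> mod_hom R P M. \<forall>x\<in>carrier P. g (h x) = f x))"

section \<open>Ext and global dimension\<close>

text \<open>The resolution is \<open>\<dots> \<rightarrow> P 2 \<rightarrow> P 1 \<rightarrow> P 0 \<rightarrow> M \<rightarrow> 0\<close> with \<open>d n\<close> mapping
  \<open>P (Suc n)\<close> to \<open>P n\<close> and augmentation \<open>e\<close>.\<close>

definition projective_resolution ::
    "('a, 'x) ring_scheme \<Rightarrow> (nat \<Rightarrow> ('a, 'p) module) \<Rightarrow> (nat \<Rightarrow> 'p \<Rightarrow> 'p) \<Rightarrow> ('p \<Rightarrow> 'm)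
      \<Rightarrow> ('a, 'm, 'z) module_scheme \<Rightarrow> bool" where
  "projective_resolution R P d e M \<longleftrightarrow>
     (\<forall>n. projective_module R (P n)) \<and>
     (\<forall>n. d n \<in> mod_hom R (P (Suc n)) (P n)) \<and>
     e \<in> mod_hom R (P 0) M \<and>
     e ` carrier (P 0) = carrier M \<and>
     d 0 ` carrier (P 1) = a_kernel (P 0) M e \<and>
     (\<forall>n. d (Suc n) ` carrier (P (Suc (Suc n))) = a_kernel (P (Suc n)) (P n) (d n))"

text \<open>The cohomology in degree \<open>m\<close> of \<open>Hom(P 0, N) \<rightarrow> Hom(P 1, N) \<rightarrow> \<dots>\<close>.\<close>

definition ext_group ::
    "('a, 'x) ring_scheme \<Rightarrow> (nat \<Rightarrow> ('a, 'p) module) \<Rightarrow> (nat \<Rightarrow> 'p \<Rightarrow> 'p)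
      \<Rightarrow> ('a, 'n, 'w) module_scheme \<Rightarrow> nat \<Rightarrow> ('p \<Rightarrow> 'n) set monoid" where
  "ext_group R P d N m =
    (let H = (\<lambda>n. hom_group R (P n) N);
         \<delta> = (\<lambda>n h. compose (carrier (P (Suc n))) h (d n))
     in (H m)\<lparr>carrier := kernel (H m) (H (Suc m)) (\<delta> m)\<rparr> Mod
        (case m of 0 \<Rightarrow> {\<one>\<^bsub>H 0\<^esub>} | Suc j \<Rightarrow> \<delta> j ` carrier (H j)))"

text \<open>\<open>Ext\<^sup>m(M, N) = 0\<close>, computed from the projective resolutions of \<open>M\<close> by modules on the
  type \<open>'p\<close>.  As \<open>Ext\<close> does not depend on the resolution, the choice of \<open>'p\<close> only matters in
  that the condition is void if \<open>M\<close> has no such resolution; results should therefore be stated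
  for all \<open>'p\<close>.  For a finite-dimensional algebra \<open>R\<close> on the type \<open>'a\<close> and a finite-dimensional
  \<open>M\<close>, the type \<open>nat \<Rightarrow> 'a\<close> already admits a resolution by modules \<open>R\<^sup>k\<close>.\<close>

definition ext_vanishes ::
    "'p itself \<Rightarrow> ('a, 'x) ring_scheme \<Rightarrow> ('a, 'm, 'z) module_scheme
      \<Rightarrow> ('a, 'n, 'w) module_scheme \<Rightarrow> nat \<Rightarrow> bool" where
  "ext_vanishes (_ :: 'p itself) R M N m \<longleftrightarrow>
    (\<forall>(P :: nat \<Rightarrow> ('a, 'p) module) d e.
       projective_resolution R P d e M \<longrightarrow> trivial_group (ext_group R P d N m))"

text \<open>The type \<open>'m\<close> is the one carrying the simple modules; every simple module is isomorphic to
  one on the type \<open>'a set\<close>, namely a quotient of \<open>R\<close> by a maximal left ideal.  The value is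
  \<open>\<infinity>\<close> if no finite bound exists.\<close>

definition gl_dim :: "'m itself \<Rightarrow> 'p itself \<Rightarrow> ('a, 'x) ring_scheme \<Rightarrow> enat" where
  "gl_dim (_ :: 'm itself) (_ :: 'p itself) R =
    (LEAST n. \<forall>m. n < enat m \<longrightarrow>
       (\<forall>(S1 :: ('a, 'm) module) (S2 :: ('a, 'm) module).
          simple_module R S1 \<and> simple_module R S2 \<longrightarrow> ext_vanishes TYPE('p) R S1 S2 m))"

section \<open>Simplicial complexes, reduced cohomology and the Leray number\<close>

text \<open>A simplicial complex is given by its set of faces, including the empty face; its vertex set
  is the union of the faces.\<close>

definition order_complex :: "'v rel \<Rightarrow> 'v set set" where
  "order_complex r = {s \<in> Chains r. finite s}"

definition induced_subcomplex :: "'v set set \<Rightarrow> 'v set \<Rightarrow> 'v set set" where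
  "induced_subcomplex \<Delta> W = {s \<in> \<Delta>. s \<subseteq> W}"

text \<open>Orderings of the faces with \<open>n\<close> vertices, i.e. of dimension \<open>n - 1\<close>.\<close>

definition ordered_faces :: "'v set set \<Rightarrow> nat \<Rightarrow> 'v list set" where
  "ordered_faces \<Delta> n = {xs. length xs = n \<and> distinct xs \<and> set xs \<in> \<Delta>}"

text \<open>Alternating cochains of dimension \<open>n - 1\<close>; since adjacent transpositions generate the
  symmetric group, the condition says that permuting the vertices multiplies the value by the
  sign of the permutation.  For \<open>n = 0\<close> this is the augmentation term, a copy of \<open>K\<close>.\<close>

definition cochain_group ::
    "('k, 'x) ring_scheme \<Rightarrow> 'v set set \<Rightarrow> nat \<Rightarrow> ('v list \<Rightarrow> 'k) monoid" where
  "cochain_group K \<Delta> n =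
    \<lparr>carrier = {f \<in> ordered_faces \<Delta> n \<rightarrow>\<^sub>E carrier K.
       \<forall>us a b vs. us @ a # b # vs \<in> ordered_faces \<Delta> n \<longrightarrow>
         f (us @ b # a # vs) = \<ominus>\<^bsub>K\<^esub> f (us @ a # b # vs)},
     monoid.mult = (\<lambda>f g. \<lambda>xs\<in>ordered_faces \<Delta> n. f xs \<oplus>\<^bsub>K\<^esub> g xs),
     one = (\<lambda>xs\<in>ordered_faces \<Delta> n. \<zero>\<^bsub>K\<^esub>)\<rparr>"

definition coboundary ::
    "('k, 'x) ring_scheme \<Rightarrow> 'v set set \<Rightarrow> nat \<Rightarrow> ('v list \<Rightarrow> 'k) \<Rightarrow> 'v list \<Rightarrow> 'k" where
  "coboundary K \<Delta> n f = (\<lambda>xs\<in>ordered_faces \<Delta> (Suc n).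
     \<Oplus>\<^bsub>K\<^esub>j\<in>{..n}. (\<ominus>\<^bsub>K\<^esub> \<one>\<^bsub>K\<^esub>) [^]\<^bsub>K\<^esub> j \<otimes>\<^bsub>K\<^esub> f (take j xs @ drop (Suc j) xs))"

text \<open>The index shift: cochains of dimension \<open>i\<close> live on faces with \<open>i + 1\<close> vertices.\<close>

definition reduced_cohomology ::
    "('k, 'x) ring_scheme \<Rightarrow> 'v set set \<Rightarrow> nat \<Rightarrow> ('v list \<Rightarrow> 'k) set monoid" where
  "reduced_cohomology K \<Delta> i =
    (cochain_group K \<Delta> (Suc i))
      \<lparr>carrier := kernel (cochain_group K \<Delta> (Suc i)) (cochain_group K \<Delta> (Suc (Suc i)))
                   (coboundary K \<Delta> (Suc i))\<rparr>
    Mod (coboundary K \<Delta> i ` carrier (cochain_group K \<Delta> i))"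

text \<open>Valued in \<^typ>\<open>enat\<close>, so that it is \<open>\<infinity>\<close> if no finite \<open>d\<close> qualifies; for a finite
  complex the minimum is finite.\<close>

definition leray_number :: "('k, 'x) ring_scheme \<Rightarrow> 'v set set \<Rightarrow> enat" where
  "leray_number K \<Delta> =
    (LEAST d. \<forall>i. d \<le> enat i \<longrightarrow>
       (\<forall>W. W \<subseteq> \<Union>\<Delta> \<longrightarrow> trivial_group (reduced_cohomology K (induced_subcomplex \<Delta> W) i)))"

end

theory Submission
  imports Defs
begin

text \<open>Every \<open>b\<close> acts on a simple module as \<open>0\<close> or \<open>1\<close>, so a simple module is a line on which a filter \<open>Q\<close>
  of the band acts trivially and the rest acts by \<open>0\<close>.  Left multiplication preserves the
  \<open>\<R>\<close>-order, hence acts on the normalised chains of the poset \<open>Q\<close>; a chain that leaves \<open>Q\<close> or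
  degenerates becomes \<open>0\<close>.  As \<open>Q\<close> has the top element \<open>\<one>\<close>, this augmented complex is exact.
  Its terms are projective, being filtered by the projective modules spanned by single
  \<open>\<L>\<close>-classes, and so it is a projective resolution of the simple module.  For a second
  simple module, given by the filter of all \<open>c\<close> with \<open>e c = e\<close>, homomorphisms from the chains into
  it are the functions on the chains of \<open>Q\<close> with top element \<open>e\<close>.  Dropping \<open>e\<close> identifies
  the Hom complex in degree \<open>m\<close> with the reduced cochains of dimension \<open>m - 1\<close> of the subposet
  \<open>{b \<in> Q. b < e}\<close>, an induced subcomplex of \<open>\<Delta>(B)\<close>.  Hence \<open>Ext\<^sup>m\<close> vanishes as soon as
  \<open>m - 1\<close> is at least the Leray number.\<close>

section \<open>Module homomorphisms\<close>

text \<open>The chain modules live on the type \<open>'b list \<Rightarrow> 'k\<close>, while Ext is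
  computed from arbitrary projective resolutions on a type \<open>'p\<close>, and projectivity is
  tested against modules on two fixed types only. So the chain complex is never shown to be a
  \<open>projective_resolution\<close>. The comparison of two resolutions needs just the lifting
  property \<open>lifts\<close> for certain triples of modules on arbitrary types: projective
  modules have it as retracts of free modules, chain modules by an explicit construction. Only one
  statement is carried across: in positive degree every cocycle is a coboundary. The second obstacle
  is that prepending \<open>\<one>\<close> to a chain contracts the complex only linearly over the
  field, not over the algebra. Yet the chain \<open>b # t\<close> is \<open>b\<close> applied to
  \<open>\<one> # t\<close>, so the image of the contraction generates the next term over the
  algebra, and an equivariant map that kills this image is zero. This turns the homotopy identity
  into a proof that consecutive boundaries compose to zero, with no double sum over pairs of
  faces.\<close>

lemma mod_homI:
  assumes "\<And>x. x \<in> carrier M \<Longrightarrow> h x \<in> carrier N"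
    and "\<And>x y. x \<in> carrier M \<Longrightarrow> y \<in> carrier M \<Longrightarrow> h (x \<oplus>\<^bsub>M\<^esub> y) = h x \<oplus>\<^bsub>N\<^esub> h y"
    and "\<And>a x. a \<in> carrier R \<Longrightarrow> x \<in> carrier M \<Longrightarrow> h (a \<odot>\<^bsub>M\<^esub> x) = a \<odot>\<^bsub>N\<^esub> h x"
  shows "h \<in> mod_hom R M N"
  using assms by (auto simp: mod_hom_def hom_def)

lemma mod_homD:
  assumes "h \<in> mod_hom R M N"
  shows "x \<in> carrier M \<Longrightarrow> h x \<in> carrier N"
    and "x \<in> carrier M \<Longrightarrow> y \<in> carrier M \<Longrightarrow> h (x \<oplus>\<^bsub>M\<^esub> y) = h x \<oplus>\<^bsub>N\<^esub> h y"
    and "a \<in> carrier R \<Longrightarrow> x \<in> carrier M \<Longrightarrow> h (a \<odot>\<^bsub>M\<^esub> x) = a \<odot>\<^bsub>N\<^esub> h x"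
  using assms by (auto simp: mod_hom_def hom_def)

text \<open>Additivity alone is assumed, because these facts also serve maps that are not module
  homomorphisms: a scalar acting on a fixed element, negation in the field, and the contraction of
  the chain complex.\<close>

lemma additive_zero:
  assumes "abelian_group M" "abelian_group N"
    and "\<And>x. x \<in> carrier M \<Longrightarrow> h x \<in> carrier N"
    and "\<And>x y. x \<in> carrier M \<Longrightarrow> y \<in> carrier M \<Longrightarrow> h (x \<oplus>\<^bsub>M\<^esub> y) = h x \<oplus>\<^bsub>N\<^esub> h y"
  shows "h \<zero>\<^bsub>M\<^esub> = \<zero>\<^bsub>N\<^esub>"
proof -
  interpret M: abelian_group M by fact
  interpret N: abelian_group N by fact
  have "h \<zero>\<^bsub>M\<^esub> \<oplus>\<^bsub>N\<^esub> h \<zero>\<^bsub>M\<^esub> = h \<zero>\<^bsub>M\<^esub> \<oplus>\<^bsub>N\<^esub> \<zero>\<^bsub>N\<^esub>"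
    using assms(3)[of "\<zero>\<^bsub>M\<^esub>"] assms(4)[of "\<zero>\<^bsub>M\<^esub>" "\<zero>\<^bsub>M\<^esub>"] by simp
  then show ?thesis using assms(3)[of "\<zero>\<^bsub>M\<^esub>"] by (metis M.zero_closed N.add.l_cancel N.zero_closed)
qed

lemma additive_minus:
  assumes "abelian_group M" "abelian_group N"
    and "\<And>x. x \<in> carrier M \<Longrightarrow> h x \<in> carrier N"
    and "\<And>x y. x \<in> carrier M \<Longrightarrow> y \<in> carrier M \<Longrightarrow> h (x \<oplus>\<^bsub>M\<^esub> y) = h x \<oplus>\<^bsub>N\<^esub> h y"
    and "x \<in> carrier M"
  shows "h (\<ominus>\<^bsub>M\<^esub> x) = \<ominus>\<^bsub>N\<^esub> h x"
proof -
  interpret M: abelian_group M by fact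
  interpret N: abelian_group N by fact
  have "h (\<ominus>\<^bsub>M\<^esub> x) \<oplus>\<^bsub>N\<^esub> h x = \<zero>\<^bsub>N\<^esub>"
    using additive_zero[OF assms(1-4)] assms(4)[of "\<ominus>\<^bsub>M\<^esub> x" x] assms(5) by (simp add: M.l_neg)
  then show ?thesis using assms(3,5) by (metis M.a_inv_closed N.minus_equality)
qed

lemma additive_finsum:
  assumes "abelian_group M" "abelian_group N"
    and "\<And>x. x \<in> carrier M \<Longrightarrow> h x \<in> carrier N"
    and "\<And>x y. x \<in> carrier M \<Longrightarrow> y \<in> carrier M \<Longrightarrow> h (x \<oplus>\<^bsub>M\<^esub> y) = h x \<oplus>\<^bsub>N\<^esub> h y"
    and "\<And>i. i \<in> A \<Longrightarrow> f i \<in> carrier M"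
  shows "h (finsum M f A) = finsum N (\<lambda>i. h (f i)) A"
proof -
  interpret M: abelian_group M by fact
  interpret N: abelian_group N by fact
  show ?thesis
    using assms(5)
  proof (induction A rule: infinite_finite_induct)
    case (infinite A)
    then show ?case using additive_zero[OF assms(1-4)] by (simp add: M.finsum_infinite N.finsum_infinite)
  next
    case empty
    then show ?case using additive_zero[OF assms(1-4)] by simp
  next
    case (insert a A)
    then have "h (finsum M f (insert a A)) = h (f a \<oplus>\<^bsub>M\<^esub> finsum M f A)"
      by (subst M.finsum_insert) auto
    also have "\<dots> = h (f a) \<oplus>\<^bsub>N\<^esub> finsum N (\<lambda>i. h (f i)) A"
      using insert by (subst assms(4)) (auto intro!: M.finsum_closed)
    also have "\<dots> = finsum N (\<lambda>i. h (f i)) (insert a A)"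
      using insert assms(3) by (subst N.finsum_insert) auto
    finally show ?case .
  qed
qed

lemma mod_hom_zero:
  assumes "h \<in> mod_hom R M N" "left_module R M" "left_module R N"
  shows "h \<zero>\<^bsub>M\<^esub> = \<zero>\<^bsub>N\<^esub>"
  using additive_zero[of M N h] assms mod_homD[OF assms(1)] by (simp add: left_module_def)

lemma mod_hom_minus:
  assumes "h \<in> mod_hom R M N" "left_module R M" "left_module R N" "x \<in> carrier M"
  shows "h (\<ominus>\<^bsub>M\<^esub> x) = \<ominus>\<^bsub>N\<^esub> h x"
  using additive_minus[of M N h] assms mod_homD[OF assms(1)] by (simp add: left_module_def)

lemma mod_hom_finsum:
  assumes "h \<in> mod_hom R M N" "left_module R M" "left_module R N" "\<And>i. i \<in> A \<Longrightarrow> f i \<in> carrier M"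
  shows "h (finsum M f A) = finsum N (\<lambda>i. h (f i)) A"
  by (rule additive_finsum)
    (use assms mod_homD[OF assms(1)] in \<open>simp_all add: left_module_def\<close>)

lemma mod_hom_comp:
  assumes "f \<in> mod_hom R L M" "g \<in> mod_hom R M N"
  shows "(\<lambda>x. g (f x)) \<in> mod_hom R L N"
  using assms by (auto simp: mod_hom_def hom_def Pi_def)

lemma (in left_module) smult_r_null:
  assumes "a \<in> carrier R" shows "a \<odot>\<^bsub>M\<^esub> \<zero>\<^bsub>M\<^esub> = \<zero>\<^bsub>M\<^esub>"
  using additive_zero[of M M "\<lambda>x. a \<odot>\<^bsub>M\<^esub> x"] assms smult_closed smult_r_distr
    M.abelian_group_axioms by simp

lemma (in left_module) smult_r_minus:
  assumes "a \<in> carrier R" "x \<in> carrier M" shows "a \<odot>\<^bsub>M\<^esub> (\<ominus>\<^bsub>M\<^esub> x) = \<ominus>\<^bsub>M\<^esub> (a \<odot>\<^bsub>M\<^esub> x)"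
  using additive_minus[of M M "\<lambda>x. a \<odot>\<^bsub>M\<^esub> x"] assms smult_closed smult_r_distr
    M.abelian_group_axioms by simp

lemma (in left_module) smult_l_null:
  assumes "x \<in> carrier M" shows "\<zero>\<^bsub>R\<^esub> \<odot>\<^bsub>M\<^esub> x = \<zero>\<^bsub>M\<^esub>"
  using additive_zero[of R M "\<lambda>a. a \<odot>\<^bsub>M\<^esub> x"] assms smult_closed smult_l_distr
    M.abelian_group_axioms R.abelian_group_axioms by simp

lemma (in left_module) smult_l_minus:
  assumes "a \<in> carrier R" "x \<in> carrier M" shows "(\<ominus>\<^bsub>R\<^esub> a) \<odot>\<^bsub>M\<^esub> x = \<ominus>\<^bsub>M\<^esub> (a \<odot>\<^bsub>M\<^esub> x)"
  using additive_minus[of R M "\<lambda>a. a \<odot>\<^bsub>M\<^esub> x"] assms smult_closed smult_l_distr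
    M.abelian_group_axioms R.abelian_group_axioms by simp

lemma (in left_module) smult_r_finsum:
  assumes "a \<in> carrier R" "\<And>i. i \<in> A \<Longrightarrow> f i \<in> carrier M"
  shows "a \<odot>\<^bsub>M\<^esub> finsum M f A = finsum M (\<lambda>i. a \<odot>\<^bsub>M\<^esub> f i) A"
  using additive_finsum[of M M "\<lambda>x. a \<odot>\<^bsub>M\<^esub> x" A f] assms smult_closed smult_r_distr
    M.abelian_group_axioms by simp

lemma mod_hom_add:
  assumes "left_module R M" "left_module R N" "f \<in> mod_hom R M N" "g \<in> mod_hom R M N"
  shows "(\<lambda>x. f x \<oplus>\<^bsub>N\<^esub> g x) \<in> mod_hom R M N"
proof -
  interpret N: left_module R N by fact
  show ?thesis
    by (rule mod_homI)
      (auto simp: mod_homD[OF assms(3)] mod_homD[OF assms(4)] N.smult_r_distr N.M.a_ac)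
qed

lemma mod_hom_neg:
  assumes "left_module R M" "left_module R N" "f \<in> mod_hom R M N"
  shows "(\<lambda>x. \<ominus>\<^bsub>N\<^esub> f x) \<in> mod_hom R M N"
proof -
  interpret N: left_module R N by fact
  show ?thesis
    by (rule mod_homI)
      (auto simp: mod_homD[OF assms(3)] N.smult_r_minus N.M.minus_add)
qed

lemma mod_hom_diff:
  assumes "left_module R M" "left_module R N" "f \<in> mod_hom R M N" "g \<in> mod_hom R M N"
  shows "(\<lambda>x. f x \<ominus>\<^bsub>N\<^esub> g x) \<in> mod_hom R M N"
  using mod_hom_add[OF assms(1,2,3) mod_hom_neg[OF assms(1,2,4)]] by (simp add: a_minus_def)

lemma mod_hom_restrict:
  assumes "left_module R M" "f \<in> mod_hom R M N"
  shows "restrict f (carrier M) \<in> mod_hom R M N"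
proof -
  interpret M: left_module R M by fact
  show ?thesis
    by (rule mod_homI) (auto simp: mod_homD[OF assms(2)] M.smult_closed)
qed

section \<open>Lifting along projective modules\<close>

text \<open>Projectivity for one pair of modules, hence free of restrictions on their types. Only
  the image of \<open>f\<close> has to lie in the image of \<open>g\<close>, so exactness can be fed
  in directly, without forming the kernel as a module.\<close>

definition lifts ::
  "('a, 'x) ring_scheme \<Rightarrow> ('a, 'p, 'u) module_scheme \<Rightarrow> ('a, 'm, 'v) module_scheme
    \<Rightarrow> ('a, 'n, 'w) module_scheme \<Rightarrow> bool" where
  "lifts R P M N \<longleftrightarrow> (\<forall>f \<in> mod_hom R P N. \<forall>g \<in> mod_hom R M N. f ` carrier P \<subseteq> g ` carrier M \<longrightarrow>
     (\<exists>h \<in> mod_hom R P M. \<forall>x\<in>carrier P. g (h x) = f x))"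

lemma liftsE:
  assumes "lifts R P M N" "f \<in> mod_hom R P N" "g \<in> mod_hom R M N"
    and "\<And>x. x \<in> carrier P \<Longrightarrow> f x \<in> g ` carrier M"
  obtains h where "h \<in> mod_hom R P M" "\<And>x. x \<in> carrier P \<Longrightarrow> g (h x) = f x"
  using assms unfolding lifts_def by (metis image_subsetI)

definition free_module :: "('a, 'x) ring_scheme \<Rightarrow> 'p set \<Rightarrow> ('a, 'p \<Rightarrow> 'a) module" where
  "free_module R S = \<lparr>carrier = {f. (\<forall>p. f p \<in> carrier R) \<and> (\<forall>p. p \<notin> S \<longrightarrow> f p = \<zero>\<^bsub>R\<^esub>) \<and>
       finite {p. f p \<noteq> \<zero>\<^bsub>R\<^esub>}},
     monoid.mult = undefined, one = undefined, ring.zero = (\<lambda>p. \<zero>\<^bsub>R\<^esub>),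
     ring.add = (\<lambda>f g p. f p \<oplus>\<^bsub>R\<^esub> g p), smult = (\<lambda>a f p. a \<otimes>\<^bsub>R\<^esub> f p)\<rparr>"

lemma left_module_free_module:
  fixes R :: "('a, 'x) ring_scheme" and S :: "'p set"
  assumes "ring R" shows "left_module R (free_module R S)"
proof -
  interpret R: ring R by fact
  have fin: "finite {p. f p \<oplus>\<^bsub>R\<^esub> g p \<noteq> \<zero>\<^bsub>R\<^esub>}"
    if "finite {p. f p \<noteq> \<zero>\<^bsub>R\<^esub>}" "finite {p. g p \<noteq> \<zero>\<^bsub>R\<^esub>}" for f g :: "'p \<Rightarrow> 'a"
    by (rule finite_subset[OF _ finite_UnI[OF that]]) auto
  have fins: "finite {p. a \<otimes>\<^bsub>R\<^esub> g p \<noteq> \<zero>\<^bsub>R\<^esub>}"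
    if "finite {p. g p \<noteq> \<zero>\<^bsub>R\<^esub>}" "a \<in> carrier R" for a and g :: "'p \<Rightarrow> 'a"
    by (rule finite_subset[OF _ that(1)]) (use that in auto)
  have ag: "abelian_group (free_module R S)"
  proof (rule abelian_groupI, goal_cases)
    case (6 f)
    then show ?case
      by (intro bexI[of _ "\<lambda>p. \<ominus>\<^bsub>R\<^esub> f p"])
        (auto simp: free_module_def R.l_neg elim!: rev_finite_subset)
  qed (auto simp: free_module_def fun_eq_iff R.a_ac fin)
  show ?thesis
    by (intro left_module.intro left_module_axioms.intro assms ag)
      (auto simp: free_module_def fun_eq_iff R.l_distr R.r_distr R.m_assoc fins)
qed

lemma (in abelian_monoid) finsum_mono_neutral:
  assumes "finite B" "A \<subseteq> B" "\<And>i. i \<in> B - A \<Longrightarrow> f i = \<zero>" "f \<in> B \<rightarrow> carrier G"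
  shows "finsum G f A = finsum G f B"
  using add.finprod_mono_neutral_cong_left[OF assms(1,2,3) refl assms(4)] by (simp add: finsum_def)

definition lin_comb ::
  "('a, 'x) ring_scheme \<Rightarrow> ('a, 'm, 'v) module_scheme \<Rightarrow> ('p \<Rightarrow> 'm) \<Rightarrow> ('p \<Rightarrow> 'a) \<Rightarrow> 'm" where
  "lin_comb R M x f = (\<Oplus>\<^bsub>M\<^esub>p\<in>{p. f p \<noteq> \<zero>\<^bsub>R\<^esub>}. f p \<odot>\<^bsub>M\<^esub> x p)"

lemma lin_comb_hom:
  assumes "left_module R M" and x: "\<And>p. p \<in> S \<Longrightarrow> x p \<in> carrier M"
  shows "lin_comb R M x \<in> mod_hom R (free_module R S) M"
proof -
  interpret M: left_module R M by fact
  let ?F = "free_module R S"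
  \<comment> \<open>The support of a sum or a multiple may differ from the supports it comes from;
    enlarging the index set lets all sums run over one common finite set.\<close>
  have eq: "lin_comb R M x f = (\<Oplus>\<^bsub>M\<^esub>p\<in>A. f p \<odot>\<^bsub>M\<^esub> x p)"
    if "f \<in> carrier ?F" "finite A" "{p. f p \<noteq> \<zero>\<^bsub>R\<^esub>} \<subseteq> A" "A \<subseteq> S" for f A
    unfolding lin_comb_def
    by (rule M.M.finsum_mono_neutral)
      (use that x in \<open>auto simp: free_module_def subset_iff intro!: M.smult_closed M.smult_l_null\<close>)
  have cl: "f p \<odot>\<^bsub>M\<^esub> x p \<in> carrier M" if "f \<in> carrier ?F" "p \<in> S" for f p
    using that x by (auto simp: free_module_def intro!: M.smult_closed)
  have supp: "finite {p. f p \<noteq> \<zero>\<^bsub>R\<^esub>}" "{p. f p \<noteq> \<zero>\<^bsub>R\<^esub>} \<subseteq> S" if "f \<in> carrier ?F" for f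
    using that by (auto simp: free_module_def)
  show ?thesis
  proof (rule mod_homI)
    fix f assume f: "f \<in> carrier ?F"
    then show "lin_comb R M x f \<in> carrier M"
      unfolding lin_comb_def using supp[OF f] by (auto intro!: M.M.finsum_closed cl)
  next
    fix f g assume f: "f \<in> carrier ?F" and g: "g \<in> carrier ?F"
    let ?A = "{p. f p \<noteq> \<zero>\<^bsub>R\<^esub>} \<union> {p. g p \<noteq> \<zero>\<^bsub>R\<^esub>}"
    have A: "finite ?A" "?A \<subseteq> S" using supp[OF f] supp[OF g] by auto
    interpret F: left_module R ?F by (rule left_module_free_module) (rule M.R.ring_axioms)
    have fg: "f \<oplus>\<^bsub>?F\<^esub> g \<in> carrier ?F" using f g by simp
    have "lin_comb R M x (f \<oplus>\<^bsub>?F\<^esub> g) = (\<Oplus>\<^bsub>M\<^esub>p\<in>?A. (f \<oplus>\<^bsub>?F\<^esub> g) p \<odot>\<^bsub>M\<^esub> x p)"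
      by (rule eq[OF fg A(1) _ A(2)]) (auto simp: free_module_def)
    also have "\<dots> = (\<Oplus>\<^bsub>M\<^esub>p\<in>?A. f p \<odot>\<^bsub>M\<^esub> x p \<oplus>\<^bsub>M\<^esub> g p \<odot>\<^bsub>M\<^esub> x p)"
    proof (rule M.M.finsum_cong')
      fix p assume "p \<in> ?A"
      then have "x p \<in> carrier M" using A(2) x by blast
      then show "(f \<oplus>\<^bsub>?F\<^esub> g) p \<odot>\<^bsub>M\<^esub> x p = f p \<odot>\<^bsub>M\<^esub> x p \<oplus>\<^bsub>M\<^esub> g p \<odot>\<^bsub>M\<^esub> x p"
        using f g by (simp add: free_module_def M.smult_l_distr)
    next
      show "(\<lambda>p. f p \<odot>\<^bsub>M\<^esub> x p \<oplus>\<^bsub>M\<^esub> g p \<odot>\<^bsub>M\<^esub> x p) \<in> ?A \<rightarrow> carrier M"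
        using A(2) by (intro Pi_I M.M.a_closed cl f g) blast+
    qed simp
    also have "\<dots> = (\<Oplus>\<^bsub>M\<^esub>p\<in>?A. f p \<odot>\<^bsub>M\<^esub> x p) \<oplus>\<^bsub>M\<^esub> (\<Oplus>\<^bsub>M\<^esub>p\<in>?A. g p \<odot>\<^bsub>M\<^esub> x p)"
      using A(2) by (intro M.M.finsum_addf Pi_I cl f g) blast+
    also have "\<dots> = lin_comb R M x f \<oplus>\<^bsub>M\<^esub> lin_comb R M x g"
      using eq[OF f A(1) _ A(2)] eq[OF g A(1) _ A(2)] by simp
    finally show "lin_comb R M x (f \<oplus>\<^bsub>?F\<^esub> g) = lin_comb R M x f \<oplus>\<^bsub>M\<^esub> lin_comb R M x g" .
  next
    fix a f assume a: "a \<in> carrier R" and f: "f \<in> carrier ?F"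
    interpret F: left_module R ?F by (rule left_module_free_module) (rule M.R.ring_axioms)
    have af: "a \<odot>\<^bsub>?F\<^esub> f \<in> carrier ?F" using F.smult_closed a f by simp
    have "lin_comb R M x (a \<odot>\<^bsub>?F\<^esub> f) = (\<Oplus>\<^bsub>M\<^esub>p\<in>{p. f p \<noteq> \<zero>\<^bsub>R\<^esub>}. (a \<odot>\<^bsub>?F\<^esub> f) p \<odot>\<^bsub>M\<^esub> x p)"
      by (rule eq[OF af supp(1)[OF f] _ supp(2)[OF f]]) (use a in \<open>auto simp: free_module_def\<close>)
    also have "\<dots> = (\<Oplus>\<^bsub>M\<^esub>p\<in>{p. f p \<noteq> \<zero>\<^bsub>R\<^esub>}. a \<odot>\<^bsub>M\<^esub> (f p \<odot>\<^bsub>M\<^esub> x p))"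
    proof (rule M.M.finsum_cong')
      fix p assume "p \<in> {p. f p \<noteq> \<zero>\<^bsub>R\<^esub>}"
      then have "x p \<in> carrier M" using supp(2)[OF f] x by blast
      then show "(a \<odot>\<^bsub>?F\<^esub> f) p \<odot>\<^bsub>M\<^esub> x p = a \<odot>\<^bsub>M\<^esub> (f p \<odot>\<^bsub>M\<^esub> x p)"
        using f a by (simp add: free_module_def M.smult_assoc)
    next
      show "(\<lambda>p. a \<odot>\<^bsub>M\<^esub> (f p \<odot>\<^bsub>M\<^esub> x p)) \<in> {p. f p \<noteq> \<zero>\<^bsub>R\<^esub>} \<rightarrow> carrier M"
        using supp(2)[OF f] M.smult_closed[OF a cl[OF f]] by blast
    qed simp
    also have "\<dots> = a \<odot>\<^bsub>M\<^esub> lin_comb R M x f"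
      unfolding lin_comb_def by (rule M.smult_r_finsum[symmetric]) (use a f cl supp(2)[OF f] in auto)
    finally show "lin_comb R M x (a \<odot>\<^bsub>?F\<^esub> f) = a \<odot>\<^bsub>M\<^esub> lin_comb R M x f" .
  qed
qed

text \<open>Lifting the identity along the canonical projection exhibits \<open>P\<close> as a
  retract of the free module on its carrier. Maps out of that free module lift along
  \<open>g\<close> into modules on any type.\<close>

lemma projective_lifts:
  fixes P :: "('a, 'p) module"
  assumes P: "projective_module R P" and M: "left_module R M" and N: "left_module R N"
  shows "lifts R P M N"
  unfolding lifts_def
proof (intro ballI impI)
  fix f g assume f: "f \<in> mod_hom R P N" and g: "g \<in> mod_hom R M N"
    and fg: "f ` carrier P \<subseteq> g ` carrier M"
  have P': "left_module R P" using P by (simp add: projective_module_def)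
  interpret P: left_module R P by fact
  interpret M: left_module R M by fact
  interpret N: left_module R N by fact
  let ?F = "free_module R (carrier P)"
  have F: "left_module R ?F" by (rule left_module_free_module) (rule P.R.ring_axioms)
  have id: "(\<lambda>x. x) \<in> mod_hom R P P" by (rule mod_homI) simp_all
  let ?e = "lin_comb R P (\<lambda>p. p)"
  have e: "?e \<in> mod_hom R ?F P" by (rule lin_comb_hom[OF P'])simp
  have "?e ` carrier ?F = carrier P"
  proof
    show "?e ` carrier ?F \<subseteq> carrier P" using mod_homD(1)[OF e] by blast
    show "carrier P \<subseteq> ?e ` carrier ?F"
    proof
      fix p assume p: "p \<in> carrier P"
      show "p \<in> ?e ` carrier ?F"
      \<comment> \<open>Over the zero ring the indicator function of \<open>p\<close> would have
        empty support, but there every module element is zero.\<close>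
      proof (cases "\<one>\<^bsub>R\<^esub> = \<zero>\<^bsub>R\<^esub>")
        case True
        then have "p = \<zero>\<^bsub>P\<^esub>" using P.smult_one[of p] P.smult_l_null[of p] p by simp
        then have "p = ?e \<zero>\<^bsub>?F\<^esub>" using mod_hom_zero[OF e F P'] by simp
        then show ?thesis using left_module.axioms(2)[OF F] abelian_monoid.zero_closed
          by (metis abelian_group.axioms(1) imageI)
      next
        case False
        define u where "u = (\<lambda>q. if q = p then \<one>\<^bsub>R\<^esub> else \<zero>\<^bsub>R\<^esub>)"
        have s: "{q. u q \<noteq> \<zero>\<^bsub>R\<^esub>} = {p}" using False by (auto simp: u_def)
        have "u \<in> carrier ?F" using p s P.R.one_closed by (auto simp: free_module_def u_def)
        moreover have "?e u = p"
          unfolding lin_comb_def s using p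
          by (simp add: u_def P.smult_one P.M.finsum_insert[of "{}", simplified])
        ultimately show ?thesis by (metis imageI)
      qed
    qed
  qed
  with P F P' id e have "\<exists>h \<in> mod_hom R P ?F. \<forall>x\<in>carrier P. ?e (h x) = x"
    unfolding projective_module_def
    by (elim conjE, elim allE[of _ ?F] allE[of _ P] allE[of _ "\<lambda>x. x"] allE[of _ ?e]) simp
  then obtain h where h: "h \<in> mod_hom R P ?F" and eh: "\<And>x. x \<in> carrier P \<Longrightarrow> ?e (h x) = x"
    by blast
  \<comment> \<open>Preimages of the values on the free generators can be chosen independently of
    each other.\<close>
  obtain y where y: "\<And>p. p \<in> carrier P \<Longrightarrow> y p \<in> carrier M" "\<And>p. p \<in> carrier P \<Longrightarrow> g (y p) = f p"
    using that[of "\<lambda>p. inv_into (carrier M) g (f p)"] fg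
    by (simp add: f_inv_into_f image_subset_iff inv_into_into)
  have yh: "lin_comb R M y \<in> mod_hom R ?F M" by (rule lin_comb_hom[OF M y(1)])
  show "\<exists>k\<in>mod_hom R P M. \<forall>x\<in>carrier P. g (k x) = f x"
  proof (rule bexI[OF _ mod_hom_comp[OF h yh]], rule ballI)
    fix x assume x: "x \<in> carrier P"
    have hx: "h x \<in> carrier ?F" using mod_homD(1)[OF h x] .
    have s: "{p. h x p \<noteq> \<zero>\<^bsub>R\<^esub>} \<subseteq> carrier P" and hR: "\<And>p. h x p \<in> carrier R"
      using hx by (auto simp: free_module_def)
    have "g (lin_comb R M y (h x)) = (\<Oplus>\<^bsub>N\<^esub>p\<in>{p. h x p \<noteq> \<zero>\<^bsub>R\<^esub>}. g (h x p \<odot>\<^bsub>M\<^esub> y p))"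
      unfolding lin_comb_def
      by (rule mod_hom_finsum[OF g M N]) (use s hR y in \<open>auto intro!: M.smult_closed\<close>)
    also have "\<dots> = (\<Oplus>\<^bsub>N\<^esub>p\<in>{p. h x p \<noteq> \<zero>\<^bsub>R\<^esub>}. f (h x p \<odot>\<^bsub>P\<^esub> p))"
    proof (rule N.M.finsum_cong')
      show "(\<lambda>p. f (h x p \<odot>\<^bsub>P\<^esub> p)) \<in> {p. h x p \<noteq> \<zero>\<^bsub>R\<^esub>} \<rightarrow> carrier N"
        using s hR by (auto intro!: mod_homD(1)[OF f] P.smult_closed)
      fix p assume "p \<in> {p. h x p \<noteq> \<zero>\<^bsub>R\<^esub>}"
      then have "p \<in> carrier P" using s by blast
      then show "g (h x p \<odot>\<^bsub>M\<^esub> y p) = f (h x p \<odot>\<^bsub>P\<^esub> p)"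
        using hR y by (simp add: mod_homD(3)[OF g] mod_homD(3)[OF f])
    qed simp
    also have "\<dots> = f (\<Oplus>\<^bsub>P\<^esub>p\<in>{p. h x p \<noteq> \<zero>\<^bsub>R\<^esub>}. h x p \<odot>\<^bsub>P\<^esub> p)"
      by (rule mod_hom_finsum[OF f P' N, symmetric]) (use s hR in \<open>auto intro!: P.smult_closed\<close>)
    also have "\<dots> = f x"
      using eh[OF x] unfolding lin_comb_def by simp
    finally show "g (lin_comb R M y (h x)) = f x" .
  qed
qed


section \<open>Comparison of resolutions\<close>

text \<open>Exactness separated from projectivity, so that the chain complex qualifies; what
  projectivity contributes enters later through \<open>lifts\<close>.\<close>

definition resolution ::
    "('a, 'x) ring_scheme \<Rightarrow> (nat \<Rightarrow> ('a, 'p, 'y) module_scheme) \<Rightarrow> (nat \<Rightarrow> 'p \<Rightarrow> 'p) \<Rightarrow> ('p \<Rightarrow> 'm)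
      \<Rightarrow> ('a, 'm, 'z) module_scheme \<Rightarrow> bool" where
  "resolution R P d e M \<longleftrightarrow>
     left_module R M \<and>
     (\<forall>n. left_module R (P n)) \<and>
     (\<forall>n. d n \<in> mod_hom R (P (Suc n)) (P n)) \<and>
     e \<in> mod_hom R (P 0) M \<and>
     e ` carrier (P 0) = carrier M \<and>
     d 0 ` carrier (P 1) = a_kernel (P 0) M e \<and>
     (\<forall>n. d (Suc n) ` carrier (P (Suc (Suc n))) = a_kernel (P (Suc n)) (P n) (d n))"

lemma (in abelian_group) minus_zero_eq: "\<ominus> \<zero> = \<zero>"
  using minus_equality[of \<zero> \<zero>] by simp

lemma a_kernel_iff: "x \<in> a_kernel M N h \<longleftrightarrow> x \<in> carrier M \<and> h x = \<zero>\<^bsub>N\<^esub>"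
  by (simp add: a_kernel_def' kernel_def)

lemma projective_resolution_imp_resolution:
  assumes "projective_resolution R P d e M" "left_module R M"
  shows "resolution R P d e M"
  using assms unfolding projective_resolution_def resolution_def projective_module_def by simp

lemma resolutionD:
  assumes "resolution R P d e M"
  shows "left_module R M" "left_module R (P n)" "d n \<in> mod_hom R (P (Suc n)) (P n)" "e \<in> mod_hom R (P 0) M"
    and "y \<in> carrier M \<Longrightarrow> y \<in> e ` carrier (P 0)"
    and "x \<in> carrier (P (Suc 0)) \<Longrightarrow> e (d 0 x) = \<zero>\<^bsub>M\<^esub>"
    and "x \<in> carrier (P (Suc (Suc n))) \<Longrightarrow> d n (d (Suc n) x) = \<zero>\<^bsub>P n\<^esub>"
    and "z \<in> carrier (P 0) \<Longrightarrow> e z = \<zero>\<^bsub>M\<^esub> \<Longrightarrow> z \<in> d 0 ` carrier (P (Suc 0))"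
    and "z \<in> carrier (P (Suc n)) \<Longrightarrow> d n z = \<zero>\<^bsub>P n\<^esub> \<Longrightarrow> z \<in> d (Suc n) ` carrier (P (Suc (Suc n)))"
proof -
  note r = assms[unfolded resolution_def]
  have k0: "d 0 ` carrier (P (Suc 0)) = a_kernel (P 0) M e" using r by simp
  have k: "d (Suc n) ` carrier (P (Suc (Suc n))) = a_kernel (P (Suc n)) (P n) (d n)" using r by blast
  show "left_module R M" "left_module R (P n)" "d n \<in> mod_hom R (P (Suc n)) (P n)" "e \<in> mod_hom R (P 0) M"
    "y \<in> carrier M \<Longrightarrow> y \<in> e ` carrier (P 0)" using r by auto
  show "x \<in> carrier (P (Suc 0)) \<Longrightarrow> e (d 0 x) = \<zero>\<^bsub>M\<^esub>"
    using k0 a_kernel_iff[of "d 0 x" "P 0" M e] by blast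
  show "x \<in> carrier (P (Suc (Suc n))) \<Longrightarrow> d n (d (Suc n) x) = \<zero>\<^bsub>P n\<^esub>"
    using k a_kernel_iff[of "d (Suc n) x" "P (Suc n)" "P n" "d n"] by blast
  show "z \<in> carrier (P 0) \<Longrightarrow> e z = \<zero>\<^bsub>M\<^esub> \<Longrightarrow> z \<in> d 0 ` carrier (P (Suc 0))"
    using k0 a_kernel_iff[of z "P 0" M e] by blast
  show "z \<in> carrier (P (Suc n)) \<Longrightarrow> d n z = \<zero>\<^bsub>P n\<^esub> \<Longrightarrow> z \<in> d (Suc n) ` carrier (P (Suc (Suc n)))"
    using k a_kernel_iff[of z "P (Suc n)" "P n" "d n"] by blast
qed

text \<open>The comparison theorem. Each component is chosen to fit the previous one, so the proof
  is a dependent choice.\<close>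

lemma chain_map_exists:
  assumes P: "resolution R P d e M" and C: "resolution R C \<delta> \<epsilon> M"
    and l0: "lifts R (P 0) (C 0) M" and l: "\<And>n. lifts R (P (Suc n)) (C (Suc n)) (C n)"
  obtains \<phi> where "\<And>n. \<phi> n \<in> mod_hom R (P n) (C n)"
    and "\<And>x. x \<in> carrier (P 0) \<Longrightarrow> \<epsilon> (\<phi> 0 x) = e x"
    and "\<And>n x. x \<in> carrier (P (Suc n)) \<Longrightarrow> \<delta> n (\<phi> (Suc n) x) = \<phi> n (d n x)"
proof -
  note PD = resolutionD[OF P] and CD = resolutionD[OF C]
  \<comment> \<open>The last conjunct keeps the recursion going: it says that the next map to be
    lifted takes its values in the image of the next differential of \<open>C\<close>.\<close>
  let ?I = "\<lambda>n f. f \<in> mod_hom R (P n) (C n) \<and> (n = 0 \<longrightarrow> (\<forall>x\<in>carrier (P 0). \<epsilon> (f x) = e x)) \<and>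
    (\<forall>x\<in>carrier (P (Suc n)). f (d n x) \<in> \<delta> n ` carrier (C (Suc n)))"
  have "\<exists>f. \<forall>n. ?I n (f n) \<and> (\<forall>x\<in>carrier (P (Suc n)). \<delta> n (f (Suc n) x) = f n (d n x))"
  proof (rule dependent_nat_choice)
    obtain f where f: "f \<in> mod_hom R (P 0) (C 0)" "\<And>x. x \<in> carrier (P 0) \<Longrightarrow> \<epsilon> (f x) = e x"
      by (rule liftsE[OF l0 PD(4) CD(4)]) (use mod_homD(1)[OF PD(4)] CD(5) in blast)+
    have "f (d 0 x) \<in> \<delta> 0 ` carrier (C (Suc 0))" if x: "x \<in> carrier (P (Suc 0))" for x
      using CD(8)[of "f (d 0 x)"] f PD(6)[OF x] mod_homD(1)[OF PD(3) x] mod_homD(1)[OF f(1)] by simp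
    with f show "\<exists>f. ?I 0 f" by blast
  next
    fix f n assume f: "?I n f"
    then have fh: "f \<in> mod_hom R (P n) (C n)" by blast
    obtain g where g: "g \<in> mod_hom R (P (Suc n)) (C (Suc n))"
      "\<And>x. x \<in> carrier (P (Suc n)) \<Longrightarrow> \<delta> n (g x) = f (d n x)"
      by (rule liftsE[OF l mod_hom_comp[OF PD(3) fh] CD(3)]) (use f in auto)
    have "g (d (Suc n) x) \<in> \<delta> (Suc n) ` carrier (C (Suc (Suc n)))" if x: "x \<in> carrier (P (Suc (Suc n)))" for x
      using CD(9)[of "g (d (Suc n) x)"] g PD(7)[OF x] mod_homD(1)[OF PD(3) x] mod_homD(1)[OF g(1)]
        mod_hom_zero[OF fh PD(2) CD(2)] by simp
    with g show "\<exists>g. ?I (Suc n) g \<and> (\<forall>x\<in>carrier (P (Suc n)). \<delta> n (g x) = f (d n x))" by blast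
  qed
  then show ?thesis using that by blast
qed

text \<open>The difference of the identity and \<open>\<theta>\<close> covers zero on
  \<open>M\<close>, hence is null-homotopic. The identity is recorded in positive degrees, where
  cocycles will be evaluated.\<close>

lemma homotopy_exists:
  assumes P: "resolution R P d e M" and l: "\<And>n. lifts R (P n) (P (Suc n)) (P n)"
    and \<theta>: "\<And>n. \<theta> n \<in> mod_hom R (P n) (P n)"
    and \<theta>0: "\<And>x. x \<in> carrier (P 0) \<Longrightarrow> e (\<theta> 0 x) = e x"
    and \<theta>d: "\<And>n x. x \<in> carrier (P (Suc n)) \<Longrightarrow> d n (\<theta> (Suc n) x) = \<theta> n (d n x)"
  obtains s where "\<And>n. s n \<in> mod_hom R (P n) (P (Suc n))"
    and "\<And>n x. x \<in> carrier (P (Suc n)) \<Longrightarrow>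
      x = \<theta> (Suc n) x \<oplus>\<^bsub>P (Suc n)\<^esub> d (Suc n) (s (Suc n) x) \<oplus>\<^bsub>P (Suc n)\<^esub> s n (d n x)"
proof -
  note PD = resolutionD[OF P]
  have ag: "abelian_group (P n)" for n using PD(2) by (rule left_module.axioms(2))
  have agM: "abelian_group M" using PD(1) by (rule left_module.axioms(2))
  have id: "(\<lambda>x. x) \<in> mod_hom R (P n) (P n)" for n by (rule mod_homI) simp_all
  define \<eta> where "\<eta> n x = x \<ominus>\<^bsub>P n\<^esub> \<theta> n x" for n x
  have \<eta>: "\<eta> n \<in> mod_hom R (P n) (P n)" for n
    unfolding \<eta>_def[abs_def] by (rule mod_hom_diff[OF PD(2) PD(2) id \<theta>])
  have \<eta>c: "\<eta> n x \<in> carrier (P n)" if "x \<in> carrier (P n)" for n x using mod_homD(1)[OF \<eta> that] .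
  have dc: "d n x \<in> carrier (P n)" if "x \<in> carrier (P (Suc n))" for n x using mod_homD(1)[OF PD(3) that] .
  have \<eta>0: "e (\<eta> 0 x) = \<zero>\<^bsub>M\<^esub>" if x: "x \<in> carrier (P 0)" for x
  proof -
    interpret P: abelian_group "P 0" by (rule ag)
    interpret M: abelian_group M by (rule agM)
    show ?thesis
      using x mod_homD(1)[OF \<theta> x] \<theta>0[OF x] mod_homD(1)[OF PD(4) x]
      by (simp add: \<eta>_def a_minus_def mod_homD[OF PD(4)] mod_hom_minus[OF PD(4) PD(2) PD(1)] M.r_neg)
  qed
  have \<eta>d: "d n (\<eta> (Suc n) x) = \<eta> n (d n x)" if x: "x \<in> carrier (P (Suc n))" for n x
  proof -
    interpret P: abelian_group "P (Suc n)" by (rule ag)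
    show ?thesis
      using x mod_homD(1)[OF \<theta> x] \<theta>d[OF x]
      by (simp add: \<eta>_def a_minus_def mod_homD[OF PD(3)] mod_hom_minus[OF PD(3) PD(2) PD(2)])
  qed
  \<comment> \<open>What the homotopy has not yet accounted for is a cycle, hence a boundary by
    exactness; carrying this along makes the next lift possible.\<close>
  let ?I = "\<lambda>n s. s \<in> mod_hom R (P n) (P (Suc n)) \<and>
    (\<forall>x\<in>carrier (P (Suc n)). \<eta> (Suc n) x \<ominus>\<^bsub>P (Suc n)\<^esub> s (d n x) \<in> d (Suc n) ` carrier (P (Suc (Suc n))))"
  have "\<exists>s. \<forall>n. ?I n (s n) \<and>
    (\<forall>x\<in>carrier (P (Suc n)). d (Suc n) (s (Suc n) x) = \<eta> (Suc n) x \<ominus>\<^bsub>P (Suc n)\<^esub> s n (d n x))"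
  proof (rule dependent_nat_choice)
    obtain s where s: "s \<in> mod_hom R (P 0) (P (Suc 0))" "\<And>x. x \<in> carrier (P 0) \<Longrightarrow> d 0 (s x) = \<eta> 0 x"
      by (rule liftsE[OF l \<eta> PD(3)]) (use PD(8) \<eta>c \<eta>0 in blast)+
    have "\<eta> (Suc 0) x \<ominus>\<^bsub>P (Suc 0)\<^esub> s (d 0 x) \<in> d (Suc 0) ` carrier (P (Suc (Suc 0)))"
      if x: "x \<in> carrier (P (Suc 0))" for x
    proof (rule PD(9))
      interpret P1: abelian_group "P (Suc 0)" by (rule ag)
      interpret P0: abelian_group "P 0" by (rule ag)
      have c: "\<eta> (Suc 0) x \<in> carrier (P (Suc 0))" "s (d 0 x) \<in> carrier (P (Suc 0))" "\<eta> 0 (d 0 x) \<in> carrier (P 0)"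
        using \<eta>c dc mod_homD(1)[OF s(1)] x by auto
      then show "\<eta> (Suc 0) x \<ominus>\<^bsub>P (Suc 0)\<^esub> s (d 0 x) \<in> carrier (P (Suc 0))" by simp
      show "d 0 (\<eta> (Suc 0) x \<ominus>\<^bsub>P (Suc 0)\<^esub> s (d 0 x)) = \<zero>\<^bsub>P 0\<^esub>"
        using c \<eta>d[OF x] s(2)[OF dc[OF x]]
        by (simp add: a_minus_def mod_homD(2)[OF PD(3)] mod_hom_minus[OF PD(3) PD(2) PD(2)] P0.r_neg)
    qed
    with s show "\<exists>s. ?I 0 s" by blast
  next
    fix s n assume s: "?I n s"
    then have sh: "s \<in> mod_hom R (P n) (P (Suc n))" by blast
    have h: "(\<lambda>x. \<eta> (Suc n) x \<ominus>\<^bsub>P (Suc n)\<^esub> s (d n x)) \<in> mod_hom R (P (Suc n)) (P (Suc n))"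
      by (rule mod_hom_diff[OF PD(2) PD(2) \<eta> mod_hom_comp[OF PD(3) sh]])
    obtain t where t: "t \<in> mod_hom R (P (Suc n)) (P (Suc (Suc n)))"
      "\<And>x. x \<in> carrier (P (Suc n)) \<Longrightarrow> d (Suc n) (t x) = \<eta> (Suc n) x \<ominus>\<^bsub>P (Suc n)\<^esub> s (d n x)"
      by (rule liftsE[OF l h PD(3)]) (use s in auto)
    have "\<eta> (Suc (Suc n)) x \<ominus>\<^bsub>P (Suc (Suc n))\<^esub> t (d (Suc n) x) \<in> d (Suc (Suc n)) ` carrier (P (Suc (Suc (Suc n))))"
      if x: "x \<in> carrier (P (Suc (Suc n)))" for x
    proof (rule PD(9))
      interpret P2: abelian_group "P (Suc (Suc n))" by (rule ag)
      interpret P1: abelian_group "P (Suc n)" by (rule ag)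
      have c: "\<eta> (Suc (Suc n)) x \<in> carrier (P (Suc (Suc n)))" "t (d (Suc n) x) \<in> carrier (P (Suc (Suc n)))"
        "\<eta> (Suc n) (d (Suc n) x) \<in> carrier (P (Suc n))"
        using \<eta>c dc mod_homD(1)[OF t(1)] x by auto
      then show "\<eta> (Suc (Suc n)) x \<ominus>\<^bsub>P (Suc (Suc n))\<^esub> t (d (Suc n) x) \<in> carrier (P (Suc (Suc n)))" by simp
      show "d (Suc n) (\<eta> (Suc (Suc n)) x \<ominus>\<^bsub>P (Suc (Suc n))\<^esub> t (d (Suc n) x)) = \<zero>\<^bsub>P (Suc n)\<^esub>"
        using c \<eta>d[OF x] t(2)[OF dc[OF x]] PD(7)[OF x] mod_hom_zero[OF sh PD(2) PD(2)]
        by (simp add: a_minus_def mod_homD(2)[OF PD(3)] mod_hom_minus[OF PD(3) PD(2) PD(2)] P1.r_neg P1.minus_zero_eq)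
    qed
    with t show "\<exists>t. ?I (Suc n) t \<and>
      (\<forall>x\<in>carrier (P (Suc n)). d (Suc n) (t x) = \<eta> (Suc n) x \<ominus>\<^bsub>P (Suc n)\<^esub> s (d n x))" by blast
  qed
  then obtain s where s: "\<And>n. s n \<in> mod_hom R (P n) (P (Suc n))"
    and sd: "\<And>n x. x \<in> carrier (P (Suc n)) \<Longrightarrow> d (Suc n) (s (Suc n) x) = \<eta> (Suc n) x \<ominus>\<^bsub>P (Suc n)\<^esub> s n (d n x)"
    by blast
  have "x = \<theta> (Suc n) x \<oplus>\<^bsub>P (Suc n)\<^esub> d (Suc n) (s (Suc n) x) \<oplus>\<^bsub>P (Suc n)\<^esub> s n (d n x)"
    if x: "x \<in> carrier (P (Suc n))" for n x
  proof -
    interpret P: abelian_group "P (Suc n)" by (rule ag)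
    have c: "\<theta> (Suc n) x \<in> carrier (P (Suc n))" "s n (d n x) \<in> carrier (P (Suc n))"
      using mod_homD(1)[OF \<theta> x] mod_homD(1)[OF s dc[OF x]] by auto
    then show ?thesis
      unfolding sd[OF x] \<eta>_def a_minus_def using x by (simp add: P.a_ac P.r_neg2 P.r_neg1 P.r_neg)
  qed
  then show ?thesis using that s by blast
qed

text \<open>With the homotopy \<open>s\<close>, the cocycle \<open>f\<close> is the sum of
  \<open>f \<psi> \<phi>\<close>, \<open>f d s\<close> and \<open>f s d\<close>. The middle term
  vanishes, and \<open>f \<psi>\<close> is a cocycle on \<open>C\<close>, hence of the form
  \<open>g \<delta>\<close>. So \<open>g \<phi> + f s\<close> is a primitive of \<open>f\<close>. A
  homotopy on the side of \<open>P\<close> suffices.\<close>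

lemma cocycle_extends_transfer:
  assumes P: "resolution R P d e M" and C: "resolution R C \<delta> \<epsilon> M" and N: "left_module R N"
    and l0: "lifts R (P 0) (C 0) M" and l: "\<And>n. lifts R (P (Suc n)) (C (Suc n)) (C n)"
    and l0': "lifts R (C 0) (P 0) M" and l': "\<And>n. lifts R (C (Suc n)) (P (Suc n)) (P n)"
    and lh: "\<And>n. lifts R (P n) (P (Suc n)) (P n)"
    and ext: "\<And>f. f \<in> mod_hom R (C (Suc j)) N \<Longrightarrow> (\<And>x. x \<in> carrier (C (Suc (Suc j))) \<Longrightarrow> f (\<delta> (Suc j) x) = \<zero>\<^bsub>N\<^esub>)
      \<Longrightarrow> \<exists>g\<in>mod_hom R (C j) N. \<forall>x\<in>carrier (C (Suc j)). f x = g (\<delta> j x)"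
    and f: "f \<in> mod_hom R (P (Suc j)) N" and fd: "\<And>x. x \<in> carrier (P (Suc (Suc j))) \<Longrightarrow> f (d (Suc j) x) = \<zero>\<^bsub>N\<^esub>"
  shows "\<exists>g\<in>mod_hom R (P j) N. \<forall>x\<in>carrier (P (Suc j)). f x = g (d j x)"
proof -
  note PD = resolutionD[OF P] and CD = resolutionD[OF C]
  interpret N: left_module R N by fact
  obtain \<phi> where \<phi>: "\<And>n. \<phi> n \<in> mod_hom R (P n) (C n)"
    "\<And>x. x \<in> carrier (P 0) \<Longrightarrow> \<epsilon> (\<phi> 0 x) = e x"
    "\<And>n x. x \<in> carrier (P (Suc n)) \<Longrightarrow> \<delta> n (\<phi> (Suc n) x) = \<phi> n (d n x)"
    by (rule chain_map_exists[OF P C l0 l]) blast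
  obtain \<psi> where \<psi>: "\<And>n. \<psi> n \<in> mod_hom R (C n) (P n)"
    "\<And>x. x \<in> carrier (C 0) \<Longrightarrow> e (\<psi> 0 x) = \<epsilon> x"
    "\<And>n x. x \<in> carrier (C (Suc n)) \<Longrightarrow> d n (\<psi> (Suc n) x) = \<psi> n (\<delta> n x)"
    by (rule chain_map_exists[OF C P l0' l']) blast
  have \<phi>c: "x \<in> carrier (P n) \<Longrightarrow> \<phi> n x \<in> carrier (C n)" for n x using mod_homD(1)[OF \<phi>(1)] .
  have \<psi>c: "x \<in> carrier (C n) \<Longrightarrow> \<psi> n x \<in> carrier (P n)" for n x using mod_homD(1)[OF \<psi>(1)] .
  have dc: "d n x \<in> carrier (P n)" if "x \<in> carrier (P (Suc n))" for n x using mod_homD(1)[OF PD(3) that] .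
  obtain s where s: "\<And>n. s n \<in> mod_hom R (P n) (P (Suc n))"
    and sd: "\<And>n x. x \<in> carrier (P (Suc n)) \<Longrightarrow>
      x = \<psi> (Suc n) (\<phi> (Suc n) x) \<oplus>\<^bsub>P (Suc n)\<^esub> d (Suc n) (s (Suc n) x) \<oplus>\<^bsub>P (Suc n)\<^esub> s n (d n x)"
    by (rule homotopy_exists[OF P lh, of "\<lambda>n x. \<psi> n (\<phi> n x)"])
      (auto intro: mod_hom_comp[OF \<phi>(1) \<psi>(1)] simp: \<phi> \<psi> \<phi>c)
  have "\<exists>g\<in>mod_hom R (C j) N. \<forall>x\<in>carrier (C (Suc j)). f (\<psi> (Suc j) x) = g (\<delta> j x)"
    by (rule ext[OF mod_hom_comp[OF \<psi>(1) f]]) (simp add: \<psi>(3)[symmetric] fd \<psi>c)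
  then obtain g where g: "g \<in> mod_hom R (C j) N" "\<And>x. x \<in> carrier (C (Suc j)) \<Longrightarrow> f (\<psi> (Suc j) x) = g (\<delta> j x)"
    by blast
  show ?thesis
  proof (rule bexI, rule ballI)
    show "(\<lambda>x. g (\<phi> j x) \<oplus>\<^bsub>N\<^esub> f (s j x)) \<in> mod_hom R (P j) N"
      by (rule mod_hom_add[OF PD(2) N mod_hom_comp[OF \<phi>(1) g(1)] mod_hom_comp[OF s f]])
    fix x assume x: "x \<in> carrier (P (Suc j))"
    interpret P: abelian_group "P (Suc j)" using PD(2) by (rule left_module.axioms(2))
    have c: "\<psi> (Suc j) (\<phi> (Suc j) x) \<in> carrier (P (Suc j))" "s (Suc j) x \<in> carrier (P (Suc (Suc j)))"
      "s j (d j x) \<in> carrier (P (Suc j))" "d (Suc j) (s (Suc j) x) \<in> carrier (P (Suc j))"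
      using x \<phi>c \<psi>c dc mod_homD(1)[OF s] by auto
    have "f x = f (\<psi> (Suc j) (\<phi> (Suc j) x) \<oplus>\<^bsub>P (Suc j)\<^esub> d (Suc j) (s (Suc j) x) \<oplus>\<^bsub>P (Suc j)\<^esub> s j (d j x))"
      using sd[OF x] by simp
    also have "\<dots> = g (\<phi> j (d j x)) \<oplus>\<^bsub>N\<^esub> f (s j (d j x))"
      using c mod_homD(1)[OF f c(1)] x
      by (simp add: mod_homD(2)[OF f] fd g(2)[OF \<phi>c] \<phi>(3))
    finally show "f x = g (\<phi> j (d j x)) \<oplus>\<^bsub>N\<^esub> f (s j (d j x))" .
  qed
qed

section \<open>Vanishing of Ext\<close>

lemma hom_group_comm_group:
  assumes M: "left_module R M" and N: "left_module R N"
  shows "comm_group (hom_group R M N)"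
proof -
  interpret M: left_module R M by fact
  interpret N: left_module R N by fact
  let ?H = "hom_group R M N"
  have cl: "f \<in> carrier ?H \<longleftrightarrow> f \<in> mod_hom R M N \<and> f \<in> extensional (carrier M)" for f
    by (simp add: hom_group_def)
  have vals: "f x \<in> carrier N" if "f \<in> carrier ?H" "x \<in> carrier M" for f x
    using that by (auto simp: cl intro: mod_homD(1))
  have ext: "f = g" if "f \<in> carrier ?H" "g \<in> carrier ?H" "\<And>x. x \<in> carrier M \<Longrightarrow> f x = g x" for f g
    using that by (auto simp: cl intro: extensionalityI)
  have mult: "(f \<otimes>\<^bsub>?H\<^esub> g) x = f x \<oplus>\<^bsub>N\<^esub> g x" if "x \<in> carrier M" for f g x
    using that by (simp add: hom_group_def)
  have one: "\<one>\<^bsub>?H\<^esub> x = \<zero>\<^bsub>N\<^esub>" if "x \<in> carrier M" for x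
    using that by (simp add: hom_group_def)
  have mc: "f \<otimes>\<^bsub>?H\<^esub> g \<in> carrier ?H" if "f \<in> carrier ?H" "g \<in> carrier ?H" for f g
    using that mod_hom_restrict[OF M mod_hom_add[OF M N, of f g]] by (auto simp: hom_group_def)
  have oc: "\<one>\<^bsub>?H\<^esub> \<in> carrier ?H"
    unfolding cl by (auto simp: hom_group_def N.smult_r_null intro!: mod_homI M.smult_closed)
  show ?thesis
  proof (rule comm_groupI)
    fix f assume f: "f \<in> carrier ?H"
    let ?g = "\<lambda>x\<in>carrier M. \<ominus>\<^bsub>N\<^esub> f x"
    have g: "?g \<in> carrier ?H"
      unfolding cl using mod_hom_restrict[OF M mod_hom_neg[OF M N, of f]] f by (simp add: cl)
    show "\<exists>g\<in>carrier ?H. g \<otimes>\<^bsub>?H\<^esub> f = \<one>\<^bsub>?H\<^esub>"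
      by (rule bexI[OF _ g], rule ext[OF mc[OF g f] oc]) (simp add: mult one N.M.l_neg vals f)
  next
    fix f g h assume fgh: "f \<in> carrier ?H" "g \<in> carrier ?H" "h \<in> carrier ?H"
    show "f \<otimes>\<^bsub>?H\<^esub> g \<otimes>\<^bsub>?H\<^esub> h = f \<otimes>\<^bsub>?H\<^esub> (g \<otimes>\<^bsub>?H\<^esub> h)"
      by (rule ext) (simp_all add: mc fgh mult N.M.a_assoc vals)
    show "f \<otimes>\<^bsub>?H\<^esub> g = g \<otimes>\<^bsub>?H\<^esub> f"
      by (rule ext) (simp_all add: mc fgh mult N.M.a_comm vals)
    show "\<one>\<^bsub>?H\<^esub> \<otimes>\<^bsub>?H\<^esub> f = f"
      by (rule ext) (simp_all add: mc oc fgh mult one vals)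
  qed (auto intro: mc oc)
qed

text \<open>\<open>T\<close> has its own name because in the application it is the image of a
  differential and \<open>S\<close> the kernel of the next; their equality is the exactness to be
  supplied.\<close>

lemma (in comm_group) trivial_quotient:
  assumes S: "subgroup S G" and "T = S"
  shows "trivial_group (G\<lparr>carrier := S\<rparr> Mod T)"
proof -
  interpret S: group "G\<lparr>carrier := S\<rparr>" using subgroup.subgroup_is_group[OF S is_group] .
  have sub: "subgroup S (G\<lparr>carrier := S\<rparr>)" using S.subgroup_self by simp
  have n: "S \<lhd> (G\<lparr>carrier := S\<rparr>)"
    using S.normal_self by simp
  interpret n: normal S "G\<lparr>carrier := S\<rparr>" by (rule n)
  have "rcosets\<^bsub>G\<lparr>carrier := S\<rparr>\<^esub> S \<subseteq> {S}"
    using S.coset_join2[OF _ sub] by (auto simp: RCOSETS_def)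
  then have "carrier (G\<lparr>carrier := S\<rparr> Mod S) \<subseteq> {\<one>\<^bsub>G\<lparr>carrier := S\<rparr> Mod S\<^esub>}"
    by (simp add: FactGroup_def)
  then show ?thesis
    using n.factorgroup_is_group assms(2) group.trivial_group_subset by blast
qed

text \<open>Reduces vanishing of Ext in positive degree to the factorisation of cocycles through the
  differential. \<open>hom_group\<close> consists of extensional functions while
  \<open>mod_hom\<close> does not, so primitives are restricted on the way back.\<close>

lemma ext_group_trivial:
  fixes P :: "nat \<Rightarrow> ('a, 'p) module" and N :: "('a, 'n, 'w) module_scheme"
  assumes P: "\<And>n. left_module R (P n)" and d: "\<And>n. d n \<in> mod_hom R (P (Suc n)) (P n)"
    and dd: "\<And>n x. x \<in> carrier (P (Suc (Suc n))) \<Longrightarrow> d n (d (Suc n) x) = \<zero>\<^bsub>P n\<^esub>"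
    and N: "left_module R N"
    and ext: "\<And>f. f \<in> mod_hom R (P (Suc j)) N \<Longrightarrow> (\<And>x. x \<in> carrier (P (Suc (Suc j))) \<Longrightarrow> f (d (Suc j) x) = \<zero>\<^bsub>N\<^esub>)
      \<Longrightarrow> \<exists>g\<in>mod_hom R (P j) N. \<forall>x\<in>carrier (P (Suc j)). f x = g (d j x)"
  shows "trivial_group (ext_group R P d N (Suc j))"
proof -
  define H where "H n = hom_group R (P n) N" for n
  define \<delta> where "\<delta> n h = compose (carrier (P (Suc n))) h (d n)" for n and h :: "'p \<Rightarrow> 'n"
  interpret N: left_module R N by fact
  have cl: "f \<in> carrier (H n) \<longleftrightarrow> f \<in> mod_hom R (P n) N \<and> f \<in> extensional (carrier (P n))" for f n
    by (simp add: H_def hom_group_def)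
  have dc: "d n x \<in> carrier (P n)" if "x \<in> carrier (P (Suc n))" for n x using mod_homD(1)[OF d that] .
  have \<delta>: "\<delta> n h \<in> carrier (H (Suc n))" if "h \<in> carrier (H n)" for n h
    using mod_hom_restrict[OF P mod_hom_comp[OF d[of n], where g=h and N=N]] that
    unfolding cl by (simp add: \<delta>_def compose_def)
  have eq: "f = g" if "f \<in> carrier (H n)" "g \<in> carrier (H n)" "\<And>x. x \<in> carrier (P n) \<Longrightarrow> f x = g x" for f g n
    using that by (auto simp: cl intro: extensionalityI)
  have one: "\<one>\<^bsub>H n\<^esub> x = \<zero>\<^bsub>N\<^esub>" if "x \<in> carrier (P n)" for n x
    using that by (simp add: H_def hom_group_def)
  have cg: "comm_group (H n)" for n unfolding H_def by (rule hom_group_comm_group[OF P N])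
  have "\<delta> (Suc j) \<in> hom (H (Suc j)) (H (Suc (Suc j)))"
    using \<delta> dc by (auto simp: hom_def H_def \<delta>_def compose_def hom_group_def fun_eq_iff)
  then interpret \<delta>: group_hom "H (Suc j)" "H (Suc (Suc j))" "\<delta> (Suc j)"
    using cg by (simp add: group_hom_def group_hom_axioms_def comm_group.axioms(2))
  let ?K = "kernel (H (Suc j)) (H (Suc (Suc j))) (\<delta> (Suc j))"
  have "\<delta> j ` carrier (H j) = ?K"
  proof
    show "\<delta> j ` carrier (H j) \<subseteq> ?K"
    proof safe
      fix h assume h: "h \<in> carrier (H j)"
      have "\<delta> (Suc j) (\<delta> j h) = \<one>\<^bsub>H (Suc (Suc j))\<^esub>"
      proof (rule eq)
        fix x assume x: "x \<in> carrier (P (Suc (Suc j)))"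
        have "h \<zero>\<^bsub>P j\<^esub> = \<zero>\<^bsub>N\<^esub>" using h mod_hom_zero[OF _ P N] by (simp add: cl)
        then show "\<delta> (Suc j) (\<delta> j h) x = \<one>\<^bsub>H (Suc (Suc j))\<^esub> x"
          using x dc[OF x] dd[OF x] by (simp add: \<delta>_def compose_def one)
      qed (simp_all add: \<delta> h)
      then show "\<delta> j h \<in> ?K" using \<delta>[OF h] by (simp add: kernel_def)
    qed
    show "?K \<subseteq> \<delta> j ` carrier (H j)"
    proof
      fix f assume "f \<in> ?K"
      then have f: "f \<in> carrier (H (Suc j))" and \<delta>f: "\<delta> (Suc j) f = \<one>\<^bsub>H (Suc (Suc j))\<^esub>"
        by (simp_all add: kernel_def)
      have "f (d (Suc j) x) = \<zero>\<^bsub>N\<^esub>" if x: "x \<in> carrier (P (Suc (Suc j)))" for x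
        using fun_cong[OF \<delta>f, of x] x by (simp add: \<delta>_def compose_def one)
      then obtain g where g: "g \<in> mod_hom R (P j) N" "\<And>x. x \<in> carrier (P (Suc j)) \<Longrightarrow> f x = g (d j x)"
        using ext f cl by blast
      have gr: "restrict g (carrier (P j)) \<in> carrier (H j)"
        using mod_hom_restrict[OF P g(1)] by (simp add: cl)
      have "f = \<delta> j (restrict g (carrier (P j)))"
        by (rule eq[OF f \<delta>[OF gr]]) (simp add: \<delta>_def compose_def dc g(2))
      with gr show "f \<in> \<delta> j ` carrier (H j)" by blast
    qed
  qed
  then have "trivial_group (H (Suc j)\<lparr>carrier := ?K\<rparr> Mod (\<delta> j ` carrier (H j)))"
    by (rule comm_group.trivial_quotient[OF cg \<delta>.subgroup_kernel])
  then show ?thesis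
    by (simp add: ext_group_def Let_def H_def[abs_def] \<delta>_def[abs_def])
qed


section \<open>Modules over the monoid algebra spanned by a partial action\<close>

text \<open>\<open>k\<close> times the basis vector \<open>t\<close>. For \<open>t\<close> outside
  \<open>T\<close> it is the zero vector, so a partial action can be written as if it were
  total.\<close>

definition sing :: "('k, 'x) ring_scheme \<Rightarrow> 't set \<Rightarrow> 'k \<Rightarrow> 't \<Rightarrow> 't \<Rightarrow> 'k" where
  "sing K T k t = (\<lambda>x\<in>T. if x = t then k else \<zero>\<^bsub>K\<^esub>)"

text \<open>For \<open>T = carrier B\<close> and \<open>act\<close> the multiplication of
  \<open>B\<close> this is the product of the monoid algebra.\<close>

definition scal :: "('k, 'x) ring_scheme \<Rightarrow> ('b, 'y) monoid_scheme \<Rightarrow> 't set \<Rightarrow> ('b \<Rightarrow> 't \<Rightarrow> 't)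
    \<Rightarrow> ('b \<Rightarrow> 'k) \<Rightarrow> ('t \<Rightarrow> 'k) \<Rightarrow> 't \<Rightarrow> 'k" where
  "scal K B T act r x = (\<lambda>t\<in>T. \<Oplus>\<^bsub>K\<^esub>p\<in>{p \<in> carrier B \<times> T. act (fst p) (snd p) = t}. r (fst p) \<otimes>\<^bsub>K\<^esub> x (snd p))"

text \<open>An element of \<open>T\<close> that the action moves out of \<open>T\<close> is sent to \<open>0\<close>.\<close>

definition span_module ::
    "('k, 'x) ring_scheme \<Rightarrow> ('b, 'y) monoid_scheme \<Rightarrow> 't set \<Rightarrow> ('b \<Rightarrow> 't \<Rightarrow> 't) \<Rightarrow> ('b \<Rightarrow> 'k, 't \<Rightarrow> 'k) module" where
  "span_module K B T act = \<lparr>carrier = T \<rightarrow>\<^sub>E carrier K, monoid.mult = undefined, one = undefined,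
     ring.zero = (\<lambda>t\<in>T. \<zero>\<^bsub>K\<^esub>), ring.add = (\<lambda>x y. \<lambda>t\<in>T. x t \<oplus>\<^bsub>K\<^esub> y t), smult = scal K B T act\<rparr>"

lemma abelian_group_pointwise:
  assumes "ring K" and "carrier G = T \<rightarrow>\<^sub>E carrier K" and "\<zero>\<^bsub>G\<^esub> = (\<lambda>t\<in>T. \<zero>\<^bsub>K\<^esub>)"
    and "(\<oplus>\<^bsub>G\<^esub>) = (\<lambda>x y. \<lambda>t\<in>T. x t \<oplus>\<^bsub>K\<^esub> y t)"
  shows "abelian_group G"
proof -
  interpret K: ring K by fact
  have cl: "x t \<in> carrier K" if "x \<in> carrier G" "t \<in> T" for x t using that by (auto simp: assms(2))
  have ac: "x \<oplus>\<^bsub>G\<^esub> y \<in> carrier G" if "x \<in> carrier G" "y \<in> carrier G" for x y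
    using that by (auto simp: assms(2,4) PiE_def)
  have at: "(x \<oplus>\<^bsub>G\<^esub> y) t = x t \<oplus>\<^bsub>K\<^esub> y t" if "t \<in> T" for x y t using that by (simp add: assms(4))
  have zt: "\<zero>\<^bsub>G\<^esub> t = \<zero>\<^bsub>K\<^esub>" if "t \<in> T" for t using that by (simp add: assms(3))
  have zc: "\<zero>\<^bsub>G\<^esub> \<in> carrier G" by (auto simp: assms(2,3) PiE_def)
  have eq: "x = y" if "x \<in> carrier G" "y \<in> carrier G" "\<And>t. t \<in> T \<Longrightarrow> x t = y t" for x y
    using that unfolding assms(2) by (rule PiE_ext)
  show ?thesis
  proof (rule abelian_groupI)
    fix x assume x: "x \<in> carrier G"
    have n: "(\<lambda>t\<in>T. \<ominus>\<^bsub>K\<^esub> x t) \<in> carrier G" using cl[OF x] by (auto simp: assms(2) PiE_def)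
    show "\<exists>y\<in>carrier G. y \<oplus>\<^bsub>G\<^esub> x = \<zero>\<^bsub>G\<^esub>"
      by (rule bexI[OF _ n], rule eq[OF ac[OF n x] zc]) (simp add: at zt K.l_neg cl x)
  next
    fix x y z assume xyz: "x \<in> carrier G" "y \<in> carrier G" "z \<in> carrier G"
    show "x \<oplus>\<^bsub>G\<^esub> y \<oplus>\<^bsub>G\<^esub> z = x \<oplus>\<^bsub>G\<^esub> (y \<oplus>\<^bsub>G\<^esub> z)"
      by (rule eq) (simp_all add: xyz ac at cl K.a_assoc)
    show "x \<oplus>\<^bsub>G\<^esub> y = y \<oplus>\<^bsub>G\<^esub> x"
      by (rule eq) (simp_all add: xyz ac at cl K.a_comm)
    show "\<zero>\<^bsub>G\<^esub> \<oplus>\<^bsub>G\<^esub> x = x"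
      by (rule eq) (simp_all add: xyz ac zc at zt cl)
  qed (auto intro: ac zc)
qed

lemma sing_closed:
  assumes "ring K" "k \<in> carrier K" shows "sing K T k t \<in> T \<rightarrow>\<^sub>E carrier K"
proof -
  interpret K: ring K by fact
  show ?thesis using assms(2) by (auto simp: sing_def)
qed

lemma sing_outside: "t \<notin> T \<Longrightarrow> sing K T k t = (\<lambda>t\<in>T. \<zero>\<^bsub>K\<^esub>)"
  by (auto simp: sing_def fun_eq_iff)

lemma sing_zero: "sing K T \<zero>\<^bsub>K\<^esub> t = (\<lambda>t\<in>T. \<zero>\<^bsub>K\<^esub>)"
  by (auto simp: sing_def fun_eq_iff)

lemma span_induct [consumes 3, case_names zero add sing]:
  assumes "ring K" "finite T" "x \<in> T \<rightarrow>\<^sub>E carrier K"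
    and zero: "P (\<lambda>t\<in>T. \<zero>\<^bsub>K\<^esub>)"
    and add: "\<And>x y. \<lbrakk>x \<in> T \<rightarrow>\<^sub>E carrier K; y \<in> T \<rightarrow>\<^sub>E carrier K; P x; P y\<rbrakk> \<Longrightarrow> P (\<lambda>t\<in>T. x t \<oplus>\<^bsub>K\<^esub> y t)"
    and sing: "\<And>k t. \<lbrakk>k \<in> carrier K; t \<in> T\<rbrakk> \<Longrightarrow> P (sing K T k t)"
  shows "P x"
proof -
  interpret K: ring K by fact
  \<comment> \<open>Truncations of \<open>x\<close> to growing subsets of \<open>T\<close>; each
    step adds one multiple of a basis vector.\<close>
  let ?x = "\<lambda>S. \<lambda>t\<in>T. if t \<in> S then x t else \<zero>\<^bsub>K\<^esub>"
  have x: "x t \<in> carrier K" if "t \<in> T" for t using assms(3) that by auto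
  have "P (?x S)" if "S \<subseteq> T" for S
    using finite_subset[OF that assms(2)] that
  proof (induction S)
    case empty
    then show ?case using zero by (simp add: restrict_def)
  next
    case (insert s S)
    have "P (\<lambda>t\<in>T. ?x S t \<oplus>\<^bsub>K\<^esub> sing K T (x s) s t)"
      using insert x by (intro add sing sing_closed assms(1)) auto
    moreover have "(\<lambda>t\<in>T. ?x S t \<oplus>\<^bsub>K\<^esub> sing K T (x s) s t) = ?x (insert s S)"
      using insert x by (auto simp: fun_eq_iff sing_def)
    ultimately show ?case by (simp only:)
  qed
  moreover have "?x T = x" using assms(3) by (auto simp: fun_eq_iff PiE_def extensional_def)
  ultimately show ?thesis by (metis order_refl)
qed

section \<open>The algebra of a finite left regular band and its partial actions\<close>

locale lrb_algebra = left_regular_band_monoid B + K: field K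
  for B :: "('b, 'y) monoid_scheme" (structure) and K :: "('k, 'x) ring_scheme" +
  assumes finite_B: "finite (carrier B)"
begin

abbreviation "RB \<equiv> carrier B \<rightarrow>\<^sub>E carrier K"
abbreviation "A \<equiv> monoid_algebra K B"
abbreviation "sc k \<equiv> sing K (carrier B) k \<one>"
abbreviation "dl b \<equiv> sing K (carrier B) \<one>\<^bsub>K\<^esub> b"

end

text \<open>The action is total on \<open>W\<close>, and by \<open>act_T\<close> what lies outside
  \<open>T\<close> never returns to it. So the span of \<open>T\<close> is the quotient of the span
  of \<open>W\<close> by the stable span of \<open>W - T\<close>.\<close>

locale bset = lrb_algebra B K
  for B :: "('b, 'y) monoid_scheme" (structure) and K :: "('k, 'x) ring_scheme" +
  fixes W T :: "'t set" and act :: "'b \<Rightarrow> 't \<Rightarrow> 't"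
  assumes finite_T: "finite T" and T_W: "T \<subseteq> W"
    and act_closed: "\<lbrakk>b \<in> carrier B; w \<in> W\<rbrakk> \<Longrightarrow> act b w \<in> W"
    and act_mult: "\<lbrakk>a \<in> carrier B; b \<in> carrier B; w \<in> W\<rbrakk> \<Longrightarrow> act a (act b w) = act (a \<otimes> b) w"
    and act_one: "w \<in> W \<Longrightarrow> act \<one> w = w"
    and act_T: "\<lbrakk>b \<in> carrier B; w \<in> W; act b w \<in> T\<rbrakk> \<Longrightarrow> w \<in> T"
begin

abbreviation "V \<equiv> T \<rightarrow>\<^sub>E carrier K"

lemma scal_term_closed:
  assumes "r \<in> RB" "x \<in> V"
  shows "(\<lambda>p. r (fst p) \<otimes>\<^bsub>K\<^esub> x (snd p)) \<in> {p \<in> carrier B \<times> T. act (fst p) (snd p) = t} \<rightarrow> carrier K"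
proof
  fix p assume "p \<in> {p \<in> carrier B \<times> T. act (fst p) (snd p) = t}"
  then have "fst p \<in> carrier B" "snd p \<in> T" by auto
  with assms have "r (fst p) \<in> carrier K" "x (snd p) \<in> carrier K" by auto
  then show "r (fst p) \<otimes>\<^bsub>K\<^esub> x (snd p) \<in> carrier K" by simp
qed

lemma scal_closed: "r \<in> RB \<Longrightarrow> x \<in> V \<Longrightarrow> scal K B T act r x \<in> V"
  unfolding scal_def restrict_PiE_iff by (intro ballI K.finsum_closed scal_term_closed)

lemma scal_add_r:
  assumes "r \<in> RB" "x \<in> V" "y \<in> V"
  shows "scal K B T act r (\<lambda>t\<in>T. x t \<oplus>\<^bsub>K\<^esub> y t) = (\<lambda>t\<in>T. scal K B T act r x t \<oplus>\<^bsub>K\<^esub> scal K B T act r y t)"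
proof (rule ext)
  fix t
  let ?A = "{p \<in> carrier B \<times> T. act (fst p) (snd p) = t}"
  have "(\<Oplus>\<^bsub>K\<^esub>p\<in>?A. r (fst p) \<otimes>\<^bsub>K\<^esub> (\<lambda>t\<in>T. x t \<oplus>\<^bsub>K\<^esub> y t) (snd p))
      = (\<Oplus>\<^bsub>K\<^esub>p\<in>?A. r (fst p) \<otimes>\<^bsub>K\<^esub> x (snd p) \<oplus>\<^bsub>K\<^esub> r (fst p) \<otimes>\<^bsub>K\<^esub> y (snd p))"
  proof (rule K.finsum_cong')
    show "(\<lambda>p. r (fst p) \<otimes>\<^bsub>K\<^esub> x (snd p) \<oplus>\<^bsub>K\<^esub> r (fst p) \<otimes>\<^bsub>K\<^esub> y (snd p)) \<in> ?A \<rightarrow> carrier K"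
      by (intro Pi_I K.a_closed funcset_mem[OF scal_term_closed[OF assms(1,2)]]
          funcset_mem[OF scal_term_closed[OF assms(1,3)]])
    fix p assume "p \<in> ?A"
    then have "fst p \<in> carrier B" "snd p \<in> T" by auto
    moreover from this have "r (fst p) \<in> carrier K" "x (snd p) \<in> carrier K" "y (snd p) \<in> carrier K"
      using assms by auto
    ultimately show "r (fst p) \<otimes>\<^bsub>K\<^esub> (\<lambda>t\<in>T. x t \<oplus>\<^bsub>K\<^esub> y t) (snd p)
        = r (fst p) \<otimes>\<^bsub>K\<^esub> x (snd p) \<oplus>\<^bsub>K\<^esub> r (fst p) \<otimes>\<^bsub>K\<^esub> y (snd p)" by (simp add: K.r_distr)
  qed simp
  also have "\<dots> = (\<Oplus>\<^bsub>K\<^esub>p\<in>?A. r (fst p) \<otimes>\<^bsub>K\<^esub> x (snd p)) \<oplus>\<^bsub>K\<^esub> (\<Oplus>\<^bsub>K\<^esub>p\<in>?A. r (fst p) \<otimes>\<^bsub>K\<^esub> y (snd p))"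
    by (rule K.finsum_addf[OF scal_term_closed[OF assms(1,2)] scal_term_closed[OF assms(1,3)]])
  finally show "scal K B T act r (\<lambda>t\<in>T. x t \<oplus>\<^bsub>K\<^esub> y t) t = (\<lambda>t\<in>T. scal K B T act r x t \<oplus>\<^bsub>K\<^esub> scal K B T act r y t) t"
    by (simp add: scal_def)
qed

lemma scal_add_l:
  assumes "r \<in> RB" "q \<in> RB" "x \<in> V"
  shows "scal K B T act (\<lambda>b\<in>carrier B. r b \<oplus>\<^bsub>K\<^esub> q b) x = (\<lambda>t\<in>T. scal K B T act r x t \<oplus>\<^bsub>K\<^esub> scal K B T act q x t)"
proof (rule ext)
  fix t
  let ?A = "{p \<in> carrier B \<times> T. act (fst p) (snd p) = t}"
  have "(\<Oplus>\<^bsub>K\<^esub>p\<in>?A. (\<lambda>b\<in>carrier B. r b \<oplus>\<^bsub>K\<^esub> q b) (fst p) \<otimes>\<^bsub>K\<^esub> x (snd p))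
      = (\<Oplus>\<^bsub>K\<^esub>p\<in>?A. r (fst p) \<otimes>\<^bsub>K\<^esub> x (snd p) \<oplus>\<^bsub>K\<^esub> q (fst p) \<otimes>\<^bsub>K\<^esub> x (snd p))"
  proof (rule K.finsum_cong')
    show "(\<lambda>p. r (fst p) \<otimes>\<^bsub>K\<^esub> x (snd p) \<oplus>\<^bsub>K\<^esub> q (fst p) \<otimes>\<^bsub>K\<^esub> x (snd p)) \<in> ?A \<rightarrow> carrier K"
      by (intro Pi_I K.a_closed funcset_mem[OF scal_term_closed[OF assms(1,3)]]
          funcset_mem[OF scal_term_closed[OF assms(2,3)]])
    fix p assume "p \<in> ?A"
    then have "fst p \<in> carrier B" "snd p \<in> T" by auto
    moreover from this have "r (fst p) \<in> carrier K" "x (snd p) \<in> carrier K" "q (fst p) \<in> carrier K"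
      using assms by auto
    ultimately show "(\<lambda>b\<in>carrier B. r b \<oplus>\<^bsub>K\<^esub> q b) (fst p) \<otimes>\<^bsub>K\<^esub> x (snd p)
        = r (fst p) \<otimes>\<^bsub>K\<^esub> x (snd p) \<oplus>\<^bsub>K\<^esub> q (fst p) \<otimes>\<^bsub>K\<^esub> x (snd p)" by (simp add: K.l_distr)
  qed simp
  also have "\<dots> = (\<Oplus>\<^bsub>K\<^esub>p\<in>?A. r (fst p) \<otimes>\<^bsub>K\<^esub> x (snd p)) \<oplus>\<^bsub>K\<^esub> (\<Oplus>\<^bsub>K\<^esub>p\<in>?A. q (fst p) \<otimes>\<^bsub>K\<^esub> x (snd p))"
    by (rule K.finsum_addf[OF scal_term_closed[OF assms(1,3)] scal_term_closed[OF assms(2,3)]])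
  finally show "scal K B T act (\<lambda>b\<in>carrier B. r b \<oplus>\<^bsub>K\<^esub> q b) x t = (\<lambda>t\<in>T. scal K B T act r x t \<oplus>\<^bsub>K\<^esub> scal K B T act q x t) t"
    by (simp add: scal_def)
qed

lemma scal_zero_r:
  assumes "r \<in> RB" shows "scal K B T act r (\<lambda>t\<in>T. \<zero>\<^bsub>K\<^esub>) = (\<lambda>t\<in>T. \<zero>\<^bsub>K\<^esub>)"
  unfolding scal_def
proof (rule restrict_ext)
  fix t
  let ?A = "{p \<in> carrier B \<times> T. act (fst p) (snd p) = t}"
  have "(\<Oplus>\<^bsub>K\<^esub>p\<in>?A. r (fst p) \<otimes>\<^bsub>K\<^esub> (\<lambda>t\<in>T. \<zero>\<^bsub>K\<^esub>) (snd p)) = (\<Oplus>\<^bsub>K\<^esub>p\<in>?A. \<zero>\<^bsub>K\<^esub>)"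
    by (rule K.finsum_cong') (use PiE_mem[OF assms] in auto)
  then show "(\<Oplus>\<^bsub>K\<^esub>p\<in>?A. r (fst p) \<otimes>\<^bsub>K\<^esub> (\<lambda>t\<in>T. \<zero>\<^bsub>K\<^esub>) (snd p)) = \<zero>\<^bsub>K\<^esub>" by simp
qed

lemma scal_zero_l:
  assumes "x \<in> V" shows "scal K B T act (\<lambda>b\<in>carrier B. \<zero>\<^bsub>K\<^esub>) x = (\<lambda>t\<in>T. \<zero>\<^bsub>K\<^esub>)"
  unfolding scal_def
proof (rule restrict_ext)
  fix t
  let ?A = "{p \<in> carrier B \<times> T. act (fst p) (snd p) = t}"
  have "(\<Oplus>\<^bsub>K\<^esub>p\<in>?A. (\<lambda>b\<in>carrier B. \<zero>\<^bsub>K\<^esub>) (fst p) \<otimes>\<^bsub>K\<^esub> x (snd p)) = (\<Oplus>\<^bsub>K\<^esub>p\<in>?A. \<zero>\<^bsub>K\<^esub>)"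
    by (rule K.finsum_cong') (use PiE_mem[OF assms] in auto)
  then show "(\<Oplus>\<^bsub>K\<^esub>p\<in>?A. (\<lambda>b\<in>carrier B. \<zero>\<^bsub>K\<^esub>) (fst p) \<otimes>\<^bsub>K\<^esub> x (snd p)) = \<zero>\<^bsub>K\<^esub>" by simp
qed

text \<open>For \<open>w\<close> outside \<open>T\<close> both sides are zero, by
  \<open>act_T\<close>. Having the rule on all of \<open>W\<close> avoids case distinctions whenever
  actions are iterated.\<close>

lemma scal_sing:
  assumes b: "b \<in> carrier B" and w: "w \<in> W" and k: "k \<in> carrier K" and l: "l \<in> carrier K"
  shows "scal K B T act (sing K (carrier B) k b) (sing K T l w) = sing K T (k \<otimes>\<^bsub>K\<^esub> l) (act b w)"
proof (cases "w \<in> T")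
  case False
  then have "act b w \<notin> T" using act_T b w by blast
  with False show ?thesis
    by (simp add: sing_outside scal_zero_r sing_closed[OF K.ring_axioms k])
next
  case True
  show ?thesis
    unfolding sing_def[of K T "k \<otimes>\<^bsub>K\<^esub> l"] scal_def
  proof (rule restrict_ext)
    fix t assume t: "t \<in> T"
    let ?A = "{p \<in> carrier B \<times> T. act (fst p) (snd p) = t}"
    let ?f = "\<lambda>p. sing K (carrier B) k b (fst p) \<otimes>\<^bsub>K\<^esub> sing K T l w (snd p)"
    have fin: "finite ?A" using finite_B finite_T by simp
    have f: "?f p = (if p = (b, w) then k \<otimes>\<^bsub>K\<^esub> l else \<zero>\<^bsub>K\<^esub>)" if "p \<in> carrier B \<times> T" for p
      using that k l by (auto simp: sing_def)
    show "finsum K ?f ?A = (if t = act b w then k \<otimes>\<^bsub>K\<^esub> l else \<zero>\<^bsub>K\<^esub>)"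
    proof (cases "t = act b w")
      case eq: True
      have "finsum K ?f ?A = (\<Oplus>\<^bsub>K\<^esub>p\<in>?A. if (b, w) = p then k \<otimes>\<^bsub>K\<^esub> l else \<zero>\<^bsub>K\<^esub>)"
      proof (rule K.finsum_cong')
        show "?f p = (if (b, w) = p then k \<otimes>\<^bsub>K\<^esub> l else \<zero>\<^bsub>K\<^esub>)" if "p \<in> ?A" for p
          using f[of p] that by (simp add: eq_commute)
      qed (use k l in auto)
      also have "\<dots> = k \<otimes>\<^bsub>K\<^esub> l"
        by (rule K.finsum_singleton[of _ _ "\<lambda>_. k \<otimes>\<^bsub>K\<^esub> l"]) (use b True eq fin k l in auto)
      finally show ?thesis using eq by simp
    next
      case neq: False
      have "finsum K ?f ?A = (\<Oplus>\<^bsub>K\<^esub>p\<in>?A. \<zero>\<^bsub>K\<^esub>)"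
      proof (rule K.finsum_cong')
        show "?f p = \<zero>\<^bsub>K\<^esub>" if "p \<in> ?A" for p
          using f[of p] that neq by auto
      qed auto
      then show ?thesis using neq by simp
    qed
  qed
qed


end

text \<open>The algebra acting on itself is the instance with \<open>T = W\<close>, so most of its
  ring axioms come from the lemmas on \<open>scal\<close>.\<close>

lemma (in lrb_algebra) regular_bset: "bset B K (carrier B) (carrier B) (\<otimes>)"
  by unfold_locales (auto simp: finite_B m_assoc)

lemma (in lrb_algebra) monoid_algebra_simps:
  "carrier A = RB"
  "r \<otimes>\<^bsub>A\<^esub> q = scal K B (carrier B) (\<otimes>) r q"
  "\<one>\<^bsub>A\<^esub> = dl \<one>"
  "\<zero>\<^bsub>A\<^esub> = (\<lambda>b\<in>carrier B. \<zero>\<^bsub>K\<^esub>)"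
  "r \<oplus>\<^bsub>A\<^esub> q = (\<lambda>b\<in>carrier B. r b \<oplus>\<^bsub>K\<^esub> q b)"
  by (simp_all add: monoid_algebra_def scal_def sing_def)

lemma (in bset) span_module_simps:
  "carrier (span_module K B T act) = V"
  "r \<odot>\<^bsub>span_module K B T act\<^esub> x = scal K B T act r x"
  "\<zero>\<^bsub>span_module K B T act\<^esub> = (\<lambda>t\<in>T. \<zero>\<^bsub>K\<^esub>)"
  "x \<oplus>\<^bsub>span_module K B T act\<^esub> y = (\<lambda>t\<in>T. x t \<oplus>\<^bsub>K\<^esub> y t)"
  by (simp_all add: span_module_def)

text \<open>Both sides are additive in each of the three arguments, which leaves basis vectors,
  where the claim is \<open>act_mult\<close>.\<close>

lemma (in bset) scal_assoc:
  assumes r: "r \<in> RB" and q: "q \<in> RB" and x: "x \<in> V"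
  shows "scal K B T act (scal K B (carrier B) (\<otimes>) r q) x = scal K B T act r (scal K B T act q x)"
proof -
  interpret reg: bset B K "carrier B" "carrier B" "(\<otimes>)" by (rule regular_bset)
  note cl = scal_closed reg.scal_closed sing_closed[OF K.ring_axioms]
  note ad = scal_add_r scal_add_l scal_zero_r scal_zero_l reg.scal_add_r reg.scal_add_l reg.scal_zero_r reg.scal_zero_l
  note ad = ad ad[unfolded restrict_def]
  have 1: "scal K B T act (scal K B (carrier B) (\<otimes>) (sing K (carrier B) k a) (sing K (carrier B) l b)) x
      = scal K B T act (sing K (carrier B) k a) (scal K B T act (sing K (carrier B) l b) x)"
    if "k \<in> carrier K" "l \<in> carrier K" "a \<in> carrier B" "b \<in> carrier B" for k l a b
    using K.ring_axioms finite_T x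
  proof (induction x rule: span_induct)
    case (sing m t)
    then have "t \<in> W" using T_W by blast
    then show ?case
      using that sing by (simp add: scal_sing reg.scal_sing act_closed act_mult K.m_assoc)
  qed (use that in \<open>simp_all add: cl ad cong: if_cong\<close>)
  have 2: "scal K B T act (scal K B (carrier B) (\<otimes>) (sing K (carrier B) k a) q) x
      = scal K B T act (sing K (carrier B) k a) (scal K B T act q x)"
    if "k \<in> carrier K" "a \<in> carrier B" for k a
    using K.ring_axioms finite_B q
    by (induction q rule: span_induct) (use that x in \<open>simp_all add: cl ad 1 cong: if_cong\<close>)
  show ?thesis
    using K.ring_axioms finite_B r
    by (induction r rule: span_induct) (use q x in \<open>simp_all add: cl ad 2 cong: if_cong\<close>)
qed

lemma (in bset) scal_one:
  assumes x: "x \<in> V" shows "scal K B T act (dl \<one>) x = x"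
  using K.ring_axioms finite_T x
proof (induction x rule: span_induct)
  case (sing m t)
  then have "t \<in> W" using T_W by blast
  then show ?case using sing by (simp add: scal_sing act_one)
qed (simp_all add: sing_closed[OF K.ring_axioms] scal_add_r[unfolded restrict_def] scal_zero_r[unfolded restrict_def] cong: if_cong)

lemma (in lrb_algebra) dl_one_r:
  assumes r: "r \<in> RB" shows "scal K B (carrier B) (\<otimes>) r (dl \<one>) = r"
proof -
  interpret reg: bset B K "carrier B" "carrier B" "(\<otimes>)" by (rule regular_bset)
  show ?thesis
    using K.ring_axioms finite_B r
    by (induction r rule: span_induct)
      (simp_all add: sing_closed[OF K.ring_axioms] reg.scal_add_l[unfolded restrict_def]
        reg.scal_zero_l[unfolded restrict_def] reg.scal_sing cong: if_cong)
qed

lemma (in lrb_algebra) ring_A: "ring A"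
proof -
  interpret reg: bset B K "carrier B" "carrier B" "(\<otimes>)" by (rule regular_bset)
  note cl = reg.scal_closed sing_closed[OF K.ring_axioms]
  show ?thesis
  proof (rule ringI)
    show "abelian_group A"
      by (rule abelian_group_pointwise[OF K.ring_axioms]) (simp_all add: monoid_algebra_def)
    show "Group.monoid A"
      by (rule Group.monoidI) (simp_all add: monoid_algebra_simps cl reg.scal_assoc reg.scal_one dl_one_r)
  qed (simp_all add: monoid_algebra_simps reg.scal_add_l reg.scal_add_r)
qed

lemma (in bset) left_module_span: "left_module A (span_module K B T act)"
proof (intro left_module.intro left_module_axioms.intro ring_A)
  show "abelian_group (span_module K B T act)"
    by (rule abelian_group_pointwise[OF K.ring_axioms]) (simp_all add: span_module_def)
qed (simp_all add: monoid_algebra_simps span_module_simps scal_closed scal_add_r scal_add_l scal_assoc scal_one)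

context lrb_algebra begin

lemma sing_A: "k \<in> carrier K \<Longrightarrow> sing K (carrier B) k b \<in> carrier A"
  by (simp add: monoid_algebra_simps sing_closed[OF K.ring_axioms])

lemma sing_mult:
  assumes "k \<in> carrier K" "l \<in> carrier K" "a \<in> carrier B" "b \<in> carrier B"
  shows "sing K (carrier B) k a \<otimes>\<^bsub>A\<^esub> sing K (carrier B) l b = sing K (carrier B) (k \<otimes>\<^bsub>K\<^esub> l) (a \<otimes> b)"
proof -
  interpret reg: bset B K "carrier B" "carrier B" "(\<otimes>)" by (rule regular_bset)
  show ?thesis using assms by (simp add: monoid_algebra_simps reg.scal_sing)
qed

lemma sing_add:
  assumes "k \<in> carrier K" "l \<in> carrier K"
  shows "sing K (carrier B) (k \<oplus>\<^bsub>K\<^esub> l) b = sing K (carrier B) k b \<oplus>\<^bsub>A\<^esub> sing K (carrier B) l b"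
  using assms by (auto simp: monoid_algebra_simps sing_def fun_eq_iff)

lemma A_induct [consumes 1, case_names zero add sing]:
  assumes "r \<in> carrier A"
    and "P \<zero>\<^bsub>A\<^esub>"
    and "\<And>r q. \<lbrakk>r \<in> carrier A; q \<in> carrier A; P r; P q\<rbrakk> \<Longrightarrow> P (r \<oplus>\<^bsub>A\<^esub> q)"
    and "\<And>k b. \<lbrakk>k \<in> carrier K; b \<in> carrier B\<rbrakk> \<Longrightarrow> P (sing K (carrier B) k b)"
  shows "P r"
  using span_induct[OF K.ring_axioms finite_B, of r P] assms unfolding monoid_algebra_simps by blast

end

text \<open>The record of a module over the algebra has no separate action of the field. It is
  recovered through \<open>sc k\<close>, the multiples of the unit, and commutes with the action
  \<open>dl b\<close> of the band.\<close>

locale lrb_module = lrb_algebra B K + M: left_module "monoid_algebra K B" M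
  for B :: "('b, 'y) monoid_scheme" (structure) and K :: "('k, 'x) ring_scheme"
    and M :: "('b \<Rightarrow> 'k, 'm, 'z) module_scheme"
begin

lemma sing_smult:
  assumes "k \<in> carrier K" "b \<in> carrier B" "m \<in> carrier M"
  shows "sing K (carrier B) k b \<odot>\<^bsub>M\<^esub> m = sc k \<odot>\<^bsub>M\<^esub> (dl b \<odot>\<^bsub>M\<^esub> m)"
  using M.smult_assoc[of "sc k" "dl b" m] assms by (simp add: sing_A sing_mult)

lemma dl_sc:
  assumes "k \<in> carrier K" "b \<in> carrier B" "m \<in> carrier M"
  shows "dl b \<odot>\<^bsub>M\<^esub> (sc k \<odot>\<^bsub>M\<^esub> m) = sc k \<odot>\<^bsub>M\<^esub> (dl b \<odot>\<^bsub>M\<^esub> m)"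
  using M.smult_assoc[of "dl b" "sc k" m] sing_smult[of k b m] assms by (simp add: sing_A sing_mult)

lemma dl_dl:
  assumes "a \<in> carrier B" "b \<in> carrier B" "m \<in> carrier M"
  shows "dl a \<odot>\<^bsub>M\<^esub> (dl b \<odot>\<^bsub>M\<^esub> m) = dl (a \<otimes> b) \<odot>\<^bsub>M\<^esub> m"
  using M.smult_assoc[of "dl a" "dl b" m] assms by (simp add: sing_A sing_mult)

lemma sc_sc:
  assumes "k \<in> carrier K" "l \<in> carrier K" "m \<in> carrier M"
  shows "sc k \<odot>\<^bsub>M\<^esub> (sc l \<odot>\<^bsub>M\<^esub> m) = sc (k \<otimes>\<^bsub>K\<^esub> l) \<odot>\<^bsub>M\<^esub> m"
  using M.smult_assoc[of "sc k" "sc l" m] assms by (simp add: sing_A sing_mult)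

lemma sc_add:
  assumes "k \<in> carrier K" "l \<in> carrier K" "m \<in> carrier M"
  shows "sc (k \<oplus>\<^bsub>K\<^esub> l) \<odot>\<^bsub>M\<^esub> m = sc k \<odot>\<^bsub>M\<^esub> m \<oplus>\<^bsub>M\<^esub> sc l \<odot>\<^bsub>M\<^esub> m"
  using assms by (simp add: sing_add sing_A M.smult_l_distr)

lemma sc_zero: "m \<in> carrier M \<Longrightarrow> sc \<zero>\<^bsub>K\<^esub> \<odot>\<^bsub>M\<^esub> m = \<zero>\<^bsub>M\<^esub>"
  using M.smult_l_null[of m] by (simp add: sing_zero monoid_algebra_simps)

lemma dl_one: "m \<in> carrier M \<Longrightarrow> dl \<one> \<odot>\<^bsub>M\<^esub> m = m"
  using M.smult_one[of m] by (simp add: monoid_algebra_simps)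

lemma dl_closed: "m \<in> carrier M \<Longrightarrow> dl b \<odot>\<^bsub>M\<^esub> m \<in> carrier M"
  by (simp add: M.smult_closed sing_A)

lemma sc_closed: "k \<in> carrier K \<Longrightarrow> m \<in> carrier M \<Longrightarrow> sc k \<odot>\<^bsub>M\<^esub> m \<in> carrier M"
  by (simp add: M.smult_closed sing_A)

end

text \<open>The elements \<open>sc k\<close> and \<open>dl b\<close> generate the algebra, so
  compatibility with these two families is enough.\<close>

lemma (in lrb_algebra) mod_hom_AI:
  assumes M: "left_module A M" and N: "left_module A N"
    and c: "\<And>x. x \<in> carrier M \<Longrightarrow> h x \<in> carrier N"
    and a: "\<And>x y. x \<in> carrier M \<Longrightarrow> y \<in> carrier M \<Longrightarrow> h (x \<oplus>\<^bsub>M\<^esub> y) = h x \<oplus>\<^bsub>N\<^esub> h y"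
    and s: "\<And>k x. k \<in> carrier K \<Longrightarrow> x \<in> carrier M \<Longrightarrow> h (sc k \<odot>\<^bsub>M\<^esub> x) = sc k \<odot>\<^bsub>N\<^esub> h x"
    and d: "\<And>b x. b \<in> carrier B \<Longrightarrow> x \<in> carrier M \<Longrightarrow> h (dl b \<odot>\<^bsub>M\<^esub> x) = dl b \<odot>\<^bsub>N\<^esub> h x"
  shows "h \<in> mod_hom A M N"
proof (rule mod_homI[OF c a])
  interpret M: lrb_module B K M
    using M lrb_algebra_axioms by (simp add: lrb_module_def)
  interpret N: lrb_module B K N
    using N lrb_algebra_axioms by (simp add: lrb_module_def)
  fix r x assume r: "r \<in> carrier A" and x: "x \<in> carrier M"
  from r show "h (r \<odot>\<^bsub>M\<^esub> x) = r \<odot>\<^bsub>N\<^esub> h x"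
  proof (induction r rule: A_induct)
    case zero
    then show ?case
      using additive_zero[OF left_module.axioms(2)[OF M] left_module.axioms(2)[OF N] c a] x
      by (simp add: M.M.smult_l_null N.M.smult_l_null c)
  next
    case (add r q)
    then show ?case using x by (simp add: M.M.smult_l_distr N.M.smult_l_distr c a M.M.smult_closed)
  next
    case (sing k b)
    then show ?case
      using x M.sing_smult[of k b x] N.sing_smult[of k b "h x"] by (simp add: c s d M.dl_closed)
  qed
qed

section \<open>Homomorphisms out of a span module are equivariant families\<close>

context bset begin

abbreviation "F \<equiv> span_module K B T act"

sublocale F: lrb_module B K "span_module K B T act"
  using left_module_span lrb_algebra_axioms by (simp add: lrb_module_def)

lemma sing_F: "k \<in> carrier K \<Longrightarrow> sing K T k t \<in> carrier F"
  by (simp add: span_module_simps sing_closed[OF K.ring_axioms])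

lemma F_induct [consumes 1, case_names zero add sing]:
  assumes "x \<in> carrier F"
    and "P \<zero>\<^bsub>F\<^esub>"
    and "\<And>x y. \<lbrakk>x \<in> carrier F; y \<in> carrier F; P x; P y\<rbrakk> \<Longrightarrow> P (x \<oplus>\<^bsub>F\<^esub> y)"
    and "\<And>k t. \<lbrakk>k \<in> carrier K; t \<in> T\<rbrakk> \<Longrightarrow> P (sing K T k t)"
  shows "P x"
  using span_induct[OF K.ring_axioms finite_T, of x P] assms unfolding span_module_simps by blast

lemma dl_sing: "b \<in> carrier B \<Longrightarrow> w \<in> W \<Longrightarrow> l \<in> carrier K \<Longrightarrow> dl b \<odot>\<^bsub>F\<^esub> sing K T l w = sing K T l (act b w)"
  by (simp add: span_module_simps scal_sing)

lemma sc_sing: "w \<in> W \<Longrightarrow> k \<in> carrier K \<Longrightarrow> l \<in> carrier K \<Longrightarrow> sc k \<odot>\<^bsub>F\<^esub> sing K T l w = sing K T (k \<otimes>\<^bsub>K\<^esub> l) w"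
  by (simp add: span_module_simps scal_sing act_one)

lemma sing_outside_F: "w \<notin> T \<Longrightarrow> sing K T k w = \<zero>\<^bsub>F\<^esub>"
  by (simp add: span_module_simps sing_outside)

lemma span_hom_eqI:
  assumes f: "f \<in> mod_hom A F M" and g: "g \<in> mod_hom A F M" and M: "left_module A M"
    and eq: "\<And>t. t \<in> T \<Longrightarrow> f (sing K T \<one>\<^bsub>K\<^esub> t) = g (sing K T \<one>\<^bsub>K\<^esub> t)" and x: "x \<in> carrier F"
  shows "f x = g x"
  using x
proof (induction x rule: F_induct)
  case zero
  then show ?case using mod_hom_zero[OF f left_module_span M] mod_hom_zero[OF g left_module_span M] by simp
next
  case (add x y)
  then show ?case using mod_homD(2)[OF f] mod_homD(2)[OF g] by simp
next
  case (sing k t)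
  then have "sing K T k t = sc k \<odot>\<^bsub>F\<^esub> sing K T \<one>\<^bsub>K\<^esub> t" using T_W by (simp add: sc_sing subset_iff)
  then show ?case using mod_homD(3)[OF f] mod_homD(3)[OF g] sing eq by (simp add: sing_A sing_F)
qed

definition span_hom :: "('b \<Rightarrow> 'k, 'm, 'z) module_scheme \<Rightarrow> ('t \<Rightarrow> 'm) \<Rightarrow> ('t \<Rightarrow> 'k) \<Rightarrow> 'm" where
  "span_hom M m x = (\<Oplus>\<^bsub>M\<^esub>t\<in>T. sc (x t) \<odot>\<^bsub>M\<^esub> m t)"

text \<open>The family is indexed by the whole type and vanishes off \<open>T\<close>. Thus
  \<open>m (act b t)\<close> is already zero when \<open>b\<close> moves \<open>t\<close> out of
  \<open>T\<close>, and one equation covers both cases. These families are the values on basis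
  vectors of homomorphisms into \<open>M\<close>.\<close>

definition equivariant :: "('b \<Rightarrow> 'k, 'm, 'z) module_scheme \<Rightarrow> ('t \<Rightarrow> 'm) \<Rightarrow> bool" where
  "equivariant M m \<longleftrightarrow> (\<forall>t. m t \<in> carrier M) \<and> (\<forall>t. t \<notin> T \<longrightarrow> m t = \<zero>\<^bsub>M\<^esub>) \<and>
     (\<forall>b\<in>carrier B. \<forall>t\<in>T. dl b \<odot>\<^bsub>M\<^esub> m t = m (act b t))"

lemma
  assumes M: "left_module A M" and m: "equivariant M m"
  shows span_hom: "span_hom M m \<in> mod_hom A F M"
    and span_hom_sing: "\<lbrakk>k \<in> carrier K; t \<in> W\<rbrakk> \<Longrightarrow> span_hom M m (sing K T k t) = sc k \<odot>\<^bsub>M\<^esub> m t"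
proof -
  interpret M: lrb_module B K M
    using M lrb_algebra_axioms by (simp add: lrb_module_def)
  have mc: "m t \<in> carrier M" for t using m by (simp add: equivariant_def)
  have m0: "t \<notin> T \<Longrightarrow> m t = \<zero>\<^bsub>M\<^esub>" for t using m by (simp add: equivariant_def)
  have ma: "dl b \<odot>\<^bsub>M\<^esub> m t = m (act b t)" if "b \<in> carrier B" "t \<in> T" for b t
    using m that by (simp add: equivariant_def)
  have xc: "x t \<in> carrier K" if "x \<in> carrier F" "t \<in> T" for x t
    using that by (auto simp: span_module_simps)
  have span_sing: "span_hom M m (sing K T k t) = sc k \<odot>\<^bsub>M\<^esub> m t" if k: "k \<in> carrier K" for k t
  proof (cases "t \<in> T")
    case True
    have "span_hom M m (sing K T k t) = (\<Oplus>\<^bsub>M\<^esub>s\<in>T. if t = s then sc k \<odot>\<^bsub>M\<^esub> m s else \<zero>\<^bsub>M\<^esub>)"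
      unfolding span_hom_def
      by (rule M.M.M.finsum_cong') (use k mc in \<open>auto simp: M.sc_closed M.sc_zero sing_def[of K T]\<close>)
    also have "\<dots> = sc k \<odot>\<^bsub>M\<^esub> m t"
      by (rule M.M.M.finsum_singleton) (use True finite_T k mc in \<open>auto simp: M.sc_closed\<close>)
    finally show ?thesis .
  next
    case False
    have "span_hom M m (sing K T k t) = (\<Oplus>\<^bsub>M\<^esub>s\<in>T. \<zero>\<^bsub>M\<^esub>)"
      unfolding span_hom_def
      by (rule M.M.M.finsum_cong') (use k mc False in \<open>auto simp: M.sc_zero sing_def[of K T]\<close>)
    then show ?thesis using False k by (simp add: m0 M.M.smult_r_null sing_A)
  qed
  then show "\<lbrakk>k \<in> carrier K; t \<in> W\<rbrakk> \<Longrightarrow> span_hom M m (sing K T k t) = sc k \<odot>\<^bsub>M\<^esub> m t" by blast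
  have c: "span_hom M m x \<in> carrier M" if "x \<in> carrier F" for x
    unfolding span_hom_def by (rule M.M.M.finsum_closed) (use that xc mc in \<open>auto intro: M.sc_closed\<close>)
  have a: "span_hom M m (x \<oplus>\<^bsub>F\<^esub> y) = span_hom M m x \<oplus>\<^bsub>M\<^esub> span_hom M m y"
    if "x \<in> carrier F" "y \<in> carrier F" for x y
  proof -
    have "span_hom M m (x \<oplus>\<^bsub>F\<^esub> y) = (\<Oplus>\<^bsub>M\<^esub>t\<in>T. sc (x t) \<odot>\<^bsub>M\<^esub> m t \<oplus>\<^bsub>M\<^esub> sc (y t) \<odot>\<^bsub>M\<^esub> m t)"
      unfolding span_hom_def
      by (rule M.M.M.finsum_cong') (use that xc mc in \<open>auto simp: span_module_simps(4) M.sc_add intro!: M.sc_closed\<close>)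
    also have "\<dots> = span_hom M m x \<oplus>\<^bsub>M\<^esub> span_hom M m y"
      unfolding span_hom_def
      by (rule M.M.M.finsum_addf) (use that xc mc in \<open>auto intro!: M.sc_closed\<close>)
    finally show ?thesis .
  qed
  have z: "span_hom M m \<zero>\<^bsub>F\<^esub> = \<zero>\<^bsub>M\<^esub>"
    using additive_zero[of F M "span_hom M m"] left_module.axioms(2)[OF left_module_span] left_module.axioms(2)[OF M] c a
    by blast
  show "span_hom M m \<in> mod_hom A F M"
  proof (rule mod_hom_AI[where h="span_hom M m", OF left_module_span M])
    show "x \<in> carrier F \<Longrightarrow> span_hom M m x \<in> carrier M" for x by (rule c)
    show "\<lbrakk>x \<in> carrier F; y \<in> carrier F\<rbrakk> \<Longrightarrow> span_hom M m (x \<oplus>\<^bsub>F\<^esub> y) = span_hom M m x \<oplus>\<^bsub>M\<^esub> span_hom M m y" for x y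
      by (rule a)
  next
    fix k x assume k: "k \<in> carrier K" and x: "x \<in> carrier F"
    from x show "span_hom M m (sc k \<odot>\<^bsub>F\<^esub> x) = sc k \<odot>\<^bsub>M\<^esub> span_hom M m x"
    proof (induction x rule: F_induct)
      case (sing l t)
      then show ?case using k T_W by (simp add: sc_sing subset_iff span_sing M.sc_sc mc)
    qed (use k in \<open>simp_all add: F.M.smult_r_null M.M.smult_r_null sing_A z a c F.M.smult_r_distr M.M.smult_r_distr F.sc_closed\<close>)
  next
    fix b x assume b: "b \<in> carrier B" and x: "x \<in> carrier F"
    from x show "span_hom M m (dl b \<odot>\<^bsub>F\<^esub> x) = dl b \<odot>\<^bsub>M\<^esub> span_hom M m x"
    proof (induction x rule: F_induct)
      case (sing l t)
      then show ?case using b T_W by (simp add: dl_sing subset_iff span_sing M.dl_sc mc ma)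
    qed (use b in \<open>simp_all add: F.M.smult_r_null M.M.smult_r_null sing_A z a c F.M.smult_r_distr M.M.smult_r_distr F.dl_closed\<close>)
  qed
qed

lemma equivariant_of_hom:
  assumes M: "left_module A M" and f: "f \<in> mod_hom A F M"
  shows "equivariant M (\<lambda>t. f (sing K T \<one>\<^bsub>K\<^esub> t))"
  unfolding equivariant_def
proof (intro conjI allI ballI impI)
  fix t show "f (sing K T \<one>\<^bsub>K\<^esub> t) \<in> carrier M" by (rule mod_homD(1)[OF f]) (simp add: sing_F)
next
  fix t assume "t \<notin> T"
  then show "f (sing K T \<one>\<^bsub>K\<^esub> t) = \<zero>\<^bsub>M\<^esub>" using mod_hom_zero[OF f left_module_span M] by (simp add: sing_outside_F)
next
  fix b t assume "b \<in> carrier B" "t \<in> T"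
  then show "dl b \<odot>\<^bsub>M\<^esub> f (sing K T \<one>\<^bsub>K\<^esub> t) = f (sing K T \<one>\<^bsub>K\<^esub> (act b t))"
    using mod_homD(3)[OF f, symmetric] T_W by (simp add: sing_A sing_F dl_sing subset_iff)
qed

end


section \<open>The chain complex of a filter of the band\<close>

definition del :: "nat \<Rightarrow> 'v list \<Rightarrow> 'v list" where
  "del i xs = take i xs @ drop (Suc i) xs"

lemma del_Cons [simp]: "del 0 (x # xs) = xs" "del (Suc i) (x # xs) = x # del i xs"
  by (simp_all add: del_def)

lemma length_del: "i < length xs \<Longrightarrow> length (del i xs) = length xs - 1"
  by (simp add: del_def)

lemma map_del: "map f (del i xs) = del i (map f xs)"
  by (simp add: del_def take_map drop_map)

lemma set_del_subset: "set (del i xs) \<subseteq> set xs"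
  by (auto simp: del_def dest: in_set_takeD in_set_dropD)

lemma sorted_wrt_del: "sorted_wrt P xs \<Longrightarrow> sorted_wrt P (del i xs)"
proof (induction xs arbitrary: i)
  case (Cons x xs)
  then show ?case using set_del_subset[of _ xs] by (cases i) auto
qed (simp add: del_def)

lemma distinct_del: "distinct xs \<Longrightarrow> distinct (del i xs)"
proof (induction xs arbitrary: i)
  case (Cons x xs)
  then show ?case using set_del_subset[of _ xs] by (cases i) auto
qed (simp add: del_def)

text \<open>Two equal neighbours give two equal faces, which occur in the boundary with opposite
  signs. Together with the next lemma this makes the boundary of a degenerate list vanish.\<close>

lemma del_eq_del_Suc: "Suc j < length xs \<Longrightarrow> xs ! j = xs ! Suc j \<Longrightarrow> del j xs = del (Suc j) xs"
proof (induction xs arbitrary: j)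
  case (Cons x xs)
  then show ?case by (cases j; cases xs) auto
qed simp

lemma del_not_distinct:
  "Suc j < length xs \<Longrightarrow> xs ! j = xs ! Suc j \<Longrightarrow> i \<noteq> j \<Longrightarrow> i \<noteq> Suc j \<Longrightarrow> \<not> distinct (del i xs)"
proof (induction xs arbitrary: i j)
  case (Cons x xs)
  show ?case
  proof (cases i)
    case 0
    then obtain j' where j: "j = Suc j'" using Cons.prems by (cases j) auto
    then have "\<not> distinct xs"
      using Cons.prems by (metis Suc_lessD Suc_less_eq distinct_conv_nth length_Cons n_not_Suc_n nth_Cons_Suc)
    then show ?thesis using 0 by simp
  next
    case (Suc i')
    show ?thesis
    proof (cases j)
      case 0
      then obtain i'' y ys where "i' = Suc i''" "xs = y # ys"
        using Suc Cons.prems by (cases i'; cases xs) auto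
      then show ?thesis using 0 Suc Cons.prems by simp
    next
      case (Suc j')
      then show ?thesis using \<open>i = Suc i'\<close> Cons.prems Cons.IH[of j' i'] by simp
    qed
  qed
qed simp

lemma (in abelian_group) zero_if_add_eq:
  assumes "x \<oplus> y = y" "x \<in> carrier G" "y \<in> carrier G" shows "x = \<zero>"
  using assms by (metis a_comm add.l_cancel r_zero zero_closed)

section \<open>Weakly descending lists and left multiplication\<close>

context lrb_algebra begin

definition wchains :: "nat \<Rightarrow> 'b list set" where
  "wchains n = {xs. length xs = Suc n \<and> set xs \<subseteq> carrier B \<and> sorted_wrt (\<lambda>a b. a \<otimes> b = b) xs}"

definition act :: "'b \<Rightarrow> 'b list \<Rightarrow> 'b list" where
  "act b = map (\<lambda>a. b \<otimes> a)"

lemma wchainsD: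
  assumes "s \<in> wchains n"
  shows "length s = Suc n" "set s \<subseteq> carrier B" "hd s \<in> carrier B" "s \<noteq> []"
    and "x \<in> set s \<Longrightarrow> hd s \<otimes> x = x"
  using assms by (cases s; auto simp: wchains_def idem)+

text \<open>If \<open>x y = y\<close>, then \<open>b x b y = b x y = b y\<close>, where the first
  step is the law \<open>b x b = b x\<close>.\<close>

lemma act_closed:
  assumes b: "b \<in> carrier B" and s: "s \<in> wchains n" shows "act b s \<in> wchains n"
proof -
  have "sorted_wrt (\<lambda>x y. b \<otimes> x \<otimes> (b \<otimes> y) = b \<otimes> y) s"
  proof (rule sorted_wrt_mono_rel)
    show "sorted_wrt (\<lambda>a b. a \<otimes> b = b) s" using s by (simp add: wchains_def)
    fix x y assume xy: "x \<in> set s" "y \<in> set s" "x \<otimes> y = y"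
    then have c: "x \<in> carrier B" "y \<in> carrier B" using s by (auto simp: wchains_def)
    have "b \<otimes> x \<otimes> (b \<otimes> y) = b \<otimes> x \<otimes> b \<otimes> y" using b c by (simp add: m_assoc)
    also have "\<dots> = b \<otimes> y" using b c xy(3) by (simp add: left_regular) (simp add: m_assoc)
    finally show "b \<otimes> x \<otimes> (b \<otimes> y) = b \<otimes> y" .
  qed
  then show ?thesis using b s by (auto simp: wchains_def act_def sorted_wrt_map)
qed

lemma act_hd: "s \<in> wchains n \<Longrightarrow> act (hd s) s = s"
  using wchainsD(5)[of s n] by (simp add: act_def map_idI)

lemma act_mult:
  "a \<in> carrier B \<Longrightarrow> b \<in> carrier B \<Longrightarrow> s \<in> wchains n \<Longrightarrow> act a (act b s) = act (a \<otimes> b) s"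
  by (auto simp: act_def wchains_def m_assoc)

lemma act_one: "s \<in> wchains n \<Longrightarrow> act \<one> s = s"
  by (auto simp: act_def wchains_def intro!: map_idI)

lemma hd_act: "s \<in> wchains n \<Longrightarrow> hd (act b s) = b \<otimes> hd s"
  using wchainsD(4) by (auto simp: act_def hd_map)

lemma del_wchains: "s \<in> wchains (Suc n) \<Longrightarrow> i \<le> Suc n \<Longrightarrow> del i s \<in> wchains n"
  using set_del_subset[of i s] by (auto simp: wchains_def length_del sorted_wrt_del)

lemma act_del: "act b (del i s) = del i (act b s)"
  by (simp add: act_def map_del)

text \<open>In \<open>a b a = a b\<close> the left side is \<open>b a = a\<close> and the right side
  is \<open>b\<close>.\<close>

lemma order_antisym:
  assumes "a \<in> carrier B" "b \<in> carrier B" "a \<otimes> b = b" "b \<otimes> a = a" shows "a = b"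
  using left_regular[OF assms(1,2)] assms by (metis idem)

text \<open>A repeated value squeezes everything between its two occurrences, so antisymmetry makes
  neighbours equal.\<close>

lemma degenerate_adjacent:
  assumes s: "s \<in> wchains n" and nd: "\<not> distinct s"
  obtains j where "j < n" "s ! j = s ! Suc j"
proof -
  obtain i k where ik: "i < length s" "k < length s" "i < k" "s ! i = s ! k"
    using nd by (metis distinct_conv_nth linorder_neqE_nat)
  have c: "s ! l \<in> carrier B" if "l < length s" for l using s that by (auto simp: wchains_def)
  have le: "s ! l \<otimes> s ! m = s ! m" if "l < m" "m < length s" for l m
    using s that by (auto simp: wchains_def sorted_wrt_iff_nth_less)
  have "s ! i = s ! Suc i"
  proof (cases "Suc i = k")
    case False
    then have "s ! Suc i \<otimes> s ! i = s ! i" "s ! i \<otimes> s ! Suc i = s ! Suc i"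
      using ik le[of "Suc i" k] le[of i "Suc i"] by auto
    then show ?thesis using order_antisym[of "s ! i" "s ! Suc i"] c ik by auto
  qed (use ik in simp)
  moreover have "i < n" using ik s by (auto simp: wchains_def)
  ultimately show ?thesis using that by blast
qed

end

text \<open>These sets are the preimages of 1 under monoid homomorphisms from \<open>B\<close> to 0
  and 1, that is, the characters of \<open>B\<close> with these values.\<close>

locale lrb_filter = lrb_algebra B K
  for B :: "('b, 'y) monoid_scheme" (structure) and K :: "('k, 'x) ring_scheme" +
  fixes Q :: "'b set"
  assumes Q_subset: "Q \<subseteq> carrier B" and Q_one: "\<one> \<in> Q"
    and Q_mult: "\<lbrakk>a \<in> carrier B; b \<in> carrier B\<rbrakk> \<Longrightarrow> a \<otimes> b \<in> Q \<longleftrightarrow> a \<in> Q \<and> b \<in> Q"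
begin

definition chains :: "nat \<Rightarrow> 'b list set" where
  "chains n = {s \<in> wchains n. distinct s \<and> set s \<subseteq> Q}"

text \<open>A list with a repetition keeps it under left multiplication, and by
  \<open>Q_mult\<close> an entry outside \<open>Q\<close> stays outside. This is the condition
  \<open>act_T\<close>.\<close>

lemma chains_bset: "bset B K (wchains n) (chains n) act"
proof unfold_locales
  have "chains n \<subseteq> {xs. set xs \<subseteq> carrier B \<and> length xs = Suc n}"
    by (auto simp: chains_def wchains_def)
  then show "finite (chains n)"
    using finite_lists_length_eq[OF finite_B] finite_subset by blast
  show "chains n \<subseteq> wchains n" by (auto simp: chains_def)
  fix b w assume b: "b \<in> carrier B" and w: "w \<in> wchains n" "act b w \<in> chains n"
  then show "w \<in> chains n"
    using wchainsD(2)[OF w(1)] Q_mult[OF b] by (fastforce simp: chains_def act_def distinct_map)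
qed (simp_all add: act_closed act_mult act_one)

interpretation ch: bset B K "wchains n" "chains n" act for n by (rule chains_bset)

abbreviation "C n \<equiv> span_module K B (chains n) act"
abbreviation "cell n \<equiv> sing K (chains n) \<one>\<^bsub>K\<^esub>"

lemma C_module: "left_module A (C n)" by (rule ch.left_module_span)

definition sgn :: "nat \<Rightarrow> 'k" where "sgn i = (\<ominus>\<^bsub>K\<^esub> \<one>\<^bsub>K\<^esub>) [^]\<^bsub>K\<^esub> i"

lemma sgn_closed [simp]: "sgn i \<in> carrier K" by (simp add: sgn_def)
lemma sgn_0: "sgn 0 = \<one>\<^bsub>K\<^esub>" by (simp add: sgn_def)
lemma sgn_Suc: "sgn (Suc i) = \<ominus>\<^bsub>K\<^esub> sgn i" by (simp add: sgn_def K.r_minus)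

text \<open>Defined on all weak chains, since the action may lead to a degenerate one. Faces that
  are not proper chains of \<open>Q\<close> drop out by the default value of
  \<open>sing\<close>.\<close>

definition bd_sum :: "nat \<Rightarrow> 'k \<Rightarrow> 'b list \<Rightarrow> 'b list \<Rightarrow> 'k" where
  "bd_sum n k s = (\<Oplus>\<^bsub>C n\<^esub>i\<in>{..Suc n}. sing K (chains n) (k \<otimes>\<^bsub>K\<^esub> sgn i) (del i s))"

lemma bd_sum_closed: "k \<in> carrier K \<Longrightarrow> bd_sum n k s \<in> carrier (C n)"
  unfolding bd_sum_def by (rule ch.F.M.M.finsum_closed) (auto intro: ch.sing_F)

lemma sing_add_C:
  "k \<in> carrier K \<Longrightarrow> l \<in> carrier K \<Longrightarrow>
    sing K (chains n) k t \<oplus>\<^bsub>C n\<^esub> sing K (chains n) l t = sing K (chains n) (k \<oplus>\<^bsub>K\<^esub> l) t"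
  by (auto simp: ch.span_module_simps sing_def fun_eq_iff)

text \<open>With a repetition two faces cancel and the others are degenerate; with all entries
  outside \<open>Q\<close> no face counts. Mixed lists are excluded for a reason: deleting the only
  entry outside \<open>Q\<close> could leave a proper chain.\<close>

lemma bd_sum_degenerate:
  assumes s: "s \<in> wchains (Suc n)" and k: "k \<in> carrier K" and nc: "s \<notin> chains (Suc n)"
    and hom: "set s \<subseteq> Q \<or> set s \<inter> Q = {}"
  shows "bd_sum n k s = \<zero>\<^bsub>C n\<^esub>"
proof (cases "set s \<subseteq> Q")
  case False
  have "sing K (chains n) (k \<otimes>\<^bsub>K\<^esub> sgn i) (del i s) = \<zero>\<^bsub>C n\<^esub>" if "i \<in> {..Suc n}" for i
  proof (rule ch.sing_outside_F)
    have "del i s \<in> wchains n" using del_wchains s that by simp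
    then have "hd (del i s) \<in> set (del i s)" using wchainsD(4) hd_in_set by blast
    moreover from this have "hd (del i s) \<notin> Q" using False hom set_del_subset[of i s] by blast
    ultimately show "del i s \<notin> chains n" by (auto simp: chains_def)
  qed
  then have "bd_sum n k s = (\<Oplus>\<^bsub>C n\<^esub>i\<in>{..Suc n}. \<zero>\<^bsub>C n\<^esub>)"
    unfolding bd_sum_def by (intro ch.F.M.M.finsum_cong') auto
  then show ?thesis by simp
next
  case True
  then have "\<not> distinct s" using nc s by (simp add: chains_def)
  then obtain j where j: "j < Suc n" "s ! j = s ! Suc j" using degenerate_adjacent[OF s] by blast
  have len: "length s = Suc (Suc n)" using wchainsD(1)[OF s] .
  let ?f = "\<lambda>i. sing K (chains n) (k \<otimes>\<^bsub>K\<^esub> sgn i) (del i s)"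
  have f: "?f i \<in> carrier (C n)" for i using k by (simp add: ch.sing_F)
  have "bd_sum n k s = finsum (C n) ?f {j, Suc j}"
    unfolding bd_sum_def
  proof (rule ch.F.M.M.finsum_mono_neutral[symmetric])
    show "?f i = \<zero>\<^bsub>C n\<^esub>" if "i \<in> {..Suc n} - {j, Suc j}" for i
      by (rule ch.sing_outside_F) (use that j len del_not_distinct[of j s i] in \<open>auto simp: chains_def\<close>)
  qed (use j f in auto)
  also have "\<dots> = ?f j \<oplus>\<^bsub>C n\<^esub> ?f (Suc j)"
    using f by (subst ch.F.M.M.finsum_insert) auto
  also have "\<dots> = \<zero>\<^bsub>C n\<^esub>"
    using k j len del_eq_del_Suc[of j s]
    by (simp add: sing_add_C sgn_Suc K.r_minus K.r_neg sing_zero ch.span_module_simps(3)[symmetric])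
  finally show ?thesis .
qed

lemma sc_bd_sum:
  assumes "k \<in> carrier K" "l \<in> carrier K" "s \<in> wchains (Suc n)"
  shows "sc k \<odot>\<^bsub>C n\<^esub> bd_sum n l s = bd_sum n (k \<otimes>\<^bsub>K\<^esub> l) s"
proof -
  have "sc k \<odot>\<^bsub>C n\<^esub> bd_sum n l s
      = (\<Oplus>\<^bsub>C n\<^esub>i\<in>{..Suc n}. sc k \<odot>\<^bsub>C n\<^esub> sing K (chains n) (l \<otimes>\<^bsub>K\<^esub> sgn i) (del i s))"
    unfolding bd_sum_def by (rule ch.F.M.smult_r_finsum) (use assms in \<open>auto intro: ch.sing_F sing_A\<close>)
  also have "\<dots> = bd_sum n (k \<otimes>\<^bsub>K\<^esub> l) s"
    unfolding bd_sum_def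
    by (rule ch.F.M.M.finsum_cong') (use assms in \<open>auto simp: ch.sc_sing del_wchains K.m_assoc intro: ch.sing_F\<close>)
  finally show ?thesis .
qed

lemma dl_bd_sum:
  assumes "b \<in> carrier B" "l \<in> carrier K" "s \<in> wchains (Suc n)"
  shows "dl b \<odot>\<^bsub>C n\<^esub> bd_sum n l s = bd_sum n l (act b s)"
proof -
  have "dl b \<odot>\<^bsub>C n\<^esub> bd_sum n l s
      = (\<Oplus>\<^bsub>C n\<^esub>i\<in>{..Suc n}. dl b \<odot>\<^bsub>C n\<^esub> sing K (chains n) (l \<otimes>\<^bsub>K\<^esub> sgn i) (del i s))"
    unfolding bd_sum_def by (rule ch.F.M.smult_r_finsum) (use assms in \<open>auto intro: ch.sing_F sing_A\<close>)
  also have "\<dots> = bd_sum n l (act b s)"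
    unfolding bd_sum_def
    by (rule ch.F.M.M.finsum_cong') (use assms in \<open>auto simp: ch.dl_sing del_wchains act_del intro: ch.sing_F\<close>)
  finally show ?thesis .
qed

definition bd_family :: "nat \<Rightarrow> 'b list \<Rightarrow> 'b list \<Rightarrow> 'k" where
  "bd_family n s = (if s \<in> chains (Suc n) then bd_sum n \<one>\<^bsub>K\<^esub> s else \<zero>\<^bsub>C n\<^esub>)"

definition bd :: "nat \<Rightarrow> ('b list \<Rightarrow> 'k) \<Rightarrow> 'b list \<Rightarrow> 'k" where
  "bd n = bset.span_hom B K (chains (Suc n)) (C n) (bd_family n)"

text \<open>By \<open>Q_mult\<close>, whether the translates by \<open>b\<close> lie in
  \<open>Q\<close> depends on \<open>b\<close> alone. Hence the mixed lists, on which the boundary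
  would not be equivariant, never arise from a chain of \<open>Q\<close>.\<close>

lemma act_homogeneous:
  assumes "b \<in> carrier B" "s \<in> chains n" shows "set (act b s) \<subseteq> Q \<or> set (act b s) \<inter> Q = {}"
proof (cases "b \<in> Q")
  case True
  then have "set (act b s) \<subseteq> Q" using assms Q_mult Q_subset by (auto simp: act_def chains_def subset_iff)
  then show ?thesis ..
next
  case False
  then have "set (act b s) \<inter> Q = {}" using assms Q_mult Q_subset by (auto simp: act_def chains_def subset_iff)
  then show ?thesis ..
qed

lemma bd_equivariant: "bset.equivariant B K (chains (Suc n)) act (C n) (bd_family n)"
  unfolding ch.equivariant_def
proof (intro conjI allI impI ballI)
  fix b s assume b: "b \<in> carrier B" and s: "s \<in> chains (Suc n)"
  then have sw: "s \<in> wchains (Suc n)" by (simp add: chains_def)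
  show "dl b \<odot>\<^bsub>C n\<^esub> bd_family n s = bd_family n (act b s)"
    using b s sw by (simp add: bd_family_def dl_bd_sum bd_sum_degenerate act_homogeneous act_closed)
qed (auto simp: bd_family_def bd_sum_closed)

lemma bd_hom: "bd n \<in> mod_hom A (C (Suc n)) (C n)"
  unfolding bd_def by (rule ch.span_hom[OF C_module bd_equivariant])

lemma bd_sing:
  assumes "s \<in> wchains (Suc n)" "k \<in> carrier K" "set s \<subseteq> Q \<or> set s \<inter> Q = {}"
  shows "bd n (sing K (chains (Suc n)) k s) = bd_sum n k s"
  unfolding bd_def ch.span_hom_sing[OF C_module bd_equivariant assms(2,1)]
  using assms by (simp add: bd_family_def sc_bd_sum bd_sum_degenerate ch.F.M.smult_r_null sing_A)

section \<open>The contraction by the top element\<close>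

definition contr :: "nat \<Rightarrow> ('b list \<Rightarrow> 'k) \<Rightarrow> 'b list \<Rightarrow> 'k" where
  "contr n x = (\<lambda>t\<in>chains (Suc n). if hd t = \<one> then x (tl t) else \<zero>\<^bsub>K\<^esub>)"

lemma tl_chains: "t \<in> chains (Suc n) \<Longrightarrow> tl t \<in> chains n"
  by (cases t) (auto simp: chains_def wchains_def)

lemma one_Cons_wchains: "s \<in> wchains n \<Longrightarrow> \<one> # s \<in> wchains (Suc n)"
  by (auto simp: wchains_def)

lemma contr_closed: "x \<in> carrier (C n) \<Longrightarrow> contr n x \<in> carrier (C (Suc n))"
  using tl_chains by (auto simp: contr_def ch.span_module_simps PiE_mem)

lemma contr_add:
  "contr n (x \<oplus>\<^bsub>C n\<^esub> y) = contr n x \<oplus>\<^bsub>C (Suc n)\<^esub> contr n y"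
  using tl_chains by (auto simp: contr_def ch.span_module_simps fun_eq_iff)

text \<open>\<open>contr\<close> is written in coefficients; on basis vectors it prepends
  \<open>\<one>\<close>. A chain that already starts with \<open>\<one>\<close> goes to zero,
  because the longer list repeats its head.\<close>

lemma contr_sing:
  assumes "s \<in> wchains n"
  shows "contr n (sing K (chains n) k s) = sing K (chains (Suc n)) k (\<one> # s)"
proof -
  have "(if hd t = \<one> then sing K (chains n) k s (tl t) else \<zero>\<^bsub>K\<^esub>) = (if t = \<one> # s then k else \<zero>\<^bsub>K\<^esub>)"
    if t: "t \<in> chains (Suc n)" for t
    using t tl_chains[OF t] by (cases t) (auto simp: sing_def chains_def wchains_def)
  then show ?thesis unfolding contr_def sing_def[of K "chains (Suc n)"] by (rule restrict_ext)
qed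

lemma contr_zero: "contr n \<zero>\<^bsub>C n\<^esub> = \<zero>\<^bsub>C (Suc n)\<^esub>"
  using tl_chains by (auto simp: contr_def ch.span_module_simps fun_eq_iff)

text \<open>Face 0 of \<open>\<one> # s\<close> is \<open>s\<close> itself. The other faces are
  those of \<open>s\<close> with \<open>\<one>\<close> in front; their indices are shifted by one,
  so their signs are opposite to those in the contracted boundary.\<close>

lemma bd_sum_one_Cons:
  assumes s: "s \<in> wchains (Suc n)" and k: "k \<in> carrier K"
  shows "bd_sum (Suc n) k (\<one> # s) \<oplus>\<^bsub>C (Suc n)\<^esub> contr n (bd_sum n k s) = sing K (chains (Suc n)) k s"
proof -
  let ?C = "C (Suc n)"
  let ?g = "\<lambda>i. sing K (chains (Suc n)) (k \<otimes>\<^bsub>K\<^esub> sgn i) (\<one> # del i s)"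
  let ?f = "\<lambda>i. sing K (chains (Suc n)) (k \<otimes>\<^bsub>K\<^esub> sgn (Suc i)) (\<one> # del i s)"
  have fg: "?f i \<in> carrier ?C" "?g i \<in> carrier ?C" for i using k by (simp_all add: ch.sing_F)
  have "bd_sum (Suc n) k (\<one> # s) = finsum ?C ?f {..Suc n} \<oplus>\<^bsub>?C\<^esub> sing K (chains (Suc n)) k s"
    unfolding bd_sum_def using k
    by (subst ch.F.M.M.finsum_Suc2) (auto simp: sgn_0 intro: ch.sing_F)
  moreover have "contr n (bd_sum n k s) = finsum ?C ?g {..Suc n}"
  proof -
    have "contr n (bd_sum n k s) = (\<Oplus>\<^bsub>?C\<^esub>i\<in>{..Suc n}. contr n (sing K (chains n) (k \<otimes>\<^bsub>K\<^esub> sgn i) (del i s)))"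
      unfolding bd_sum_def
      by (rule additive_finsum[OF left_module.axioms(2)[OF C_module] left_module.axioms(2)[OF C_module]])
        (use k in \<open>auto intro: contr_closed contr_add ch.sing_F\<close>)
    also have "\<dots> = finsum ?C ?g {..Suc n}"
      by (rule ch.F.M.M.finsum_cong') (use s fg in \<open>auto simp: contr_sing del_wchains\<close>)
    finally show ?thesis .
  qed
  moreover have "finsum ?C ?f {..Suc n} \<oplus>\<^bsub>?C\<^esub> finsum ?C ?g {..Suc n} = \<zero>\<^bsub>?C\<^esub>"
  proof -
    have "finsum ?C ?f {..Suc n} \<oplus>\<^bsub>?C\<^esub> finsum ?C ?g {..Suc n} = (\<Oplus>\<^bsub>?C\<^esub>i\<in>{..Suc n}. ?f i \<oplus>\<^bsub>?C\<^esub> ?g i)"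
      by (rule ch.F.M.M.finsum_addf[symmetric]) (use fg in auto)
    also have "\<dots> = (\<Oplus>\<^bsub>?C\<^esub>i\<in>{..Suc n}. \<zero>\<^bsub>?C\<^esub>)"
      by (rule ch.F.M.M.finsum_cong')
        (use k in \<open>auto simp: sing_add_C sgn_Suc K.r_minus K.l_neg sing_zero ch.span_module_simps(3)[symmetric]\<close>)
    finally show ?thesis by simp
  qed
  ultimately show ?thesis
    using k fg ch.sing_F[of k "Suc n" s]
    by (simp add: ch.F.M.M.a_ac ch.F.M.M.finsum_closed Pi_def)
qed

lemma contr_homotopy:
  assumes "x \<in> carrier (C (Suc n))"
  shows "bd (Suc n) (contr (Suc n) x) \<oplus>\<^bsub>C (Suc n)\<^esub> contr n (bd n x) = x"
  using assms
proof (induction x rule: ch.F_induct)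
  case zero
  then show ?case
    using mod_hom_zero[OF bd_hom C_module C_module] by (simp add: contr_zero)
next
  case (add x y)
  have c: "bd (Suc n) (contr (Suc n) z) \<in> carrier (C (Suc n))" "contr n (bd n z) \<in> carrier (C (Suc n))"
    if "z \<in> carrier (C (Suc n))" for z
    using that mod_homD(1)[OF bd_hom] contr_closed by blast+
  have "bd (Suc n) (contr (Suc n) (x \<oplus>\<^bsub>C (Suc n)\<^esub> y)) \<oplus>\<^bsub>C (Suc n)\<^esub> contr n (bd n (x \<oplus>\<^bsub>C (Suc n)\<^esub> y))
    = (bd (Suc n) (contr (Suc n) x) \<oplus>\<^bsub>C (Suc n)\<^esub> bd (Suc n) (contr (Suc n) y)) \<oplus>\<^bsub>C (Suc n)\<^esub>
      (contr n (bd n x) \<oplus>\<^bsub>C (Suc n)\<^esub> contr n (bd n y))"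
    using add by (simp add: contr_add mod_homD(2)[OF bd_hom] contr_closed)
  also have "\<dots> = (bd (Suc n) (contr (Suc n) x) \<oplus>\<^bsub>C (Suc n)\<^esub> contr n (bd n x)) \<oplus>\<^bsub>C (Suc n)\<^esub>
      (bd (Suc n) (contr (Suc n) y) \<oplus>\<^bsub>C (Suc n)\<^esub> contr n (bd n y))"
    using add c by (simp add: ch.F.M.M.a_ac)
  finally show ?case using add by simp
next
  case (sing k s)
  then have s: "s \<in> wchains (Suc n)" "set s \<subseteq> Q" by (simp_all add: chains_def)
  then show ?case
    using sing bd_sum_one_Cons[OF s(1)] Q_one
    by (simp add: contr_sing bd_sing one_Cons_wchains)
qed

text \<open>Since \<open>b\<close> lies above all of \<open>t\<close>, the chain
  \<open>b # t\<close> is \<open>b\<close> applied to \<open>\<one> # t\<close>. So the image of the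
  contraction generates the module over the algebra, although the contraction itself is not
  equivariant.\<close>

lemma hom_zero_via_contr:
  assumes M: "left_module A M" and f: "f \<in> mod_hom A (C (Suc n)) M"
    and z: "\<And>y. y \<in> carrier (C n) \<Longrightarrow> f (contr n y) = \<zero>\<^bsub>M\<^esub>" and x: "x \<in> carrier (C (Suc n))"
  shows "f x = \<zero>\<^bsub>M\<^esub>"
  using x
proof (induction x rule: ch.F_induct)
  case zero
  then show ?case using mod_hom_zero[OF f C_module M] by simp
next
  case (add x y)
  then show ?case
    using mod_homD(2)[OF f] left_module.axioms(2)[OF M] by (simp add: abelian_group.axioms(1) abelian_monoid.l_zero abelian_monoid.zero_closed)
next
  case (sing k s)
  interpret M: lrb_module B K M using M lrb_algebra_axioms by (simp add: lrb_module_def)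
  obtain b t where s: "s = b # t" using sing by (cases s) (auto simp: chains_def wchains_def)
  have t: "t \<in> chains n" using tl_chains[OF sing(2)] s by simp
  then have tw: "t \<in> wchains n" by (simp add: chains_def)
  have sw: "s \<in> wchains (Suc n)" using sing by (simp add: chains_def)
  have b: "b \<in> carrier B" using wchainsD(2)[OF sw] s by simp
  have "act b (\<one> # t) = s"
    using act_hd[OF sw] s b by (simp add: act_def idem)
  then have "sing K (chains (Suc n)) k s = dl b \<odot>\<^bsub>C (Suc n)\<^esub> contr n (sing K (chains n) k t)"
    using b tw sing by (simp add: contr_sing ch.dl_sing one_Cons_wchains)
  then have "f (sing K (chains (Suc n)) k s) = dl b \<odot>\<^bsub>M\<^esub> f (contr n (sing K (chains n) k t))"
    using mod_homD(3)[OF f] sing by (simp add: sing_A contr_closed ch.sing_F)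
  then show ?case using z sing by (simp add: ch.sing_F M.M.smult_r_null sing_A)
qed

end

section \<open>The augmented complex of a one-dimensional module\<close>

locale lrb_character = lrb_filter B K Q + M: lrb_module B K M
  for B :: "('b, 'y) monoid_scheme" (structure) and K :: "('k, 'x) ring_scheme" and Q :: "'b set"
    and M :: "('b \<Rightarrow> 'k, 'm, 'z) module_scheme" +
  fixes v :: 'm
  assumes v_closed: "v \<in> carrier M" and v_nonzero: "v \<noteq> \<zero>\<^bsub>M\<^esub>"
    and M_line: "carrier M = (\<lambda>k. sc k \<odot>\<^bsub>M\<^esub> v) ` carrier K"
    and dl_v: "b \<in> carrier B \<Longrightarrow> dl b \<odot>\<^bsub>M\<^esub> v = (if b \<in> Q then v else \<zero>\<^bsub>M\<^esub>)"
begin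

interpretation ch: bset B K "wchains n" "chains n" act for n by (rule chains_bset)

lemma M_module: "left_module A M" by (rule M.M.left_module_axioms)

lemma sc_v_zero:
  assumes "k \<in> carrier K" "sc k \<odot>\<^bsub>M\<^esub> v = \<zero>\<^bsub>M\<^esub>" shows "k = \<zero>\<^bsub>K\<^esub>"
proof (rule ccontr)
  assume "k \<noteq> \<zero>\<^bsub>K\<^esub>"
  then have k: "k \<in> Units K" using assms K.field_Units by simp
  have "v = sc (inv\<^bsub>K\<^esub> k) \<odot>\<^bsub>M\<^esub> (sc k \<odot>\<^bsub>M\<^esub> v)"
    using M.sc_sc[of "inv\<^bsub>K\<^esub> k" k v] assms k v_closed M.M.smult_one[of v]
    by (simp add: K.Units_l_inv monoid_algebra_simps(3))
  then show False using assms k v_nonzero by (simp add: M.M.smult_r_null sing_A)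
qed

definition aug :: "('b list \<Rightarrow> 'k) \<Rightarrow> 'm" where
  "aug = bset.span_hom B K (chains 0) M (\<lambda>t. if t \<in> chains 0 then v else \<zero>\<^bsub>M\<^esub>)"

lemma chains_0: "chains 0 = (\<lambda>a. [a]) ` Q"
  using Q_subset by (auto simp: chains_def wchains_def length_Suc_conv)

lemma aug_equivariant: "bset.equivariant B K (chains 0) act M (\<lambda>t. if t \<in> chains 0 then v else \<zero>\<^bsub>M\<^esub>)"
  unfolding ch.equivariant_def
proof (intro conjI allI impI ballI)
  fix b t assume b: "b \<in> carrier B" and t: "t \<in> chains 0"
  then obtain a where a: "t = [a]" "a \<in> Q" by (auto simp: chains_0)
  have "act b t \<in> chains 0 \<longleftrightarrow> b \<in> Q"
    using a b Q_subset Q_mult[of b a] by (auto simp: chains_0 act_def)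
  then show "dl b \<odot>\<^bsub>M\<^esub> (if t \<in> chains 0 then v else \<zero>\<^bsub>M\<^esub>) = (if act b t \<in> chains 0 then v else \<zero>\<^bsub>M\<^esub>)"
    using t b dl_v by simp
qed (auto simp: v_closed)

lemma aug_hom: "aug \<in> mod_hom A (C 0) M"
  unfolding aug_def by (rule ch.span_hom[OF M_module aug_equivariant])

lemma aug_sing: "k \<in> carrier K \<Longrightarrow> t \<in> chains 0 \<Longrightarrow> aug (sing K (chains 0) k t) = sc k \<odot>\<^bsub>M\<^esub> v"
  unfolding aug_def using ch.span_hom_sing[OF M_module aug_equivariant, of k t] by (simp add: chains_def)

lemma one_chain: "[\<one>] \<in> chains 0" using Q_one by (simp add: chains_0)

text \<open>In degree 0 the homotopy identity acquires the term of the augmentation, a multiple of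
  the chain \<open>[\<one>]\<close>. The scalar is only asserted to exist because \<open>aug\<close>
  takes values in \<open>M\<close>, where it is the coordinate with respect to
  \<open>v\<close>.\<close>

lemma contr_homotopy_0:
  assumes "x \<in> carrier (C 0)"
  shows "\<exists>k\<in>carrier K. sc k \<odot>\<^bsub>M\<^esub> v = aug x \<and> bd 0 (contr 0 x) \<oplus>\<^bsub>C 0\<^esub> sing K (chains 0) k [\<one>] = x"
  using assms
proof (induction x rule: ch.F_induct)
  case zero
  show ?case
  proof (rule bexI[of _ "\<zero>\<^bsub>K\<^esub>"], rule conjI)
    show "sc \<zero>\<^bsub>K\<^esub> \<odot>\<^bsub>M\<^esub> v = aug \<zero>\<^bsub>C 0\<^esub>"
      using M.sc_zero[OF v_closed] mod_hom_zero[OF aug_hom C_module M_module] by simp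
  qed (simp_all add: contr_zero mod_hom_zero[OF bd_hom C_module C_module] sing_zero ch.span_module_simps(3)[symmetric])
next
  case (add x y)
  then obtain k l where kl: "k \<in> carrier K" "sc k \<odot>\<^bsub>M\<^esub> v = aug x"
    "bd 0 (contr 0 x) \<oplus>\<^bsub>C 0\<^esub> sing K (chains 0) k [\<one>] = x"
    "l \<in> carrier K" "sc l \<odot>\<^bsub>M\<^esub> v = aug y" "bd 0 (contr 0 y) \<oplus>\<^bsub>C 0\<^esub> sing K (chains 0) l [\<one>] = y"
    by blast
  have c: "bd 0 (contr 0 z) \<in> carrier (C 0)" if "z \<in> carrier (C 0)" for z
    using that mod_homD(1)[OF bd_hom] contr_closed by blast
  show ?case
  proof (intro bexI conjI)
    show "sc (k \<oplus>\<^bsub>K\<^esub> l) \<odot>\<^bsub>M\<^esub> v = aug (x \<oplus>\<^bsub>C 0\<^esub> y)"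
      using kl add by (simp add: M.sc_add v_closed mod_homD(2)[OF aug_hom])
    have "bd 0 (contr 0 (x \<oplus>\<^bsub>C 0\<^esub> y)) \<oplus>\<^bsub>C 0\<^esub> sing K (chains 0) (k \<oplus>\<^bsub>K\<^esub> l) [\<one>]
        = (bd 0 (contr 0 x) \<oplus>\<^bsub>C 0\<^esub> bd 0 (contr 0 y)) \<oplus>\<^bsub>C 0\<^esub>
          (sing K (chains 0) k [\<one>] \<oplus>\<^bsub>C 0\<^esub> sing K (chains 0) l [\<one>])"
      using kl add by (simp add: contr_add mod_homD(2)[OF bd_hom] contr_closed sing_add_C)
    also have "\<dots> = (bd 0 (contr 0 x) \<oplus>\<^bsub>C 0\<^esub> sing K (chains 0) k [\<one>]) \<oplus>\<^bsub>C 0\<^esub>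
          (bd 0 (contr 0 y) \<oplus>\<^bsub>C 0\<^esub> sing K (chains 0) l [\<one>])"
      using add c kl(1,4) by (simp add: ch.F.M.M.a_ac ch.sing_F)
    finally show "bd 0 (contr 0 (x \<oplus>\<^bsub>C 0\<^esub> y)) \<oplus>\<^bsub>C 0\<^esub> sing K (chains 0) (k \<oplus>\<^bsub>K\<^esub> l) [\<one>] = x \<oplus>\<^bsub>C 0\<^esub> y"
      using kl by simp
  qed (use kl in simp)
next
  case (sing k t)
  then obtain a where a: "t = [a]" "a \<in> Q" by (auto simp: chains_0)
  have tw: "t \<in> wchains 0" using sing by (simp add: chains_def)
  have "bd 0 (contr 0 (sing K (chains 0) k t)) = bd_sum 0 k (\<one> # t)"
    using tw sing a Q_one by (simp add: contr_sing bd_sing one_Cons_wchains)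
  also have "\<dots> = sing K (chains 0) (\<ominus>\<^bsub>K\<^esub> k) [\<one>] \<oplus>\<^bsub>C 0\<^esub> sing K (chains 0) k t"
    unfolding bd_sum_def using sing a
    by (subst ch.F.M.M.finsum_Suc2) (auto simp: ch.sing_F sgn_0 sgn_Suc K.r_minus Pi_def)
  finally have "bd 0 (contr 0 (sing K (chains 0) k t)) \<oplus>\<^bsub>C 0\<^esub> sing K (chains 0) k [\<one>]
      = sing K (chains 0) k t \<oplus>\<^bsub>C 0\<^esub> (sing K (chains 0) (\<ominus>\<^bsub>K\<^esub> k) [\<one>] \<oplus>\<^bsub>C 0\<^esub> sing K (chains 0) k [\<one>])"
    using sing by (simp add: ch.F.M.M.a_ac ch.sing_F)
  also have "\<dots> = sing K (chains 0) k t"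
  proof -
    have "sing K (chains 0) (\<ominus>\<^bsub>K\<^esub> k) [\<one>] \<oplus>\<^bsub>C 0\<^esub> sing K (chains 0) k [\<one>] = \<zero>\<^bsub>C 0\<^esub>"
      using sing(1) by (simp only: sing_add_C K.a_inv_closed K.l_neg sing_zero ch.span_module_simps(3))
    then show ?thesis using ch.F.M.M.r_zero[OF ch.sing_F[OF sing(1)]] by (simp only:)
  qed
  finally have "bd 0 (contr 0 (sing K (chains 0) k t)) \<oplus>\<^bsub>C 0\<^esub> sing K (chains 0) k [\<one>] = sing K (chains 0) k t" .
  with aug_sing[OF sing] sing(1) show ?case by (intro bexI[of _ k] conjI) simp_all
qed

text \<open>Applying \<open>aug\<close> to the homotopy identity yields \<open>aug y\<close> on both
  sides plus the term in question. So that term vanishes on the image of the contraction, which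
  generates.\<close>

lemma aug_bd:
  assumes "x \<in> carrier (C (Suc 0))" shows "aug (bd 0 x) = \<zero>\<^bsub>M\<^esub>"
proof (rule hom_zero_via_contr[OF M_module mod_hom_comp[OF bd_hom aug_hom] _ assms])
  fix y assume y: "y \<in> carrier (C 0)"
  obtain k where k: "k \<in> carrier K" "sc k \<odot>\<^bsub>M\<^esub> v = aug y"
    "bd 0 (contr 0 y) \<oplus>\<^bsub>C 0\<^esub> sing K (chains 0) k [\<one>] = y"
    using contr_homotopy_0[OF y] by blast
  have c: "bd 0 (contr 0 y) \<in> carrier (C 0)" using mod_homD(1)[OF bd_hom contr_closed[OF y]] .
  have ac: "aug (bd 0 (contr 0 y)) \<in> carrier M" "aug y \<in> carrier M"
    using mod_homD(1)[OF aug_hom] c y by blast+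
  have "aug (bd 0 (contr 0 y) \<oplus>\<^bsub>C 0\<^esub> sing K (chains 0) k [\<one>])
      = aug (bd 0 (contr 0 y)) \<oplus>\<^bsub>M\<^esub> aug (sing K (chains 0) k [\<one>])"
    by (rule mod_homD(2)[OF aug_hom c ch.sing_F[OF k(1)]])
  then have "aug (bd 0 (contr 0 y)) \<oplus>\<^bsub>M\<^esub> aug y = aug y"
    by (simp only: k(2,3) aug_sing[OF k(1) one_chain])
  then show "aug (bd 0 (contr 0 y)) = \<zero>\<^bsub>M\<^esub>"
    by (rule M.M.M.zero_if_add_eq[OF _ ac])
qed

text \<open>Write \<open>h\<close> for the contraction. The boundary of the homotopy identity at
  \<open>y\<close> says that \<open>bd bd h y + bd h bd y = bd y\<close>. By induction
  \<open>bd y\<close> is a cycle, so the identity one degree lower gives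
  \<open>bd h bd y = bd y\<close>. Hence \<open>bd bd\<close> kills the image of \<open>h\<close>.
  The induction starts from \<open>aug_bd\<close>.\<close>

lemma bd_bd:
  assumes "x \<in> carrier (C (Suc (Suc n)))" shows "bd n (bd (Suc n) x) = \<zero>\<^bsub>C n\<^esub>"
  using assms
proof (induction n arbitrary: x)
  case 0
  show ?case
  proof (rule hom_zero_via_contr[OF C_module mod_hom_comp[OF bd_hom bd_hom] _ 0])
    fix y assume y: "y \<in> carrier (C (Suc 0))"
    have z: "bd 0 y \<in> carrier (C 0)" using mod_homD(1)[OF bd_hom y] .
    have c: "bd (Suc 0) (contr (Suc 0) y) \<in> carrier (C (Suc 0))" using mod_homD(1)[OF bd_hom contr_closed[OF y]] .
    obtain k where k: "k \<in> carrier K" "sc k \<odot>\<^bsub>M\<^esub> v = aug (bd 0 y)"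
      "bd 0 (contr 0 (bd 0 y)) \<oplus>\<^bsub>C 0\<^esub> sing K (chains 0) k [\<one>] = bd 0 y"
      using contr_homotopy_0[OF z] by blast
    have "k = \<zero>\<^bsub>K\<^esub>" using k aug_bd[OF y] sc_v_zero by simp
    then have "bd 0 (contr 0 (bd 0 y)) = bd 0 y"
      using k(3) mod_homD(1)[OF bd_hom contr_closed[OF z]]
      by (simp add: sing_zero ch.span_module_simps(3)[symmetric])
    moreover have "bd 0 (bd (Suc 0) (contr (Suc 0) y)) \<oplus>\<^bsub>C 0\<^esub> bd 0 (contr 0 (bd 0 y)) = bd 0 y"
      using mod_homD(2)[OF bd_hom c contr_closed[OF z]] contr_homotopy[OF y] by simp
    ultimately show "bd 0 (bd (Suc 0) (contr (Suc 0) y)) = \<zero>\<^bsub>C 0\<^esub>"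
      using mod_homD(1)[OF bd_hom c] z ch.F.M.M.zero_if_add_eq by simp
  qed
next
  case (Suc n)
  show ?case
  proof (rule hom_zero_via_contr[OF C_module mod_hom_comp[OF bd_hom bd_hom] _ Suc.prems])
    fix y assume y: "y \<in> carrier (C (Suc (Suc n)))"
    have z: "bd (Suc n) y \<in> carrier (C (Suc n))" using mod_homD(1)[OF bd_hom y] .
    have c: "bd (Suc (Suc n)) (contr (Suc (Suc n)) y) \<in> carrier (C (Suc (Suc n)))" using mod_homD(1)[OF bd_hom contr_closed[OF y]] .
    have "bd (Suc n) (contr (Suc n) (bd (Suc n) y)) = bd (Suc n) y"
      using contr_homotopy[OF z] Suc.IH[OF y] mod_homD(1)[OF bd_hom contr_closed[OF z]] by (simp add: contr_zero)
    moreover have "bd (Suc n) (bd (Suc (Suc n)) (contr (Suc (Suc n)) y)) \<oplus>\<^bsub>C (Suc n)\<^esub> bd (Suc n) (contr (Suc n) (bd (Suc n) y)) = bd (Suc n) y"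
      using mod_homD(2)[OF bd_hom c contr_closed[OF z]] contr_homotopy[OF y] by simp
    ultimately show "bd (Suc n) (bd (Suc (Suc n)) (contr (Suc (Suc n)) y)) = \<zero>\<^bsub>C (Suc n)\<^esub>"
      using mod_homD(1)[OF bd_hom c] z ch.F.M.M.zero_if_add_eq by simp
  qed
qed

text \<open>By the homotopy identity a cycle \<open>z\<close> is the boundary of its own
  contraction.\<close>

lemma C_resolution: "resolution A C bd aug M"
  unfolding resolution_def
proof (intro conjI allI)
  show "aug ` carrier (C 0) = carrier M"
  proof
    show "aug ` carrier (C 0) \<subseteq> carrier M" using mod_homD(1)[OF aug_hom] by blast
    show "carrier M \<subseteq> aug ` carrier (C 0)"
      unfolding M_line using aug_sing[OF _ one_chain] ch.sing_F by (metis (no_types, lifting) image_subsetI imageI)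
  qed
  show "bd 0 ` carrier (C 1) = a_kernel (C 0) M aug"
  proof (intro subset_antisym subsetI)
    fix z assume "z \<in> bd 0 ` carrier (C 1)"
    then show "z \<in> a_kernel (C 0) M aug"
      using aug_bd mod_homD(1)[OF bd_hom, of _ 0] by (auto simp: a_kernel_iff)
  next
    fix z assume "z \<in> a_kernel (C 0) M aug"
    then have z: "z \<in> carrier (C 0)" "aug z = \<zero>\<^bsub>M\<^esub>" by (simp_all add: a_kernel_iff)
    obtain k where k: "k \<in> carrier K" "sc k \<odot>\<^bsub>M\<^esub> v = aug z"
      "bd 0 (contr 0 z) \<oplus>\<^bsub>C 0\<^esub> sing K (chains 0) k [\<one>] = z"
      using contr_homotopy_0[OF z(1)] by blast
    have "k = \<zero>\<^bsub>K\<^esub>" using k z sc_v_zero by simp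
    then have "bd 0 (contr 0 z) = z"
      using k(3) mod_homD(1)[OF bd_hom contr_closed[OF z(1)]]
      by (simp add: sing_zero ch.span_module_simps(3)[symmetric])
    then show "z \<in> bd 0 ` carrier (C 1)" using contr_closed[OF z(1)] by (metis One_nat_def imageI)
  qed
  fix n
  show "bd (Suc n) ` carrier (C (Suc (Suc n))) = a_kernel (C (Suc n)) (C n) (bd n)"
  proof (intro subset_antisym subsetI)
    fix z assume "z \<in> bd (Suc n) ` carrier (C (Suc (Suc n)))"
    then show "z \<in> a_kernel (C (Suc n)) (C n) (bd n)"
      using bd_bd mod_homD(1)[OF bd_hom, of _ "Suc n"] by (auto simp: a_kernel_iff)
  next
    fix z assume "z \<in> a_kernel (C (Suc n)) (C n) (bd n)"
    then have z: "z \<in> carrier (C (Suc n))" "bd n z = \<zero>\<^bsub>C n\<^esub>" by (simp_all add: a_kernel_iff)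
    have "bd (Suc n) (contr (Suc n) z) = z"
      using contr_homotopy[OF z(1)] z(2) mod_homD(1)[OF bd_hom contr_closed[OF z(1)]] by (simp add: contr_zero)
    then show "z \<in> bd (Suc n) ` carrier (C (Suc (Suc n)))" using contr_closed[OF z(1)] by (metis imageI)
  qed
qed (simp_all add: M_module C_module bd_hom aug_hom)

end


section \<open>Projectivity of the chain modules\<close>

context lrb_algebra begin

text \<open>The elements of the band lying above \<open>b\<close> in the semilattice of principal left ideals.\<close>

definition above :: "'b \<Rightarrow> 'b set" where
  "above b = {c \<in> carrier B. b \<otimes> c = b}"

lemma above_refl: "b \<in> carrier B \<Longrightarrow> b \<in> above b"
  by (simp add: above_def idem)

text \<open>If \<open>b x y = b\<close>, then \<open>b x = b x y x = b x y = b\<close>, and then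
  \<open>b y = b\<close>.\<close>

lemma above_mult_iff:
  assumes "b \<in> carrier B" "x \<in> carrier B" "y \<in> carrier B"
  shows "x \<otimes> y \<in> above b \<longleftrightarrow> x \<in> above b \<and> y \<in> above b"
proof
  assume "x \<otimes> y \<in> above b"
  then have e: "b \<otimes> x \<otimes> y = b" using assms by (simp add: above_def m_assoc)
  have "b \<otimes> x = b \<otimes> x \<otimes> y \<otimes> x" by (simp add: e)
  also have "\<dots> = b \<otimes> (x \<otimes> y \<otimes> x)" using assms by (simp add: m_assoc)
  also have "\<dots> = b \<otimes> x \<otimes> y" using assms by (simp add: left_regular m_assoc[of b x y])
  finally have 1: "b \<otimes> x = b" using e by simp
  then have "b \<otimes> y = b" using e by simp
  with 1 show "x \<in> above b \<and> y \<in> above b" using assms by (simp add: above_def)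
next
  assume "x \<in> above b \<and> y \<in> above b"
  then show "x \<otimes> y \<in> above b" using assms by (simp add: above_def m_assoc[symmetric])
qed

lemma above_mono:
  assumes "b \<in> carrier B" "c \<in> carrier B" shows "above b \<subseteq> above (c \<otimes> b)"
  using assms by (auto simp: above_def m_assoc)

text \<open>An equation \<open>c b x = c b\<close> loses its factor \<open>c\<close> after
  multiplication by \<open>b\<close> on the left, since \<open>b c = b\<close>.\<close>

lemma above_mult_eq:
  assumes b: "b \<in> carrier B" and c: "c \<in> above b" shows "above (c \<otimes> b) = above b"
proof
  have cB: "c \<in> carrier B" and bc: "b \<otimes> c = b" using c by (auto simp: above_def)
  show "above b \<subseteq> above (c \<otimes> b)" by (rule above_mono[OF b cB])
  show "above (c \<otimes> b) \<subseteq> above b"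
  proof
    fix x assume "x \<in> above (c \<otimes> b)"
    then have x: "x \<in> carrier B" "c \<otimes> b \<otimes> x = c \<otimes> b" by (auto simp: above_def)
    have "b \<otimes> (c \<otimes> b \<otimes> x) = b \<otimes> (c \<otimes> b)" using x by simp
    then have "b \<otimes> c \<otimes> b \<otimes> x = b \<otimes> c \<otimes> b" using b cB x by (simp add: m_assoc)
    then show "x \<in> above b" using bc x b by (simp add: idem above_def)
  qed
qed

lemma finite_above: "finite (above b)"
  using finite_B by (simp add: above_def)

lemma card_above_le: "card (above b) \<le> card (carrier B)"
  by (rule card_mono[OF finite_B]) (auto simp: above_def)

lemma card_above_mono:
  assumes "b \<in> carrier B" "c \<in> carrier B" shows "card (above b) \<le> card (above (c \<otimes> b))"
  by (rule card_mono[OF finite_above above_mono[OF assms]])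

text \<open>The witness for strictness is \<open>c\<close> itself: \<open>c b c = c b\<close>. So
  \<open>card (above b)\<close> grades the band: left multiplication preserves the class of
  \<open>b\<close> or strictly raises this number.\<close>

lemma card_above_strict:
  assumes b: "b \<in> carrier B" and c: "c \<in> carrier B" "c \<notin> above b"
  shows "card (above b) < card (above (c \<otimes> b))"
proof (rule psubset_card_mono[OF finite_above])
  have "c \<in> above (c \<otimes> b)" using b c by (simp add: above_def left_regular)
  then show "above b \<subset> above (c \<otimes> b)" using above_mono[OF b c(1)] c(2) by blast
qed

text \<open>Elements with the same \<open>above\<close> form an \<open>\<L>\<close>-class; this
  picks one element of each class.\<close>

definition rep :: "'b \<Rightarrow> 'b" where
  "rep b = (SOME x. x \<in> carrier B \<and> above x = above b)"

lemma rep: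
  assumes "b \<in> carrier B" shows "rep b \<in> carrier B" "above (rep b) = above b"
  using someI[of "\<lambda>x. x \<in> carrier B \<and> above x = above b" b] assms by (auto simp: rep_def)

lemma rep_cong: "above b = above b' \<Longrightarrow> rep b = rep b'"
  by (simp add: rep_def)

end

section \<open>Lifting one level of classes at a time\<close>

context lrb_filter begin

interpretation ch: bset B K "wchains n" "chains n" act for n by (rule chains_bset)

lemma equivariant_chain_eq:
  assumes "bset.equivariant B K (chains n) act N m" "c \<in> carrier B" "t \<in> wchains n" "left_module A N"
  shows "dl c \<odot>\<^bsub>N\<^esub> m t = m (act c t)"
proof (cases "t \<in> chains n")
  case True
  then show ?thesis using assms by (simp add: ch.equivariant_def)
next
  case False
  then have "act c t \<notin> chains n" using ch.act_T assms by blast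
  then show ?thesis
    using False assms left_module.smult_r_null[OF assms(4)] by (simp add: ch.equivariant_def sing_A)
qed

text \<open>The correction \<open>y - a y + m (a u)\<close> makes \<open>a\<close> act on the lift as prescribed, and
  \<open>a' a = a' a a'\<close> shows that it preserves what has been arranged for \<open>a'\<close>.\<close>

lemma lift_step:
  assumes M: "left_module A M" and N: "left_module A N" and g: "g \<in> mod_hom A M N"
    and nn: "bset.equivariant B K (chains n) act N nn"
    and u: "u \<in> chains n" and e: "hd u = e" and im: "nn u \<in> g ` carrier M"
    and mc: "\<And>t. m t \<in> carrier M"
    and gm: "\<And>a. a \<in> carrier B - above e \<Longrightarrow> g (m (act a u)) = nn (act a u)"
    and em: "\<And>a c. a \<in> carrier B - above e \<Longrightarrow> c \<in> carrier B \<Longrightarrow> dl c \<odot>\<^bsub>M\<^esub> m (act a u) = m (act c (act a u))"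
  shows "\<exists>y\<in>carrier M. g y = nn u \<and> (\<forall>a\<in>carrier B - above e. dl a \<odot>\<^bsub>M\<^esub> y = m (act a u))"
proof -
  interpret M: lrb_module B K M using M lrb_algebra_axioms by (simp add: lrb_module_def)
  interpret N: lrb_module B K N using N lrb_algebra_axioms by (simp add: lrb_module_def)
  have uw: "u \<in> wchains n" using u by (simp add: chains_def)
  have eB: "e \<in> carrier B" using wchainsD(3)[OF uw] e by simp
  have "\<exists>y\<in>carrier M. g y = nn u \<and> (\<forall>a\<in>S. dl a \<odot>\<^bsub>M\<^esub> y = m (act a u))" if "S \<subseteq> carrier B - above e" for S
    using finite_subset[OF that] finite_B that
  proof (induction S rule: infinite_finite_induct)
    case empty
    then show ?case using im by auto
  next
    case (insert a S)
    then obtain y where y: "y \<in> carrier M" "g y = nn u" and yS: "\<And>b. b \<in> S \<Longrightarrow> dl b \<odot>\<^bsub>M\<^esub> y = m (act b u)"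
      by auto
    have a: "a \<in> carrier B - above e" "a \<in> carrier B" using insert by auto
    let ?y = "y \<oplus>\<^bsub>M\<^esub> (\<ominus>\<^bsub>M\<^esub> (dl a \<odot>\<^bsub>M\<^esub> y) \<oplus>\<^bsub>M\<^esub> m (act a u))"
    have cl: "dl b \<odot>\<^bsub>M\<^esub> y \<in> carrier M" for b using y by (simp add: M.dl_closed)
    have "g ?y = nn u \<oplus>\<^bsub>N\<^esub> (\<ominus>\<^bsub>N\<^esub> (dl a \<odot>\<^bsub>N\<^esub> nn u) \<oplus>\<^bsub>N\<^esub> nn (act a u))"
      using y cl mc a
      by (simp add: mod_homD(2)[OF g] mod_hom_minus[OF g M N] mod_homD(3)[OF g] sing_A gm)
    also have "\<dots> = nn u"
      using equivariant_chain_eq[OF nn a(2) uw N] nn by (simp add: ch.equivariant_def N.M.M.l_neg)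
    finally have 1: "g ?y = nn u" .
    have expand: "dl b \<odot>\<^bsub>M\<^esub> ?y = dl b \<odot>\<^bsub>M\<^esub> y \<oplus>\<^bsub>M\<^esub> (\<ominus>\<^bsub>M\<^esub> (dl (b \<otimes> a) \<odot>\<^bsub>M\<^esub> y) \<oplus>\<^bsub>M\<^esub> m (act (b \<otimes> a) u))"
      if b: "b \<in> carrier B" for b
      using y cl mc a b em[OF a(1) b]
      by (simp add: M.M.smult_r_distr M.M.smult_r_minus sing_A M.dl_dl act_mult[OF _ _ uw])
    have 2: "dl b \<odot>\<^bsub>M\<^esub> ?y = m (act b u)" if b: "b \<in> insert a S" for b
    proof (cases "b = a")
      case True
      then show ?thesis
        using expand[OF a(2)] a cl mc by (simp add: idem M.M.M.r_neg2)
    next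
      case False
      then have b: "b \<in> S" "b \<in> carrier B - above e" "b \<in> carrier B" using that insert by auto
      have "dl (b \<otimes> a) \<odot>\<^bsub>M\<^esub> y = dl (b \<otimes> a) \<odot>\<^bsub>M\<^esub> (dl b \<odot>\<^bsub>M\<^esub> y)"
        using a b y by (simp add: M.dl_dl left_regular)
      also have "\<dots> = m (act (b \<otimes> a) (act b u))" using a b by (simp add: yS em)
      also have "\<dots> = m (act (b \<otimes> a) u)" using a b by (simp add: act_mult[OF _ _ uw] left_regular)
      finally show ?thesis using expand[OF b(3)] yS[OF b(1)] mc by (simp add: M.M.M.l_neg)
    qed
    show ?case
      using 1 2 y cl mc by (intro bexI[of _ ?y]) auto
  qed auto
  then show ?thesis by blast
qed

text \<open>The lift is an equivariant family of preimages, built in order of decreasing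
  \<open>card (above (hd t))\<close>. The action leads from a chain to chains of its own class or to
  earlier levels, whose values are already fixed. \<open>lift_step\<close> makes a preimage
  compatible with these; within a class everything is transported from the chains whose head is the
  chosen representative.\<close>

lemma chain_modules_lift:
  assumes M: "left_module A M" and N: "left_module A N"
  shows "lifts A (C n) M N"
  unfolding lifts_def
proof (intro ballI impI)
  fix f g assume f: "f \<in> mod_hom A (C n) N" and g: "g \<in> mod_hom A M N"
    and im: "f ` carrier (C n) \<subseteq> g ` carrier M"
  interpret M: lrb_module B K M using M lrb_algebra_axioms by (simp add: lrb_module_def)
  interpret N: lrb_module B K N using N lrb_algebra_axioms by (simp add: lrb_module_def)
  define nn where "nn t = f (cell n t)" for t
  have nn: "bset.equivariant B K (chains n) act N nn"
    unfolding nn_def by (rule ch.equivariant_of_hom[OF N f])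
  have nnim: "nn t \<in> g ` carrier M" for t using im ch.sing_F by (auto simp: nn_def)
  have nn0: "nn t = \<zero>\<^bsub>N\<^esub>" if "t \<notin> chains n" for t using nn that by (simp add: ch.equivariant_def)
  have g0: "g \<zero>\<^bsub>M\<^esub> = \<zero>\<^bsub>N\<^esub>" by (rule mod_hom_zero[OF g M N])
  let ?c = "card (carrier B)"
  \<comment> \<open>The chains handled after \<open>j\<close> rounds. The bound is kept additive to
    avoid subtraction of natural numbers: the set is empty for \<open>j = 0\<close> and contains
    every chain for \<open>j = Suc ?c\<close>.\<close>
  let ?L = "\<lambda>j. {t \<in> chains n. card (above (hd t)) + j > ?c}"
  have L_act: "act c t \<in> ?L j" if "t \<in> ?L j" "c \<in> carrier B" "act c t \<in> chains n" for c t j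
  proof -
    have "t \<in> wchains n" using that by (simp add: chains_def)
    then show ?thesis
      using that card_above_mono[of "hd t" c] by (simp add: hd_act wchainsD(3))
  qed
  have levels: "\<exists>m. (\<forall>t. m t \<in> carrier M) \<and> (\<forall>t. t \<notin> chains n \<longrightarrow> m t = \<zero>\<^bsub>M\<^esub>) \<and>
      (\<forall>t\<in>?L j. g (m t) = nn t \<and> (\<forall>c\<in>carrier B. dl c \<odot>\<^bsub>M\<^esub> m t = m (act c t)))" for j
  proof (induction j)
    case 0
    have "?L 0 = {}" using card_above_le by (auto simp: not_less)
    then show ?case by (intro exI[of _ "\<lambda>_. \<zero>\<^bsub>M\<^esub>"]) auto
  next
    case (Suc j)
    then obtain m where mc: "\<And>t. m t \<in> carrier M" and m0: "\<And>t. t \<notin> chains n \<Longrightarrow> m t = \<zero>\<^bsub>M\<^esub>"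
      and gm: "\<And>t. t \<in> ?L j \<Longrightarrow> g (m t) = nn t"
      and em: "\<And>t c. t \<in> ?L j \<Longrightarrow> c \<in> carrier B \<Longrightarrow> dl c \<odot>\<^bsub>M\<^esub> m t = m (act c t)" by blast
    let ?E = "{t \<in> chains n. card (above (hd t)) + j = ?c}"
    have up: "act a u \<in> ?L j" if "u \<in> ?E" "a \<in> carrier B - above (hd u)" "act a u \<in> chains n" for a u
    proof -
      have "u \<in> wchains n" using that by (simp add: chains_def)
      then show ?thesis
        using that card_above_strict[of "hd u" a] by (simp add: hd_act wchainsD(3))
    qed
    have "\<exists>y\<in>carrier M. g y = nn u \<and> (\<forall>a\<in>carrier B - above (hd u). dl a \<odot>\<^bsub>M\<^esub> y = m (act a u))"
      if u: "u \<in> ?E" for u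
    proof (rule lift_step[OF M N g nn _ refl nnim mc])
      have uw: "u \<in> wchains n" using u by (simp add: chains_def)
      show "u \<in> chains n" using u by simp
      fix a assume a: "a \<in> carrier B - above (hd u)"
      show "g (m (act a u)) = nn (act a u)"
        by (cases "act a u \<in> chains n") (use gm[OF up[OF u a]] m0 nn0 g0 in auto)
      fix c assume c: "c \<in> carrier B"
      show "dl c \<odot>\<^bsub>M\<^esub> m (act a u) = m (act c (act a u))"
      proof (cases "act a u \<in> chains n")
        case True
        then show ?thesis using up[OF u a] em c by blast
      next
        case False
        then have "act c (act a u) \<notin> chains n"
          using ch.act_T[OF c act_closed[OF _ uw, of a]] a by blast
        then show ?thesis using False m0 by (simp add: M.M.smult_r_null sing_A)
      qed
    qed
    then have "\<forall>u\<in>?E. \<exists>y. y \<in> carrier M \<and> g y = nn u \<and> (\<forall>a\<in>carrier B - above (hd u). dl a \<odot>\<^bsub>M\<^esub> y = m (act a u))"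
      by blast
    from bchoice[OF this] obtain Y where
      "\<forall>u\<in>?E. Y u \<in> carrier M \<and> g (Y u) = nn u \<and> (\<forall>a\<in>carrier B - above (hd u). dl a \<odot>\<^bsub>M\<^esub> Y u = m (act a u))" ..
    note Y0 = bspec[OF this]
    note Y = Y0[THEN conjunct1] Y0[THEN conjunct2, THEN conjunct1] Y0[THEN conjunct2, THEN conjunct2, THEN bspec]
    \<comment> \<open>A new chain \<open>t\<close> with head \<open>b\<close> is \<open>b\<close>
      applied to \<open>act e t\<close>, where \<open>e = rep b\<close>. This dictates its value.
      Using \<open>rep\<close> makes chains that differ by the action inside a class share the same
      \<open>Y\<close>.\<close>
    define m' where "m' t = (if t \<in> ?L j then m t else if t \<in> ?E then dl (hd t) \<odot>\<^bsub>M\<^esub> Y (act (rep (hd t)) t)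
      else \<zero>\<^bsub>M\<^esub>)" for t
    have m'L: "m' t = m t" if "t \<in> ?L j" for t using that by (simp add: m'_def)
    have m'0: "m' t = \<zero>\<^bsub>M\<^esub>" if "t \<notin> chains n" for t using that by (simp add: m'_def)
    have m'E: "m' t = dl (hd t) \<odot>\<^bsub>M\<^esub> Y (act (rep (hd t)) t)" if "t \<in> ?E" for t using that by (simp add: m'_def)
    have new: "act (rep (hd t)) t \<in> ?E" "hd (act (rep (hd t)) t) = rep (hd t)"
      "hd t \<otimes> rep (hd t) = hd t" "act (hd t) (act (rep (hd t)) t) = t"
      "t \<in> wchains n" "hd t \<in> carrier B" "rep (hd t) \<in> carrier B" "above (rep (hd t)) = above (hd t)"
      "rep (hd t) \<otimes> hd t = rep (hd t)"
      if t: "t \<in> ?E" for t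
    proof -
      show tw: "t \<in> wchains n" using t by (simp add: chains_def)
      show b: "hd t \<in> carrier B" by (rule wchainsD(3)[OF tw])
      note e = rep[OF b]
      then show "rep (hd t) \<in> carrier B" "above (rep (hd t)) = above (hd t)" .
      have "rep (hd t) \<in> above (hd t)" "hd t \<in> above (rep (hd t))"
        using above_refl[OF e(1)] above_refl[OF b] unfolding e(2) .
      then show be: "hd t \<otimes> rep (hd t) = hd t" "rep (hd t) \<otimes> hd t = rep (hd t)"
        by (simp_all add: above_def)
      then show h: "hd (act (rep (hd t)) t) = rep (hd t)" using hd_act[OF tw] by simp
      show a: "act (hd t) (act (rep (hd t)) t) = t"
        using act_mult[OF b e(1) tw] be act_hd[OF tw] by simp
      then have "act (rep (hd t)) t \<in> chains n"
        using ch.act_T[OF b act_closed[OF e(1) tw]] t by simp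
      then show "act (rep (hd t)) t \<in> ?E" using t h e(2) by simp
    qed
    have m'c: "m' t \<in> carrier M" for t
    proof -
      consider "t \<in> ?L j" | "t \<in> ?E" | "m' t = \<zero>\<^bsub>M\<^esub>" unfolding m'_def by meson
      then show ?thesis
      proof cases
        case 1
        then show ?thesis using m'L mc by simp
      next
        case 2
        then show ?thesis unfolding m'E[OF 2] by (rule M.dl_closed[OF Y(1)[OF new(1)]])
      qed simp
    qed
    show ?case
    proof (intro exI[of _ m'] conjI allI impI ballI)
      fix t assume "t \<in> ?L (Suc j)"
      then have tc: "t \<in> chains n" and tt: "t \<in> ?L j \<or> t \<in> ?E" by auto
      show "g (m' t) = nn t"
      proof (cases "t \<in> ?L j")
        case True
        then show ?thesis unfolding m'L[OF True] by (rule gm)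
      next
        case False
        then have E: "t \<in> ?E" using tt by blast
        have "g (m' t) = dl (hd t) \<odot>\<^bsub>N\<^esub> nn (act (rep (hd t)) t)"
          using m'E[OF E] Y(1,2)[OF new(1)[OF E]] mod_homD(3)[OF g] by (simp add: sing_A)
        also have "\<dots> = nn t"
          using equivariant_chain_eq[OF nn new(6)[OF E] act_closed[OF new(7,5)[OF E]] N] new(4)[OF E] by simp
        finally show ?thesis .
      qed
      fix c assume c: "c \<in> carrier B"
      show "dl c \<odot>\<^bsub>M\<^esub> m' t = m' (act c t)"
      proof (cases "t \<in> ?L j")
        case True
        then have "dl c \<odot>\<^bsub>M\<^esub> m' t = m (act c t)" unfolding m'L[OF True] using c by (rule em)
        also have "\<dots> = m' (act c t)"
          by (cases "act c t \<in> chains n") (use m'L[OF L_act[OF True c]] m'0 m0 in auto)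
        finally show ?thesis .
      next
        case False
        then have E: "t \<in> ?E" using tt by blast
        note E' = new[OF E]
        let ?b = "hd t" and ?e = "rep (hd t)"
        have l: "dl c \<odot>\<^bsub>M\<^esub> m' t = dl (c \<otimes> ?b) \<odot>\<^bsub>M\<^esub> Y (act ?e t)"
          using m'E[OF E] c E' Y(1)[OF E'(1)] by (simp add: M.dl_dl)
        show ?thesis
        proof (cases "c \<in> above ?b")
          case True
          \<comment> \<open>Here \<open>c\<close> stays inside the class: the representative
            \<open>e\<close> is unchanged and \<open>e c = e\<close>, so both chains refer to the
            same value of \<open>Y\<close>.\<close>
          have ab: "above (c \<otimes> ?b) = above ?b" by (rule above_mult_eq[OF E'(6) True])
          have bc: "?b \<otimes> c = ?b" using True by (simp add: above_def)
          have "c \<in> above ?e" using True unfolding E'(8) .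
          then have ec: "?e \<otimes> c = ?e" by (simp add: above_def)
          have "act ?b (act c t) = t" using act_mult[OF E'(6) c E'(5)] bc act_hd[OF E'(5)] by simp
          then have "act c t \<in> chains n" using ch.act_T[OF E'(6) act_closed[OF c E'(5)]] tc by simp
          then have "act c t \<in> ?E" using E ab hd_act[OF E'(5)] by simp
          then have "m' (act c t) = dl (c \<otimes> ?b) \<odot>\<^bsub>M\<^esub> Y (act ?e (act c t))"
            using m'E hd_act[OF E'(5)] rep_cong[OF ab] by simp
          also have "act ?e (act c t) = act ?e t" using act_mult[OF E'(7) c E'(5)] ec by simp
          finally show ?thesis using l by simp
        next
          case nc: False
          \<comment> \<open>Here \<open>c\<close> leaves the class, and so does
            \<open>c \<otimes> ?b\<close> acting on \<open>act ?e t\<close>; for such elements the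
            action on \<open>Y\<close> was prescribed by \<open>lift_step\<close>.\<close>
          have "c \<otimes> ?b \<in> carrier B - above (hd (act ?e t))"
            using above_mult_iff[OF E'(7) c E'(6)] nc E'(2,8,6) c by auto
          then have "dl c \<odot>\<^bsub>M\<^esub> m' t = m (act (c \<otimes> ?b) (act ?e t))"
            using l Y(3)[OF E'(1)] by simp
          also have "act (c \<otimes> ?b) (act ?e t) = act c t"
            using act_mult[OF c E'(6) act_closed[OF E'(7,5)]] E'(4) by simp
          finally have l2: "dl c \<odot>\<^bsub>M\<^esub> m' t = m (act c t)" .
          show ?thesis
          proof (cases "act c t \<in> chains n")
            case True
            then have "act c t \<in> ?L j" using up[OF E] nc c by blast
            then show ?thesis using l2 m'L by simp
          next
            case False
            then show ?thesis using l2 m0 m'0 by simp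
          qed
        qed
      qed
    qed (simp_all add: m'c m'0)
  qed
  have all: "?L (Suc ?c) = chains n" by auto
  from levels[of "Suc ?c", unfolded all] obtain m where m: "\<And>t. m t \<in> carrier M" "\<And>t. t \<notin> chains n \<Longrightarrow> m t = \<zero>\<^bsub>M\<^esub>"
    "\<And>t. t \<in> chains n \<Longrightarrow> g (m t) = nn t"
    "\<And>t c. t \<in> chains n \<Longrightarrow> c \<in> carrier B \<Longrightarrow> dl c \<odot>\<^bsub>M\<^esub> m t = m (act c t)" by blast
  then have eq: "bset.equivariant B K (chains n) act M m" by (simp add: ch.equivariant_def)
  let ?h = "bset.span_hom B K (chains n) M m"
  have h: "?h \<in> mod_hom A (C n) M" by (rule ch.span_hom[OF M eq])
  have "g (?h (cell n t)) = f (cell n t)" if t: "t \<in> chains n" for t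
  proof -
    have "?h (cell n t) = m t"
      using ch.span_hom_sing[OF M eq, of "\<one>\<^bsub>K\<^esub>" t] m(1) M.M.smult_one t
      by (simp add: chains_def monoid_algebra_simps)
    then show ?thesis using m(3)[OF t] by (simp add: nn_def)
  qed
  note key = ch.span_hom_eqI[OF mod_hom_comp[OF h g] f N this]
  show "\<exists>h\<in>mod_hom A (C n) M. \<forall>x\<in>carrier (C n). g (h x) = f x"
    by (rule bexI[OF _ h], rule ballI, rule key)
qed

end


section \<open>Alternating cochains\<close>

lemma del_append:
  "del j (us @ zs) = (if j < length us then del j us @ zs else us @ del (j - length us) zs)"
  by (auto simp: del_def Suc_diff_le)

lemma ordered_faces_swap:
  "us @ a # b # vs \<in> ordered_faces \<Delta> n \<Longrightarrow> us @ b # a # vs \<in> ordered_faces \<Delta> n"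
  by (auto simp: ordered_faces_def insert_commute)

lemma ordered_faces_del:
  assumes "\<And>s t. s \<in> \<Delta> \<Longrightarrow> t \<subseteq> s \<Longrightarrow> t \<in> \<Delta>" and "xs \<in> ordered_faces \<Delta> (Suc n)" "j \<le> n"
  shows "del j xs \<in> ordered_faces \<Delta> n"
  using assms set_del_subset[of j xs] by (auto simp: ordered_faces_def length_del distinct_del)

text \<open>The two terms that delete a swapped vertex trade places, and their signs differ because
  their indices are adjacent. In every other term both vertices survive next to each other, and the
  sign comes from \<open>f\<close>.\<close>

lemma coboundary_swap:
  assumes K: "cring K" and down: "\<And>s t. s \<in> \<Delta> \<Longrightarrow> t \<subseteq> s \<Longrightarrow> t \<in> \<Delta>"
    and f: "f \<in> carrier (cochain_group K \<Delta> n)" and xs: "us @ a # b # vs \<in> ordered_faces \<Delta> (Suc n)"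
  shows "coboundary K \<Delta> n f (us @ b # a # vs) = \<ominus>\<^bsub>K\<^esub> coboundary K \<Delta> n f (us @ a # b # vs)"
proof -
  interpret K: cring K by fact
  let ?k = "length us"
  let ?xs = "us @ a # b # vs" and ?ys = "us @ b # a # vs"
  let ?s = "\<lambda>j::nat. (\<ominus>\<^bsub>K\<^esub> \<one>\<^bsub>K\<^esub>) [^]\<^bsub>K\<^esub> j"
  let ?F = "\<lambda>xs j. ?s j \<otimes>\<^bsub>K\<^esub> f (del j xs)"
  \<comment> \<open>The transposition that matches the faces of the swapped list with those of the
    original one.\<close>
  define \<tau> where "\<tau> j = (if j = ?k then Suc ?k else if j = Suc ?k then ?k else j)" for j
  have ys: "?ys \<in> ordered_faces \<Delta> (Suc n)" by (rule ordered_faces_swap[OF xs])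
  have len: "Suc n = ?k + 2 + length vs" using xs by (simp add: ordered_faces_def)
  have fc: "f zs \<in> carrier K" if "zs \<in> ordered_faces \<Delta> n" for zs
    using f that by (auto simp: cochain_group_def)
  have falt: "f (us' @ y # x # vs') = \<ominus>\<^bsub>K\<^esub> f (us' @ x # y # vs')"
    if "us' @ x # y # vs' \<in> ordered_faces \<Delta> n" for us' x y vs'
    using f that by (simp add: cochain_group_def)
  have dx: "del j ?xs \<in> ordered_faces \<Delta> n" if "j \<le> n" for j
    by (rule ordered_faces_del[OF down xs that])
  have Fc: "?F ?xs j \<in> carrier K" if "j \<le> n" for j
    using fc[OF dx[OF that]] by simp
  have Fy: "?F ?ys j = \<ominus>\<^bsub>K\<^esub> ?F ?xs (\<tau> j)" if j: "j \<le> n" for j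
  proof -
    consider "j = ?k" | "j = Suc ?k" | "j < ?k" | "j > Suc ?k" by linarith
    then show ?thesis
    proof cases
      case 1
      then have "del j ?ys = us @ a # vs" "del (Suc ?k) ?xs = us @ a # vs"
        by (simp_all add: del_append)
      moreover from this have "f (us @ a # vs) \<in> carrier K"
        using fc[OF dx[of "Suc ?k"]] len by simp
      ultimately show ?thesis using 1 by (simp add: \<tau>_def K.l_minus K.r_minus)
    next
      case 2
      then have "del j ?ys = us @ b # vs" "del ?k ?xs = us @ b # vs"
        by (simp_all add: del_append)
      moreover from this have "f (us @ b # vs) \<in> carrier K"
        using fc[OF dx[of ?k]] len by simp
      ultimately show ?thesis using 2 by (simp add: \<tau>_def K.l_minus K.r_minus)
    next
      case 3
      then have "f (del j ?ys) = \<ominus>\<^bsub>K\<^esub> f (del j ?xs)"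
        using falt[of "del j us" a b vs] dx[OF j] by (simp add: del_append)
      then show ?thesis using 3 fc[OF dx[OF j]] by (simp add: \<tau>_def K.r_minus)
    next
      case 4
      then obtain l where l: "j = ?k + 2 + l" using less_imp_Suc_add by (metis add_2_eq_Suc' add_Suc_right add_Suc)
      then have "f (del j ?ys) = \<ominus>\<^bsub>K\<^esub> f (del j ?xs)"
        using falt[of us a b "del l vs"] dx[OF j] by (simp add: del_append)
      then show ?thesis using 4 fc[OF dx[OF j]] by (simp add: \<tau>_def K.r_minus)
    qed
  qed
  have inj: "inj_on \<tau> {..n}" by (auto simp: inj_on_def \<tau>_def split: if_splits)
  have img: "\<tau> ` {..n} = {..n}"
    by (rule endo_inj_surj[OF _ _ inj]) (use len in \<open>auto simp: \<tau>_def\<close>)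
  then have \<tau>n: "\<tau> j \<le> n" if "j \<le> n" for j using that by blast
  have "(\<Oplus>\<^bsub>K\<^esub>j\<in>{..n}. ?F ?ys j) = (\<Oplus>\<^bsub>K\<^esub>j\<in>{..n}. \<ominus>\<^bsub>K\<^esub> ?F ?xs (\<tau> j))"
  proof (rule K.finsum_cong')
    show "(\<lambda>j. \<ominus>\<^bsub>K\<^esub> ?F ?xs (\<tau> j)) \<in> {..n} \<rightarrow> carrier K"
      using \<tau>n Fc by (intro Pi_I K.a_inv_closed) simp
  qed (use Fy in auto)
  also have "\<dots> = \<ominus>\<^bsub>K\<^esub> (\<Oplus>\<^bsub>K\<^esub>j\<in>{..n}. ?F ?xs (\<tau> j))"
    by (rule additive_finsum[OF K.abelian_group_axioms K.abelian_group_axioms, symmetric])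
      (use \<tau>n Fc in \<open>simp_all add: K.minus_add\<close>)
  also have "(\<Oplus>\<^bsub>K\<^esub>j\<in>{..n}. ?F ?xs (\<tau> j)) = (\<Oplus>\<^bsub>K\<^esub>j\<in>\<tau> ` {..n}. ?F ?xs j)"
    by (rule K.finsum_reindex[symmetric, OF _ inj]) (use Fc \<tau>n in auto)
  finally show ?thesis
    using xs ys img by (simp add: coboundary_def del_def)
qed

text \<open>Unpacks the quotient: the coset of a cocycle \<open>z\<close> must be the subgroup of
  coboundaries, so it is enough to see that \<open>z\<close> belongs to its own coset.\<close>

lemma trivial_reduced_cohomology:
  assumes K: "cring K" and down: "\<And>s t. s \<in> \<Delta> \<Longrightarrow> t \<subseteq> s \<Longrightarrow> t \<in> \<Delta>"
    and triv: "trivial_group (reduced_cohomology K \<Delta> i)"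
    and z: "z \<in> carrier (cochain_group K \<Delta> (Suc i))"
    and dz: "\<And>xs. xs \<in> ordered_faces \<Delta> (Suc (Suc i)) \<Longrightarrow> coboundary K \<Delta> (Suc i) z xs = \<zero>\<^bsub>K\<^esub>"
  obtains y where "y \<in> carrier (cochain_group K \<Delta> i)" "z = coboundary K \<Delta> i y"
proof -
  interpret K: cring K by fact
  let ?G = "cochain_group K \<Delta> (Suc i)" and ?H = "coboundary K \<Delta> i ` carrier (cochain_group K \<Delta> i)"
  let ?k = "kernel ?G (cochain_group K \<Delta> (Suc (Suc i))) (coboundary K \<Delta> (Suc i))"
  have "coboundary K \<Delta> (Suc i) z = \<one>\<^bsub>cochain_group K \<Delta> (Suc (Suc i))\<^esub>"
    using dz by (auto simp: cochain_group_def coboundary_def fun_eq_iff)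
  then have zk: "z \<in> ?k" using z by (simp add: kernel_def)
  \<comment> \<open>The zero cochain shows that zero is a coboundary, which places \<open>z\<close>
    in its coset without establishing that the coboundaries form a subgroup.\<close>
  define o0 where "o0 = (\<lambda>xs\<in>ordered_faces \<Delta> i. \<zero>\<^bsub>K\<^esub>)"
  have o0: "o0 \<in> carrier (cochain_group K \<Delta> i)"
    using K.minus_zero_eq by (auto simp: o0_def cochain_group_def dest: ordered_faces_swap)
  have "coboundary K \<Delta> i o0 xs = \<zero>\<^bsub>K\<^esub>" if xs: "xs \<in> ordered_faces \<Delta> (Suc i)" for xs
  proof -
    have "coboundary K \<Delta> i o0 xs = (\<Oplus>\<^bsub>K\<^esub>j\<in>{..i}. \<zero>\<^bsub>K\<^esub>)"
      unfolding coboundary_def restrict_apply'[OF xs]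
      by (rule K.finsum_cong')
        (use ordered_faces_del[OF down xs] in \<open>auto simp: o0_def del_def\<close>)
    then show ?thesis by simp
  qed
  then have o1: "coboundary K \<Delta> i o0 \<otimes>\<^bsub>?G\<^esub> z = z"
    using z by (auto simp: cochain_group_def fun_eq_iff PiE_def extensional_def dest: funcset_mem)
  have "?H #>\<^bsub>?G\<lparr>carrier := ?k\<rparr>\<^esub> z \<in> carrier (reduced_cohomology K \<Delta> i)"
    using zk by (auto simp: reduced_cohomology_def FactGroup_def RCOSETS_def)
  then have "?H #>\<^bsub>?G\<lparr>carrier := ?k\<rparr>\<^esub> z = ?H"
    using triv by (simp add: trivial_group_def reduced_cohomology_def FactGroup_def)
  moreover have "z \<in> ?H #>\<^bsub>?G\<lparr>carrier := ?k\<rparr>\<^esub> z"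
    using o0 o1 by (force simp: r_coset_def)
  ultimately show ?thesis using that by blast
qed

section \<open>Sorting the vertices of a simplex\<close>

context lrb_algebra begin

text \<open>Counts the pairs whose later entry lies above the earlier one. The parity is the sign of
  the sorting permutation of a simplex, and the number itself is the measure for bubble
  sort.\<close>

fun inversions :: "'b list \<Rightarrow> nat" where
  "inversions [] = 0"
| "inversions (x # xs) = length (filter (\<lambda>y. y \<otimes> x = x) xs) + inversions xs"

text \<open>Only the swapped pair contributes differently; \<open>k\<close> collects everything
  else. For distinct comparable \<open>a\<close> and \<open>b\<close> exactly one of the two
  conditions holds, so the parity changes.\<close>

lemma inversions_swap:
  obtains k where "inversions (us @ a # b # vs) = k + (if b \<otimes> a = a then 1 else 0)"
    and "inversions (us @ b # a # vs) = k + (if a \<otimes> b = b then 1 else 0)"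
proof -
  have "\<exists>k. inversions (us @ a # b # vs) = k + (if b \<otimes> a = a then 1 else 0) \<and>
    inversions (us @ b # a # vs) = k + (if a \<otimes> b = b then 1 else 0)"
  proof (induction us)
    case Nil
    show ?case
      by (rule exI[of _ "length (filter (\<lambda>y. y \<otimes> a = a) vs) + length (filter (\<lambda>y. y \<otimes> b = b) vs) + inversions vs"]) simp
  next
    case (Cons u us)
    then obtain k where "inversions (us @ a # b # vs) = k + (if b \<otimes> a = a then 1 else 0)"
      "inversions (us @ b # a # vs) = k + (if a \<otimes> b = b then 1 else 0)" by blast
    then show ?case
      by (intro exI[of _ "length (filter (\<lambda>y. y \<otimes> u = u) (us @ a # b # vs)) + k"]) simp
  qed
  then show ?thesis using that by blast
qed

abbreviation "descending \<equiv> sorted_wrt (\<lambda>a b. a \<otimes> b = b)"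

lemma inversions_descending:
  "descending xs \<Longrightarrow> distinct xs \<Longrightarrow> set xs \<subseteq> carrier B \<Longrightarrow> inversions xs = 0"
proof (induction xs)
  case (Cons x xs)
  then have "\<not> y \<otimes> x = x" if "y \<in> set xs" for y using that order_antisym[of x y] by auto
  then show ?case using Cons by (auto simp: filter_empty_conv)
qed simp

lemma descending_unique:
  "\<lbrakk>descending xs; distinct xs; descending ys; distinct ys; set xs = set ys; set xs \<subseteq> carrier B\<rbrakk> \<Longrightarrow> xs = ys"
proof (induction xs arbitrary: ys)
  case (Cons x xs)
  then obtain y ys' where ys: "ys = y # ys'" by (cases ys) auto
  have "x = y"
  proof (rule ccontr)
    assume "x \<noteq> y"
    then have "y \<in> set xs" "x \<in> set ys'" using Cons.prems ys by auto
    then have "x \<otimes> y = y" "y \<otimes> x = x" using Cons.prems ys by auto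
    then show False using order_antisym[of x y] \<open>x \<noteq> y\<close> Cons.prems(5,6) ys by auto
  qed
  moreover have "xs = ys'"
    by (rule Cons.IH) (use Cons.prems ys \<open>x = y\<close> in auto)
  ultimately show ?case using ys by simp
qed simp

lemma not_descending_adjacent:
  assumes "set xs \<subseteq> carrier B" "\<not> descending xs"
  obtains us a b vs where "xs = us @ a # b # vs" "a \<otimes> b \<noteq> b"
proof -
  \<comment> \<open>Membership in the carrier is built into the relation so that it is transitive on
    the whole type; then a violation can be found between neighbours.\<close>
  let ?P = "\<lambda>a b. a \<in> carrier B \<and> b \<in> carrier B \<and> a \<otimes> b = b"
  have "transp ?P"
  proof (rule transpI)
    fix x y z assume xyz: "?P x y" "?P y z"
    then have "x \<otimes> z = x \<otimes> (y \<otimes> z)" by simp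
    also have "\<dots> = x \<otimes> y \<otimes> z" using xyz by (metis m_assoc)
    finally show "?P x z" using xyz by simp
  qed
  moreover have "\<not> sorted_wrt ?P xs" using assms(2) by (metis (no_types, lifting) sorted_wrt_mono_rel)
  ultimately obtain i where i: "Suc i < length xs" "\<not> ?P (xs ! i) (xs ! Suc i)"
    by (auto simp: sorted_wrt_iff_nth_Suc_transp)
  then have "xs ! i \<otimes> xs ! Suc i \<noteq> xs ! Suc i" using assms(1) by (meson Suc_lessD nth_mem subsetD)
  moreover have "xs = take i xs @ xs ! i # xs ! Suc i # drop (Suc (Suc i)) xs"
    using i by (metis Cons_nth_drop_Suc Suc_lessD append_take_drop_id)
  ultimately show ?thesis using that by blast
qed

definition subposet_complex :: "'b set \<Rightarrow> 'b set set" where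
  "subposet_complex Y = induced_subcomplex (order_complex (R_order B)) Y"

lemma subposet_complex_iff:
  assumes "Y \<subseteq> carrier B"
  shows "s \<in> subposet_complex Y \<longleftrightarrow> finite s \<and> s \<subseteq> Y \<and> (\<forall>a\<in>s. \<forall>b\<in>s. a \<otimes> b = b \<or> b \<otimes> a = a)"
  using assms by (auto simp: subposet_complex_def induced_subcomplex_def order_complex_def Chains_def R_order_def subset_iff)

lemma subposet_complex_down: "s \<in> subposet_complex Y \<Longrightarrow> t \<subseteq> s \<Longrightarrow> t \<in> subposet_complex Y"
  by (auto simp: subposet_complex_def induced_subcomplex_def order_complex_def Chains_def intro: finite_subset)

text \<open>Bubble sort as an induction rule: a property of sorted simplices that survives exchanges
  of neighbours holds for every ordering. It terminates because exchanging an ascending pair lowers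
  \<open>inversions\<close>.\<close>

lemma bubble_induct [consumes 2, case_names descending swap]:
  assumes Y: "Y \<subseteq> carrier B" and xs: "xs \<in> ordered_faces (subposet_complex Y) n"
    and sorted: "\<And>xs. xs \<in> ordered_faces (subposet_complex Y) n \<Longrightarrow> descending xs \<Longrightarrow> P xs"
    and swap: "\<And>us a b vs. us @ a # b # vs \<in> ordered_faces (subposet_complex Y) n \<Longrightarrow> P (us @ a # b # vs) \<Longrightarrow> P (us @ b # a # vs)"
  shows "P xs"
  using xs
proof (induction "inversions xs" arbitrary: xs rule: less_induct)
  case less
  have face: "set xs \<subseteq> Y" "distinct xs" "\<And>a b. a \<in> set xs \<Longrightarrow> b \<in> set xs \<Longrightarrow> a \<otimes> b = b \<or> b \<otimes> a = a"
    using less.prems by (auto simp: ordered_faces_def subposet_complex_iff[OF Y])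
  show ?case
  proof (cases "descending xs")
    case True
    then show ?thesis using sorted less.prems by blast
  next
    case False
    then obtain us a b vs where ab: "xs = us @ a # b # vs" "a \<otimes> b \<noteq> b"
      using not_descending_adjacent[of xs] face(1) Y by blast
    have ba: "b \<otimes> a = a" using face(3)[of a b] ab by auto
    obtain k where "inversions (us @ a # b # vs) = k + (if b \<otimes> a = a then 1 else 0)"
      "inversions (us @ b # a # vs) = k + (if a \<otimes> b = b then 1 else 0)" by (rule inversions_swap)
    then have "inversions (us @ b # a # vs) < inversions xs" using ab ba by simp
    moreover have sw: "us @ b # a # vs \<in> ordered_faces (subposet_complex Y) n"
      using less.prems unfolding ab(1) by (rule ordered_faces_swap)
    ultimately have "P (us @ b # a # vs)" using less.hyps by blast
    then show ?thesis using swap[OF sw] ab(1) by simp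
  qed
qed

definition sort_desc :: "'b set \<Rightarrow> 'b list" where
  "sort_desc S = (SOME t. descending t \<and> distinct t \<and> set t = S)"

lemma sort_desc_eq:
  assumes "descending t" "distinct t" "set t \<subseteq> carrier B" shows "sort_desc (set t) = t"
proof -
  have "descending (sort_desc (set t)) \<and> distinct (sort_desc (set t)) \<and> set (sort_desc (set t)) = set t"
    unfolding sort_desc_def by (rule someI[of _ t]) (use assms in simp)
  then show ?thesis using descending_unique[of "sort_desc (set t)" t] assms by simp
qed

lemma sort_desc:
  assumes Y: "Y \<subseteq> carrier B" and xs: "xs \<in> ordered_faces (subposet_complex Y) n"
  shows "descending (sort_desc (set xs))" "distinct (sort_desc (set xs))" "set (sort_desc (set xs)) = set xs"
    "length (sort_desc (set xs)) = n"
proof -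
  have "\<exists>t. descending t \<and> distinct t \<and> set t = set xs"
    using Y xs
  proof (induction rule: bubble_induct)
    case (descending xs)
    then show ?case by (auto simp: ordered_faces_def)
  next
    case (swap us a b vs)
    then show ?case by (simp add: insert_commute)
  qed
  note ex = someI_ex[OF this]
  show s: "descending (sort_desc (set xs))" "distinct (sort_desc (set xs))" "set (sort_desc (set xs)) = set xs"
    using ex by (simp_all add: sort_desc_def)
  show "length (sort_desc (set xs)) = n"
    using xs s distinct_card[of "sort_desc (set xs)"] distinct_card[of xs] by (simp add: ordered_faces_def)
qed

end

section \<open>From functions on strict chains to alternating cochains\<close>

context lrb_filter begin

definition desc_lists :: "'b set \<Rightarrow> nat \<Rightarrow> 'b list set" where
  "desc_lists Y n = {xs. length xs = n \<and> set xs \<subseteq> Y \<and> distinct xs \<and> descending xs}"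

lemma desc_lists_face:
  assumes "Y \<subseteq> carrier B" "xs \<in> desc_lists Y n" shows "xs \<in> ordered_faces (subposet_complex Y) n"
proof -
  have "a \<otimes> b = b \<or> b \<otimes> a = a" if ab: "a \<in> set xs" "b \<in> set xs" for a b
  proof (cases "a = b")
    case True
    have "a \<in> carrier B" using ab(1) assms by (auto simp: desc_lists_def)
    then have "a \<otimes> a = a" by (rule idem)
    then show ?thesis unfolding True by (rule disjI1)
  next
    case False
    obtain i where i: "i < length xs" "a = xs ! i" using ab(1) unfolding in_set_conv_nth by blast
    obtain j where j: "j < length xs" "b = xs ! j" using ab(2) unfolding in_set_conv_nth by blast
    note ij = i j
    have d: "xs ! k \<otimes> xs ! l = xs ! l" if "k < l" "l < length xs" for k l
      using assms(2) that by (simp add: desc_lists_def sorted_wrt_iff_nth_less)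
    consider "i < j" | "j < i" using False ij by fastforce
    then show ?thesis
      by cases (use d ij in simp_all)
  qed
  then show ?thesis using assms by (auto simp: ordered_faces_def subposet_complex_iff desc_lists_def)
qed

lemma del_desc_lists: "xs \<in> desc_lists Y (Suc n) \<Longrightarrow> j \<le> n \<Longrightarrow> del j xs \<in> desc_lists Y n"
  using set_del_subset[of j xs] by (auto simp: desc_lists_def length_del distinct_del sorted_wrt_del)

text \<open>An alternating cochain on an order complex is determined by its values on descending
  lists, and these may be prescribed freely. So \<open>\<gamma>\<close> extends to an alternating
  cocycle, and the values of a primitive on descending lists serve as
  \<open>\<beta>\<close>.\<close>

lemma poset_cocycle_is_coboundary:
  assumes Y: "Y \<subseteq> carrier B" and triv: "trivial_group (reduced_cohomology K (subposet_complex Y) i)"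
    and c: "\<And>t. t \<in> desc_lists Y (Suc i) \<Longrightarrow> \<gamma> t \<in> carrier K"
    and cocycle: "\<And>t. t \<in> desc_lists Y (Suc (Suc i)) \<Longrightarrow> (\<Oplus>\<^bsub>K\<^esub>j\<in>{..Suc i}. sgn j \<otimes>\<^bsub>K\<^esub> \<gamma> (del j t)) = \<zero>\<^bsub>K\<^esub>"
  obtains \<beta> where "\<And>t. t \<in> desc_lists Y i \<Longrightarrow> \<beta> t \<in> carrier K"
    and "\<And>t. t \<in> desc_lists Y (Suc i) \<Longrightarrow> \<gamma> t = (\<Oplus>\<^bsub>K\<^esub>j\<in>{..i}. sgn j \<otimes>\<^bsub>K\<^esub> \<beta> (del j t))"
proof -
  let ?D = "subposet_complex Y"
  note down = subposet_complex_down[of _ Y]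
  \<comment> \<open>The alternating extension of \<open>\<gamma>\<close>: sort the vertices and
    record the sign of the sorting.\<close>
  define z where "z = (\<lambda>xs\<in>ordered_faces ?D (Suc i). sgn (inversions xs) \<otimes>\<^bsub>K\<^esub> \<gamma> (sort_desc (set xs)))"
  have sd: "sort_desc (set xs) \<in> desc_lists Y n" if "xs \<in> ordered_faces ?D n" for xs n
    using sort_desc[OF Y that] that by (auto simp: desc_lists_def ordered_faces_def subposet_complex_iff[OF Y])
  have zt: "z t = \<gamma> t" if t: "t \<in> desc_lists Y (Suc i)" for t
  proof -
    have "descending t" "distinct t" "set t \<subseteq> carrier B" using t Y by (auto simp: desc_lists_def)
    then show ?thesis
      using desc_lists_face[OF Y t] c[OF t] by (simp add: z_def inversions_descending sort_desc_eq sgn_0)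
  qed
  have zc: "z \<in> carrier (cochain_group K ?D (Suc i))"
    unfolding cochain_group_def
  proof (simp, intro conjI allI impI)
    show "z \<in> ordered_faces ?D (Suc i) \<rightarrow>\<^sub>E carrier K" using sd c by (auto simp: z_def)
    fix us a b vs assume f: "us @ a # b # vs \<in> ordered_faces ?D (Suc i)"
    note f' = ordered_faces_swap[OF f]
    have ab: "a \<in> carrier B" "b \<in> carrier B" "a \<noteq> b" "a \<otimes> b = b \<or> b \<otimes> a = a"
      using f Y by (auto simp: ordered_faces_def subposet_complex_iff)
    \<comment> \<open>Exactly one of the two relations holds, so the inversion numbers of the two
      orderings differ by exactly one.\<close>
    then have one: "(a \<otimes> b = b) \<noteq> (b \<otimes> a = a)" using order_antisym by blast
    obtain k where "inversions (us @ a # b # vs) = k + (if b \<otimes> a = a then 1 else 0)"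
      "inversions (us @ b # a # vs) = k + (if a \<otimes> b = b then 1 else 0)" by (rule inversions_swap)
    then have "sgn (inversions (us @ b # a # vs)) = \<ominus>\<^bsub>K\<^esub> sgn (inversions (us @ a # b # vs))"
      using one by (auto simp: sgn_Suc)
    moreover have "set (us @ b # a # vs) = set (us @ a # b # vs)" by auto
    ultimately show "z (us @ b # a # vs) = \<ominus>\<^bsub>K\<^esub> z (us @ a # b # vs)"
      using f f' c[OF sd[OF f]] by (simp add: z_def K.l_minus del: set_append)
  qed
  have dz: "coboundary K ?D (Suc i) z xs = \<zero>\<^bsub>K\<^esub>" if "xs \<in> ordered_faces ?D (Suc (Suc i))" for xs
    using Y that
  proof (induction rule: bubble_induct)
    \<comment> \<open>On sorted lists every face is sorted, so this is the hypothesis on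
      \<open>\<gamma>\<close>. The remaining orderings follow from
      \<open>coboundary_swap\<close>.\<close>
    case (descending xs)
    then have xs: "xs \<in> desc_lists Y (Suc (Suc i))"
      by (auto simp: desc_lists_def ordered_faces_def subposet_complex_iff[OF Y])
    have "coboundary K ?D (Suc i) z xs = (\<Oplus>\<^bsub>K\<^esub>j\<in>{..Suc i}. sgn j \<otimes>\<^bsub>K\<^esub> \<gamma> (del j xs))"
      unfolding coboundary_def restrict_apply'[OF descending(1)]
      by (rule K.finsum_cong')
        (use del_desc_lists[OF xs] c in \<open>auto simp: zt sgn_def simp flip: del_def\<close>)
    then show ?case using cocycle[OF xs] by simp
  next
    case (swap us a b vs)
    then show ?case
      using coboundary_swap[OF K.is_cring down zc swap(1)] K.minus_zero_eq by simp
  qed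
  obtain y where y: "y \<in> carrier (cochain_group K ?D i)" "z = coboundary K ?D i y"
    by (rule trivial_reduced_cohomology[OF K.is_cring down triv zc dz])
  show ?thesis
  proof (rule that[of y])
    show "y t \<in> carrier K" if "t \<in> desc_lists Y i" for t
      using y(1) desc_lists_face[OF Y that] by (auto simp: cochain_group_def)
    show "\<gamma> t = (\<Oplus>\<^bsub>K\<^esub>j\<in>{..i}. sgn j \<otimes>\<^bsub>K\<^esub> y (del j t))" if t: "t \<in> desc_lists Y (Suc i)" for t
      using zt[OF t] y(2) desc_lists_face[OF Y t] by (simp add: coboundary_def sgn_def del_def)
  qed
qed

end


section \<open>Simple modules are characters\<close>

text \<open>Closure under negatives comes for free, as negation is the action of the scalar
  -1.\<close>

lemma (in left_module) submodule_of_closed: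
  assumes "H \<subseteq> carrier M" "\<zero>\<^bsub>M\<^esub> \<in> H"
    and add: "\<And>x y. x \<in> H \<Longrightarrow> y \<in> H \<Longrightarrow> x \<oplus>\<^bsub>M\<^esub> y \<in> H"
    and sm: "\<And>a x. a \<in> carrier R \<Longrightarrow> x \<in> H \<Longrightarrow> a \<odot>\<^bsub>M\<^esub> x \<in> H"
  shows "submodule H R M"
proof (intro submodule.intro subgroup.intro submodule_axioms.intro sm)
  fix x assume x: "x \<in> H"
  then have xM: "x \<in> carrier M" using assms(1) by blast
  have "\<ominus>\<^bsub>M\<^esub> x = (\<ominus>\<^bsub>R\<^esub> \<one>\<^bsub>R\<^esub>) \<odot>\<^bsub>M\<^esub> x" using smult_l_minus[of "\<one>\<^bsub>R\<^esub>" x] xM by (simp add: smult_one)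
  then have "\<ominus>\<^bsub>M\<^esub> x \<in> H" using sm[OF _ x] by simp
  then show "inv\<^bsub>add_monoid M\<^esub> x \<in> H" by (simp add: a_inv_def)
qed (use assms in auto)

context lrb_module begin

text \<open>\<open>b c (b x - x) = 0\<close> because \<open>b c b = b c\<close>, so \<open>b x - x\<close> lies in the largest submodule killed
  by \<open>b\<close>.\<close>

lemma simple_dl:
  assumes simple: "simple_module A M" and b: "b \<in> carrier B"
  shows "(\<forall>x\<in>carrier M. dl b \<odot>\<^bsub>M\<^esub> x = x) \<or> (\<forall>x\<in>carrier M. dl b \<odot>\<^bsub>M\<^esub> x = \<zero>\<^bsub>M\<^esub>)"
proof -
  let ?H = "{x \<in> carrier M. \<forall>r\<in>carrier A. dl b \<odot>\<^bsub>M\<^esub> (r \<odot>\<^bsub>M\<^esub> x) = \<zero>\<^bsub>M\<^esub>}"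
  have bA: "dl b \<in> carrier A" by (simp add: sing_A)
  have "submodule ?H A M"
  proof (rule M.submodule_of_closed)
    fix a x assume a: "a \<in> carrier A" and x: "x \<in> ?H"
    have "dl b \<odot>\<^bsub>M\<^esub> (r \<odot>\<^bsub>M\<^esub> (a \<odot>\<^bsub>M\<^esub> x)) = \<zero>\<^bsub>M\<^esub>" if "r \<in> carrier A" for r
    proof -
      have "dl b \<odot>\<^bsub>M\<^esub> ((r \<otimes>\<^bsub>A\<^esub> a) \<odot>\<^bsub>M\<^esub> x) = \<zero>\<^bsub>M\<^esub>" using x M.R.m_closed[OF that a] by blast
      then show ?thesis using M.smult_assoc[OF that a, of x] x by simp
    qed
    then show "a \<odot>\<^bsub>M\<^esub> x \<in> ?H" using a x M.smult_closed by simp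
  qed (use bA in \<open>auto simp: M.smult_r_distr M.smult_r_null M.smult_closed\<close>)
  then have "?H = {\<zero>\<^bsub>M\<^esub>} \<or> ?H = carrier M" using simple by (auto simp: simple_module_def)
  then show ?thesis
  proof
    assume H: "?H = carrier M"
    have "dl b \<odot>\<^bsub>M\<^esub> x = \<zero>\<^bsub>M\<^esub>" if x: "x \<in> carrier M" for x
    proof -
      have "x \<in> ?H" using x H by blast
      then have "dl b \<odot>\<^bsub>M\<^esub> (\<one>\<^bsub>A\<^esub> \<odot>\<^bsub>M\<^esub> x) = \<zero>\<^bsub>M\<^esub>" using M.R.one_closed by blast
      then show ?thesis using x by (simp add: M.smult_one)
    qed
    then show ?thesis by blast
  next
    assume H: "?H = {\<zero>\<^bsub>M\<^esub>}"
    have "dl b \<odot>\<^bsub>M\<^esub> x = x" if x: "x \<in> carrier M" for x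
    proof -
      let ?t = "dl b \<odot>\<^bsub>M\<^esub> x \<oplus>\<^bsub>M\<^esub> \<ominus>\<^bsub>M\<^esub> x"
      have t: "?t \<in> carrier M" using x by (simp add: dl_closed)
      have "dl b \<odot>\<^bsub>M\<^esub> (r \<odot>\<^bsub>M\<^esub> ?t) = \<zero>\<^bsub>M\<^esub>" if "r \<in> carrier A" for r
        using that
      proof (induction r rule: A_induct)
        case zero
        then show ?case using t bA by (simp add: M.smult_l_null M.smult_r_null)
      next
        case (add r q)
        then show ?case using t bA by (simp add: M.smult_l_distr M.smult_r_distr M.smult_closed)
      next
        case (sing k c)
        have "dl (b \<otimes> c) \<odot>\<^bsub>M\<^esub> ?t = \<zero>\<^bsub>M\<^esub>"
          using x b sing dl_closed[OF x]
          by (simp add: M.smult_r_distr M.smult_r_minus sing_A dl_dl left_regular M.M.r_neg)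
        then have "dl b \<odot>\<^bsub>M\<^esub> (dl c \<odot>\<^bsub>M\<^esub> ?t) = \<zero>\<^bsub>M\<^esub>" using dl_dl[OF b sing(2) t] by (simp only:)
        then show ?case
          unfolding sing_smult[OF sing t] dl_sc[OF sing(1) b dl_closed[OF t]]
          using sing(1) by (simp add: M.smult_r_null sing_A)
      qed
      then have "?t \<in> ?H" using t by blast
      then have "?t = \<zero>\<^bsub>M\<^esub>" using H by blast
      then show ?thesis using x dl_closed[OF x, of b] by (metis M.M.a_inv_closed M.M.minus_equality M.M.minus_minus)
    qed
    then show ?thesis by blast
  qed
qed

text \<open>Scalars preserve the line through any \<open>v\<close>, and so does the band, whose
  elements act as 0 or 1; for nonzero \<open>v\<close> simplicity makes this line everything. That
  the elements acting as 1 satisfy \<open>Q_mult\<close> is read off from the action of a product on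
  \<open>v\<close>.\<close>

lemma simple_character:
  assumes simple: "simple_module A M"
  obtains Q v where "lrb_character B K Q M v"
proof -
  have "carrier M \<noteq> {\<zero>\<^bsub>M\<^esub>}" using simple by (simp add: simple_module_def)
  then obtain v where v: "v \<in> carrier M" "v \<noteq> \<zero>\<^bsub>M\<^esub>" using M.M.zero_closed by blast
  define Q where "Q = {b \<in> carrier B. \<forall>x\<in>carrier M. dl b \<odot>\<^bsub>M\<^esub> x = x}"
  have notQ: "dl b \<odot>\<^bsub>M\<^esub> x = \<zero>\<^bsub>M\<^esub>" if "b \<in> carrier B" "b \<notin> Q" "x \<in> carrier M" for b x
    using simple_dl[OF simple that(1)] that by (auto simp: Q_def)
  let ?H = "(\<lambda>k. sc k \<odot>\<^bsub>M\<^esub> v) ` carrier K"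
  have "submodule ?H A M"
  proof (rule M.submodule_of_closed)
    show "?H \<subseteq> carrier M" using v by (auto intro: sc_closed)
    show "\<zero>\<^bsub>M\<^esub> \<in> ?H" using sc_zero[OF v(1)] by (metis K.zero_closed imageI)
    show add: "x \<oplus>\<^bsub>M\<^esub> y \<in> ?H" if "x \<in> ?H" "y \<in> ?H" for x y
      using that v by (auto simp: sc_add[symmetric])
    fix a x assume "a \<in> carrier A" and x: "x \<in> ?H"
    then obtain l where l: "l \<in> carrier K" "x = sc l \<odot>\<^bsub>M\<^esub> v" by blast
    have xM: "x \<in> carrier M" using l v by (simp add: sc_closed)
    from \<open>a \<in> carrier A\<close> show "a \<odot>\<^bsub>M\<^esub> x \<in> ?H"
    proof (induction a rule: A_induct)
      case zero
      then show ?case using xM \<open>\<zero>\<^bsub>M\<^esub> \<in> ?H\<close> by (simp add: M.smult_l_null)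
    next
      case (add a c)
      then show ?case using xM \<open>\<And>x y. x \<in> ?H \<Longrightarrow> y \<in> ?H \<Longrightarrow> x \<oplus>\<^bsub>M\<^esub> y \<in> ?H\<close>
        unfolding M.smult_l_distr[OF add(1,2) xM] by blast
    next
      case (sing k b)
      have "dl b \<odot>\<^bsub>M\<^esub> x = x \<or> dl b \<odot>\<^bsub>M\<^esub> x = \<zero>\<^bsub>M\<^esub>" using simple_dl[OF simple sing(2)] xM by blast
      then show ?case
      proof
        assume "dl b \<odot>\<^bsub>M\<^esub> x = x"
        then have "sing K (carrier B) k b \<odot>\<^bsub>M\<^esub> x = sc (k \<otimes>\<^bsub>K\<^esub> l) \<odot>\<^bsub>M\<^esub> v"
          unfolding sing_smult[OF sing xM] using l sing(1) v by (simp add: sc_sc)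
        then show ?thesis using l sing by simp
      next
        assume "dl b \<odot>\<^bsub>M\<^esub> x = \<zero>\<^bsub>M\<^esub>"
        then have "sing K (carrier B) k b \<odot>\<^bsub>M\<^esub> x = \<zero>\<^bsub>M\<^esub>"
          unfolding sing_smult[OF sing xM] using sing by (simp add: M.smult_r_null sing_A)
        then show ?thesis using \<open>\<zero>\<^bsub>M\<^esub> \<in> ?H\<close> by simp
      qed
    qed
  qed
  moreover have "v \<in> ?H"
    using dl_one[OF v(1)] by (metis K.one_closed imageI)
  ultimately have line: "carrier M = ?H" using simple v(2) unfolding simple_module_def by blast
  have "lrb_character B K Q M v"
  proof unfold_locales
    show "Q \<subseteq> carrier B" "\<one> \<in> Q" by (auto simp: Q_def dl_one)
    fix a b assume ab: "a \<in> carrier B" "b \<in> carrier B"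
    have abx: "dl (a \<otimes> b) \<odot>\<^bsub>M\<^esub> x = dl a \<odot>\<^bsub>M\<^esub> (dl b \<odot>\<^bsub>M\<^esub> x)" if "x \<in> carrier M" for x
      using dl_dl[OF ab that] ..
    show "a \<otimes> b \<in> Q \<longleftrightarrow> a \<in> Q \<and> b \<in> Q"
    proof
      assume "a \<otimes> b \<in> Q"
      then have e: "dl a \<odot>\<^bsub>M\<^esub> (dl b \<odot>\<^bsub>M\<^esub> v) = v" using abx[OF v(1)] v by (simp add: Q_def)
      have "a \<in> Q" using e notQ[OF ab(1) _ dl_closed[OF v(1)]] v(2) by metis
      moreover have "b \<in> Q"
      proof (rule ccontr)
        assume "b \<notin> Q"
        then have "dl a \<odot>\<^bsub>M\<^esub> \<zero>\<^bsub>M\<^esub> = v" using e notQ[OF ab(2) _ v(1)] by simp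
        then show False using v(2) by (simp add: M.smult_r_null sing_A)
      qed
      ultimately show "a \<in> Q \<and> b \<in> Q" by blast
    next
      assume "a \<in> Q \<and> b \<in> Q"
      then show "a \<otimes> b \<in> Q" using abx ab by (simp add: Q_def)
    qed
  next
    show "dl b \<odot>\<^bsub>M\<^esub> v = (if b \<in> Q then v else \<zero>\<^bsub>M\<^esub>)" if "b \<in> carrier B" for b
      using notQ[OF that _ v(1)] v(1) by (auto simp: Q_def)
  qed (use v line in auto)
  then show ?thesis using that by blast
qed

end

section \<open>Cohomology of the chain complex with simple coefficients\<close>

context lrb_character begin

lemma dl_M:
  assumes "b \<in> carrier B" "x \<in> carrier M" shows "dl b \<odot>\<^bsub>M\<^esub> x = (if b \<in> Q then x else \<zero>\<^bsub>M\<^esub>)"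
proof -
  obtain k where "k \<in> carrier K" "x = sc k \<odot>\<^bsub>M\<^esub> v" using assms(2) M_line by blast
  then show ?thesis using assms(1) dl_v[OF assms(1)] v_closed by (simp add: M.dl_sc M.M.smult_r_null sing_A)
qed

text \<open>Take \<open>e\<close> in \<open>Q\<close> with the largest \<open>above\<close>. For
  \<open>c\<close> in \<open>Q\<close> the product \<open>c e\<close> is again in \<open>Q\<close>,
  and by \<open>card_above_strict\<close> it would beat \<open>e\<close> unless \<open>c\<close> is
  above \<open>e\<close>.\<close>

lemma Q_eq_above:
  obtains e where "e \<in> carrier B" "above e = Q"
proof -
  have "\<exists>e. e \<in> Q \<and> (\<forall>c. c \<in> Q \<longrightarrow> card (above c) \<le> card (above e))"
    using ex_has_greatest_nat[of "\<lambda>e. e \<in> Q" \<one> "\<lambda>e. card (above e)" "Suc (card (carrier B))"]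
      Q_one card_above_le by (auto simp: less_Suc_eq_le)
  then obtain e where e: "e \<in> Q" and m: "\<And>c. c \<in> Q \<Longrightarrow> card (above c) \<le> card (above e)" by blast
  have eB: "e \<in> carrier B" using e Q_subset by blast
  have "above e = Q"
  proof
    show "above e \<subseteq> Q"
    proof
      fix c assume "c \<in> above e"
      then have "c \<in> carrier B" "e \<otimes> c = e" by (auto simp: above_def)
      then show "c \<in> Q" using Q_mult[OF eB, of c] e by simp
    qed
    show "Q \<subseteq> above e"
    proof
      fix c assume c: "c \<in> Q"
      then have cB: "c \<in> carrier B" using Q_subset by blast
      have "c \<otimes> e \<in> Q" using Q_mult[OF cB eB] c e by simp
      then show "c \<in> above e" using m card_above_strict[OF eB cB] by (meson not_le)
    qed
  qed
  then show ?thesis using that eB by blast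
qed

lemma finsum_sc_v:
  assumes "\<And>i. i \<in> S \<Longrightarrow> f i \<in> carrier K"
  shows "(\<Oplus>\<^bsub>M\<^esub>i\<in>S. sc (f i) \<odot>\<^bsub>M\<^esub> v) = sc (finsum K f S) \<odot>\<^bsub>M\<^esub> v"
  by (rule additive_finsum[OF K.abelian_group_axioms M.M.M.abelian_group_axioms, symmetric])
    (use assms v_closed in \<open>auto simp: M.sc_closed M.sc_add\<close>)

end

section \<open>Homomorphisms from chains into a character\<close>

context lrb_filter begin

interpretation ch: bset B K "wchains n" "chains n" act for n by (rule chains_bset)

lemma act_top: "s \<in> wchains n \<Longrightarrow> e \<in> carrier B \<Longrightarrow> hd s \<in> above e \<Longrightarrow>
    act e s = e # tl (act e s)"
  using wchainsD(4)[of s n] hd_act[of s n e] by (cases s) (auto simp: above_def act_def)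

lemma act_e_top: "e # u \<in> wchains n \<Longrightarrow> act e (e # u) = e # u"
  using act_hd[of "e # u" n] by simp

text \<open>A chain is fixed by its head, and a head outside \<open>G\<close> acts as zero on
  \<open>N\<close>.\<close>

lemma character_hom_vanish:
  assumes N: "lrb_character B K G N w" and f: "f \<in> mod_hom A (C n) N"
    and s: "s \<in> wchains n" "hd s \<notin> G" and k: "k \<in> carrier K"
  shows "f (sing K (chains n) k s) = \<zero>\<^bsub>N\<^esub>"
proof -
  interpret N: lrb_character B K G N w by fact
  have "sing K (chains n) k s = dl (hd s) \<odot>\<^bsub>C n\<^esub> sing K (chains n) k s"
    using s k act_hd[OF s(1)] wchainsD(3)[OF s(1)] by (simp add: ch.dl_sing)
  then have "f (sing K (chains n) k s) = dl (hd s) \<odot>\<^bsub>N\<^esub> f (sing K (chains n) k s)"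
    using mod_homD(3)[OF f, of "dl (hd s)" "sing K (chains n) k s"] k by (simp add: sing_A ch.sing_F)
  also have "\<dots> = \<zero>\<^bsub>N\<^esub>"
    using N.dl_M[OF wchainsD(3)[OF s(1)] mod_homD(1)[OF f ch.sing_F[OF k]]] s by simp
  finally show ?thesis .
qed

text \<open>Since \<open>e\<close> acts as the identity on \<open>N\<close>, a chain
  \<open>s\<close> with head in \<open>G\<close> has the same image as \<open>act e s\<close>, and
  this list starts with \<open>e\<close> because \<open>e \<otimes> hd s = e\<close>. The other
  chains are covered by \<open>character_hom_vanish\<close>.\<close>

lemma character_hom_eqI:
  assumes N: "lrb_character B K G N w" and f: "f \<in> mod_hom A (C n) N" and g: "g \<in> mod_hom A (C n) N"
    and e: "e \<in> carrier B" "above e = G"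
    and eq: "\<And>t. e # t \<in> chains n \<Longrightarrow> f (cell n (e # t)) = g (cell n (e # t))"
    and x: "x \<in> carrier (C n)"
  shows "f x = g x"
proof -
  interpret N: lrb_character B K G N w by fact
  have "f (cell n s) = g (cell n s)" if "s \<in> chains n" for s
  proof (cases "hd s \<in> G")
    case False
    then show ?thesis using character_hom_vanish[OF N f] character_hom_vanish[OF N g] that by (simp add: chains_def)
  next
    case True
    have s: "s \<in> wchains n" using that by (simp add: chains_def)
    have eG: "e \<in> G" using above_refl[OF e(1)] e(2) by simp
    have red: "h (cell n s) = h (cell n (act e s))"
      if h: "h \<in> mod_hom A (C n) N" for h
    proof -
      have "h (cell n (act e s)) = dl e \<odot>\<^bsub>N\<^esub> h (cell n s)"
        using mod_homD(3)[OF h, of "dl e" "cell n s"] s e by (simp add: sing_A ch.sing_F ch.dl_sing)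
      also have "\<dots> = h (cell n s)"
        using N.dl_M[OF e(1) mod_homD(1)[OF h ch.sing_F]] eG by simp
      finally show ?thesis ..
    qed
    have "act e s = e # tl (act e s)" using act_top[OF s e(1)] True e(2) by simp
    then have "f (cell n (act e s)) = g (cell n (act e s))"
      using eq[of "tl (act e s)"] mod_hom_zero[OF f C_module N.M_module] mod_hom_zero[OF g C_module N.M_module]
      by (cases "act e s \<in> chains n") (simp_all add: ch.sing_outside_F)
    then show ?thesis using red[OF f] red[OF g] by simp
  qed
  from ch.span_hom_eqI[OF f g N.M_module this x] show ?thesis .
qed

lemma hom_bd_sum:
  assumes N: "left_module A N" and g: "g \<in> mod_hom A (C n) N" and s: "s \<in> wchains (Suc n)"
  shows "g (bd_sum n \<one>\<^bsub>K\<^esub> s) = (\<Oplus>\<^bsub>N\<^esub>i\<in>{..Suc n}. sc (sgn i) \<odot>\<^bsub>N\<^esub> g (cell n (del i s)))"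
proof -
  interpret N: lrb_module B K N using N lrb_algebra_axioms by (simp add: lrb_module_def)
  have "g (bd_sum n \<one>\<^bsub>K\<^esub> s) = (\<Oplus>\<^bsub>N\<^esub>i\<in>{..Suc n}. g (sing K (chains n) (\<one>\<^bsub>K\<^esub> \<otimes>\<^bsub>K\<^esub> sgn i) (del i s)))"
    unfolding bd_sum_def by (rule mod_hom_finsum[OF g C_module N]) (simp add: ch.sing_F)
  also have "\<dots> = (\<Oplus>\<^bsub>N\<^esub>i\<in>{..Suc n}. sc (sgn i) \<odot>\<^bsub>N\<^esub> g (cell n (del i s)))"
  proof (rule N.M.M.finsum_cong')
    show "(\<lambda>i. sc (sgn i) \<odot>\<^bsub>N\<^esub> g (cell n (del i s))) \<in> {..Suc n} \<rightarrow> carrier N"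
      by (auto intro!: N.sc_closed mod_homD(1)[OF g] ch.sing_F)
    fix i assume "i \<in> {..Suc n}"
    then have "sing K (chains n) (\<one>\<^bsub>K\<^esub> \<otimes>\<^bsub>K\<^esub> sgn i) (del i s) = sc (sgn i) \<odot>\<^bsub>C n\<^esub> cell n (del i s)"
      using del_wchains[OF s] by (simp add: ch.sc_sing)
    then show "g (sing K (chains n) (\<one>\<^bsub>K\<^esub> \<otimes>\<^bsub>K\<^esub> sgn i) (del i s)) = sc (sgn i) \<odot>\<^bsub>N\<^esub> g (cell n (del i s))"
      using mod_homD(3)[OF g] by (simp add: sing_A ch.sing_F)
  qed simp
  finally show ?thesis .
qed

definition below :: "'b \<Rightarrow> 'b set" where
  "below e = {b \<in> Q. e \<otimes> b = b \<and> b \<noteq> e}"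

lemma below_subset: "below e \<subseteq> carrier B"
  using Q_subset by (auto simp: below_def)

lemma Cons_chains_iff:
  assumes "e \<in> Q" shows "e # t \<in> chains n \<longleftrightarrow> t \<in> desc_lists (below e) n"
  using assms Q_subset by (auto simp: chains_def wchains_def desc_lists_def below_def)

text \<open>If \<open>e b = b\<close> and \<open>e b = e\<close>, then \<open>b = e\<close>. So
  chains strictly below \<open>e\<close> have their head outside the filter of the second character
  and are killed by homomorphisms into it.\<close>

lemma hd_desc_lists:
  assumes "t \<in> desc_lists (below e) (Suc n)" "e \<in> carrier B" shows "t \<in> wchains n" "hd t \<notin> above e"
proof -
  show "t \<in> wchains n" using assms(1) below_subset by (auto simp: desc_lists_def wchains_def)
  have "hd t \<in> below e" using assms(1) by (cases t) (auto simp: desc_lists_def)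
  then show "hd t \<notin> above e" by (auto simp: below_def above_def)
qed

text \<open>A homomorphism into the character is determined by its values on the chains \<open>e # t\<close>, and there
  the boundary of the top element contributes nothing, leaving the coboundary of the poset below \<open>e\<close>.\<close>

lemma cocycle_extends:
  assumes N: "lrb_character B K G N w" and f: "f \<in> mod_hom A (C (Suc j)) N"
    and fd: "\<And>x. x \<in> carrier (C (Suc (Suc j))) \<Longrightarrow> f (bd (Suc j) x) = \<zero>\<^bsub>N\<^esub>"
    and triv: "\<And>Y. Y \<subseteq> carrier B \<Longrightarrow> trivial_group (reduced_cohomology K (subposet_complex Y) j)"
  shows "\<exists>g\<in>mod_hom A (C j) N. \<forall>x\<in>carrier (C (Suc j)). f x = g (bd j x)"
proof -
  interpret N: lrb_character B K G N w by fact
  note NM = N.M_module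
  obtain e where e: "e \<in> carrier B" "above e = G" by (rule N.Q_eq_above)
  have eG: "e \<in> G" using above_refl[OF e(1)] e(2) by simp
  show ?thesis
  proof (cases "e \<in> Q")
    \<comment> \<open>No chain of \<open>Q\<close> can start with \<open>e\<close>, so the whole Hom
      complex is zero.\<close>
    case False
    have z: "(\<lambda>x. \<zero>\<^bsub>N\<^esub>) \<in> mod_hom A (C n) N" for n
      by (rule mod_homI) (simp_all add: N.M.M.smult_r_null)
    have "f x = \<zero>\<^bsub>N\<^esub>" if "x \<in> carrier (C (Suc j))" for x
      by (rule character_hom_eqI[OF N f z e _ that]) (use False in \<open>auto simp: chains_def\<close>)
    with z show ?thesis by (intro bexI[of _ "\<lambda>x. \<zero>\<^bsub>N\<^esub>"]) auto
  next
    case eQ: True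
    have "\<forall>s. \<exists>k. k \<in> carrier K \<and> f (cell (Suc j) s) = sc k \<odot>\<^bsub>N\<^esub> w"
    proof
      fix s
      have "f (cell (Suc j) s) \<in> carrier N"
        by (rule mod_homD(1)[OF f ch.sing_F]) simp
      then show "\<exists>k. k \<in> carrier K \<and> f (cell (Suc j) s) = sc k \<odot>\<^bsub>N\<^esub> w"
        unfolding N.M_line by blast
    qed
    then obtain \<phi> where \<phi>: "\<And>s. \<phi> s \<in> carrier K" "\<And>s. f (cell (Suc j) s) = sc (\<phi> s) \<odot>\<^bsub>N\<^esub> w"
      by metis
    let ?Y = "below e"
    have cocycle: "(\<Oplus>\<^bsub>K\<^esub>i\<in>{..Suc j}. sgn i \<otimes>\<^bsub>K\<^esub> \<phi> (e # del i t)) = \<zero>\<^bsub>K\<^esub>"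
      if t: "t \<in> desc_lists ?Y (Suc (Suc j))" for t
    proof -
      have et: "e # t \<in> chains (Suc (Suc j))" using t by (simp add: Cons_chains_iff eQ)
      then have etw: "e # t \<in> wchains (Suc (Suc j))" "set (e # t) \<subseteq> Q" by (simp_all add: chains_def)
      \<comment> \<open>The face that omits \<open>e\<close> has its head outside
        \<open>G\<close>.\<close>
      have "\<phi> t = \<zero>\<^bsub>K\<^esub>"
        using N.sc_v_zero[OF \<phi>(1)] character_hom_vanish[OF N f hd_desc_lists(1)[OF t e(1)], of "\<one>\<^bsub>K\<^esub>"]
          hd_desc_lists(2)[OF t e(1)] e(2) \<phi>(2) by simp
      have "\<zero>\<^bsub>N\<^esub> = f (bd (Suc j) (cell (Suc (Suc j)) (e # t)))"
        using fd[OF ch.sing_F] by simp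
      also have "\<dots> = f (bd_sum (Suc j) \<one>\<^bsub>K\<^esub> (e # t))" using bd_sing etw by simp
      also have "\<dots> = (\<Oplus>\<^bsub>N\<^esub>i\<in>{..Suc (Suc j)}. sc (sgn i \<otimes>\<^bsub>K\<^esub> \<phi> (del i (e # t))) \<odot>\<^bsub>N\<^esub> w)"
        unfolding hom_bd_sum[OF NM f etw(1)] \<phi>(2)
        by (rule N.M.M.M.finsum_cong') (use \<phi>(1) N.v_closed in \<open>auto simp: N.M.sc_sc intro!: N.M.sc_closed\<close>)
      also have "\<dots> = sc (\<Oplus>\<^bsub>K\<^esub>i\<in>{..Suc (Suc j)}. sgn i \<otimes>\<^bsub>K\<^esub> \<phi> (del i (e # t))) \<odot>\<^bsub>N\<^esub> w"
        by (rule N.finsum_sc_v) (simp add: \<phi>(1))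
      finally have "(\<Oplus>\<^bsub>K\<^esub>i\<in>{..Suc (Suc j)}. sgn i \<otimes>\<^bsub>K\<^esub> \<phi> (del i (e # t))) = \<zero>\<^bsub>K\<^esub>"
        using N.sc_v_zero K.finsum_closed \<phi>(1) by (simp add: Pi_def)
      \<comment> \<open>Face \<open>Suc i\<close> of \<open>e # t\<close> is \<open>e\<close>
        followed by face \<open>i\<close> of \<open>t\<close>. The index shift turns every sign
        around, which is harmless for a sum equal to zero.\<close>
      then have "(\<Oplus>\<^bsub>K\<^esub>i\<in>{..Suc j}. \<ominus>\<^bsub>K\<^esub> (sgn i \<otimes>\<^bsub>K\<^esub> \<phi> (e # del i t))) = \<zero>\<^bsub>K\<^esub>"
        by (subst (asm) K.finsum_Suc2) (simp_all add: \<phi>(1) \<open>\<phi> t = \<zero>\<^bsub>K\<^esub>\<close> sgn_Suc K.l_minus Pi_def)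
      moreover have "(\<Oplus>\<^bsub>K\<^esub>i\<in>{..Suc j}. \<ominus>\<^bsub>K\<^esub> (sgn i \<otimes>\<^bsub>K\<^esub> \<phi> (e # del i t))) = \<ominus>\<^bsub>K\<^esub> (\<Oplus>\<^bsub>K\<^esub>i\<in>{..Suc j}. sgn i \<otimes>\<^bsub>K\<^esub> \<phi> (e # del i t))"
        by (rule additive_finsum[OF K.abelian_group_axioms K.abelian_group_axioms, symmetric])
          (simp_all add: \<phi>(1) K.minus_add)
      moreover have "(\<Oplus>\<^bsub>K\<^esub>i\<in>{..Suc j}. sgn i \<otimes>\<^bsub>K\<^esub> \<phi> (e # del i t)) \<in> carrier K"
        by (rule K.finsum_closed) (simp add: \<phi>(1))
      ultimately show ?thesis using K.minus_zero_eq by (metis K.minus_minus)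
    qed
    \<comment> \<open>The chains \<open>e # t\<close> in \<open>C (Suc j)\<close> have
      \<open>Suc j\<close> entries below \<open>e\<close>, hence dimension \<open>j\<close>: this is
      why degree \<open>Suc j\<close> of Ext meets cohomology in degree \<open>j\<close>. For
      \<open>j = 0\<close>, \<open>\<beta>\<close> lives on the empty list, the augmentation
      term.\<close>
    obtain \<beta> where \<beta>: "\<And>t. t \<in> desc_lists ?Y j \<Longrightarrow> \<beta> t \<in> carrier K"
      "\<And>t. t \<in> desc_lists ?Y (Suc j) \<Longrightarrow> \<phi> (e # t) = (\<Oplus>\<^bsub>K\<^esub>i\<in>{..j}. sgn i \<otimes>\<^bsub>K\<^esub> \<beta> (del i t))"
      by (rule poset_cocycle_is_coboundary[OF below_subset triv[OF below_subset], where \<gamma>="\<lambda>t. \<phi> (e # t)"])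
        (use \<phi>(1) cocycle in auto)
    \<comment> \<open>The minus sign makes up for the reversed signs of the faces of
      \<open>e # t\<close>. A chain with head in \<open>G\<close> is first moved to head
      \<open>e\<close>; if it leaves the proper chains on the way, the value must be zero.\<close>
    define \<psi> where "\<psi> s = (if s \<in> chains j \<and> hd s \<in> G \<and> act e s \<in> chains j
      then sc (\<ominus>\<^bsub>K\<^esub> \<beta> (tl (act e s))) \<odot>\<^bsub>N\<^esub> w else \<zero>\<^bsub>N\<^esub>)" for s
    have \<psi>c: "\<psi> s \<in> carrier N" for s
    proof (cases "s \<in> chains j \<and> hd s \<in> G \<and> act e s \<in> chains j")
      case True
      then have "act e s = e # tl (act e s)" using act_top[of s j e] e by (simp add: chains_def)
      then have "tl (act e s) \<in> desc_lists ?Y j" using True Cons_chains_iff[OF eQ, of "tl (act e s)" j] by simp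
      then show ?thesis using True \<beta>(1) N.v_closed by (simp add: \<psi>_def N.M.sc_closed)
    next
      case False
      then show ?thesis unfolding \<psi>_def if_not_P[OF False] by simp
    qed
    have \<psi>e: "bset.equivariant B K (chains j) act N \<psi>"
      unfolding ch.equivariant_def
    proof (intro conjI allI impI ballI \<psi>c)
      show "\<psi> s = \<zero>\<^bsub>N\<^esub>" if "s \<notin> chains j" for s using that by (simp add: \<psi>_def)
      fix c s assume c: "c \<in> carrier B" and s: "s \<in> chains j"
      have sw: "s \<in> wchains j" using s by (simp add: chains_def)
      have hB: "hd s \<in> carrier B" by (rule wchainsD(3)[OF sw])
      have hd: "hd (act c s) \<in> G \<longleftrightarrow> c \<in> G \<and> hd s \<in> G"
        unfolding hd_act[OF sw] by (rule N.Q_mult[OF c hB])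
      show "dl c \<odot>\<^bsub>N\<^esub> \<psi> s = \<psi> (act c s)"
      proof (cases "c \<in> G")
        case False
        then have "\<psi> (act c s) = \<zero>\<^bsub>N\<^esub>" using hd by (simp add: \<psi>_def)
        then show ?thesis using N.dl_M[OF c \<psi>c] False by simp
      next
        case True
        \<comment> \<open>Elements of \<open>G\<close> are absorbed by \<open>e\<close> on the
          right, so \<open>\<psi>\<close> cannot tell \<open>act c s\<close> from
          \<open>s\<close>.\<close>
        then have "e \<otimes> c = e" using e(2) by (auto simp: above_def)
        then have ec: "act e (act c s) = act e s" using act_mult[OF e(1) c sw] by simp
        have "act c s \<in> chains j" if "act e s \<in> chains j"
          using ch.act_T[OF e(1) act_closed[OF c sw]] ec that by simp
        then have "\<psi> (act c s) = \<psi> s" using s hd True ec by (auto simp: \<psi>_def)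
        then show ?thesis using N.dl_M[OF c \<psi>c] True by simp
      qed
    qed
    let ?g = "bset.span_hom B K (chains j) N \<psi>"
    have g: "?g \<in> mod_hom A (C j) N" by (rule ch.span_hom[OF NM \<psi>e])
    have gs: "?g (cell j s) = \<psi> s" if "s \<in> wchains j" for s
      using ch.span_hom_sing[OF NM \<psi>e K.one_closed that] N.M.dl_one[OF \<psi>c] by simp
    have key: "f (cell (Suc j) (e # t)) = ?g (bd j (cell (Suc j) (e # t)))"
      if et: "e # t \<in> chains (Suc j)" for t
    proof -
      have t: "t \<in> desc_lists ?Y (Suc j)" using et by (simp add: Cons_chains_iff eQ)
      have etw: "e # t \<in> wchains (Suc j)" "set (e # t) \<subseteq> Q" using et by (simp_all add: chains_def)
      have \<psi>t: "\<psi> t = \<zero>\<^bsub>N\<^esub>" using hd_desc_lists(2)[OF t e(1)] e(2) by (simp add: \<psi>_def)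
      have dt: "del i t \<in> desc_lists ?Y j" if "i \<le> j" for i using del_desc_lists[OF t that] .
      have \<psi>i: "\<psi> (e # del i t) = sc (\<ominus>\<^bsub>K\<^esub> \<beta> (del i t)) \<odot>\<^bsub>N\<^esub> w" if i: "i \<le> j" for i
      proof -
        have c: "e # del i t \<in> chains j" using dt[OF i] by (simp add: Cons_chains_iff eQ)
        then have "act e (e # del i t) = e # del i t" using act_e_top[of e _ j] by (simp add: chains_def)
        then show ?thesis using c eG by (simp add: \<psi>_def)
      qed
      have "?g (bd j (cell (Suc j) (e # t))) = ?g (bd_sum j \<one>\<^bsub>K\<^esub> (e # t))"
        using bd_sing etw by simp
      also have "\<dots> = (\<Oplus>\<^bsub>N\<^esub>i\<in>{..Suc j}. sc (sgn i) \<odot>\<^bsub>N\<^esub> \<psi> (del i (e # t)))"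
        unfolding hom_bd_sum[OF NM g etw(1)]
        by (rule N.M.M.M.finsum_cong') (use del_wchains[OF etw(1)] \<psi>c in \<open>auto simp: gs intro!: N.M.sc_closed\<close>)
      also have "\<dots> = (\<Oplus>\<^bsub>N\<^esub>i\<in>{..j}. sc (sgn (Suc i)) \<odot>\<^bsub>N\<^esub> \<psi> (e # del i t)) \<oplus>\<^bsub>N\<^esub> sc (sgn 0) \<odot>\<^bsub>N\<^esub> \<psi> t"
        by (subst N.M.M.M.finsum_Suc2) (auto simp: \<psi>c intro!: N.M.sc_closed)
      also have "\<dots> = (\<Oplus>\<^bsub>N\<^esub>i\<in>{..j}. sc (sgn (Suc i)) \<odot>\<^bsub>N\<^esub> \<psi> (e # del i t))"
        using \<psi>t \<psi>c by (simp add: N.M.M.smult_r_null sing_A N.M.sc_closed N.M.M.M.finsum_closed Pi_def)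
      also have "\<dots> = (\<Oplus>\<^bsub>N\<^esub>i\<in>{..j}. sc (sgn i \<otimes>\<^bsub>K\<^esub> \<beta> (del i t)) \<odot>\<^bsub>N\<^esub> w)"
        by (rule N.M.M.M.finsum_cong')
          (use \<beta>(1)[OF dt] N.v_closed in \<open>auto simp: \<psi>i N.M.sc_sc sgn_Suc K.l_minus K.r_minus intro!: N.M.sc_closed\<close>)
      also have "\<dots> = sc (\<phi> (e # t)) \<odot>\<^bsub>N\<^esub> w"
        unfolding \<beta>(2)[OF t] by (rule N.finsum_sc_v) (use \<beta>(1)[OF dt] in auto)
      finally show ?thesis using \<phi>(2) by simp
    qed
    show ?thesis
      by (rule bexI[OF _ g], rule ballI)
        (rule character_hom_eqI[OF N f mod_hom_comp[OF bd_hom g] e key])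
  qed
qed

end

text \<open>Compares the given resolution of \<open>S1\<close> with the chain complex of its
  character. Lifts out of \<open>P\<close> come from projectivity, lifts out of the chain modules
  from \<open>chain_modules_lift\<close>; the cocycles are then extended on the chain
  complex.\<close>

lemma (in lrb_algebra) ext_simple_trivial:
  fixes S1 :: "('b \<Rightarrow> 'k, 'm) module" and S2 :: "('b \<Rightarrow> 'k, 'n) module"
    and P :: "nat \<Rightarrow> ('b \<Rightarrow> 'k, 'p) module"
  assumes S1: "simple_module A S1" and S2: "simple_module A S2"
    and triv: "\<And>Y. Y \<subseteq> carrier B \<Longrightarrow> trivial_group (reduced_cohomology K (subposet_complex Y) j)"
    and P: "projective_resolution A P d e S1"
  shows "trivial_group (ext_group A P d S2 (Suc j))"
proof -
  have m: "left_module A S1" "left_module A S2" using S1 S2 by (simp_all add: simple_module_def)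
  interpret S1: lrb_module B K S1 using m lrb_algebra_axioms by (simp add: lrb_module_def)
  interpret S2: lrb_module B K S2 using m lrb_algebra_axioms by (simp add: lrb_module_def)
  obtain Q v where Q: "lrb_character B K Q S1 v" by (rule S1.simple_character[OF S1])
  obtain G w where G: "lrb_character B K G S2 w" by (rule S2.simple_character[OF S2])
  interpret Q: lrb_character B K Q S1 v by (rule Q)
  have PR: "resolution A P d e S1" by (rule projective_resolution_imp_resolution[OF P m(1)])
  have Pp: "projective_module A (P n)" for n using P by (simp add: projective_resolution_def)
  note PD = resolutionD[OF PR]
  show ?thesis
  proof (rule ext_group_trivial[where R=A and P=P and d=d and N=S2 and j=j])
    fix f assume f: "f \<in> mod_hom A (P (Suc j)) S2"
      and fd: "\<And>x. x \<in> carrier (P (Suc (Suc j))) \<Longrightarrow> f (d (Suc j) x) = \<zero>\<^bsub>S2\<^esub>"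
    show "\<exists>g\<in>mod_hom A (P j) S2. \<forall>x\<in>carrier (P (Suc j)). f x = g (d j x)"
    proof (rule cocycle_extends_transfer[OF PR Q.C_resolution m(2) _ _ _ _ _ _ f fd])
      show "lifts A (P 0) (Q.C 0) S1" by (rule projective_lifts[OF Pp Q.C_module m(1)])
      show "lifts A (P (Suc n)) (Q.C (Suc n)) (Q.C n)" for n by (rule projective_lifts[OF Pp Q.C_module Q.C_module])
      show "lifts A (Q.C 0) (P 0) S1" by (rule Q.chain_modules_lift[OF PD(2) m(1)])
      show "lifts A (Q.C (Suc n)) (P (Suc n)) (P n)" for n by (rule Q.chain_modules_lift[OF PD(2) PD(2)])
      show "lifts A (P n) (P (Suc n)) (P n)" for n by (rule projective_lifts[OF Pp PD(2) PD(2)])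
    next
      fix f assume "f \<in> mod_hom A (Q.C (Suc j)) S2"
        "\<And>x. x \<in> carrier (Q.C (Suc (Suc j))) \<Longrightarrow> f (Q.bd (Suc j) x) = \<zero>\<^bsub>S2\<^esub>"
      then show "\<exists>g\<in>mod_hom A (Q.C j) S2. \<forall>x\<in>carrier (Q.C (Suc j)). f x = g (Q.bd j x)"
        by (rule Q.cocycle_extends[OF G _ _ triv])
    qed
  qed (use PD m in auto)
qed

lemma (in lrb_algebra) order_complex_vertices: "\<Union> (order_complex (R_order B)) = carrier B"
proof
  show "\<Union> (order_complex (R_order B)) \<subseteq> carrier B"
    by (auto simp: order_complex_def Chains_def R_order_def)
  show "carrier B \<subseteq> \<Union> (order_complex (R_order B))"
  proof
    fix b assume "b \<in> carrier B"
    then have "{b} \<in> order_complex (R_order B)" by (simp add: order_complex_def Chains_def R_order_def idem)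
    then show "b \<in> \<Union> (order_complex (R_order B))" by blast
  qed
qed

theorem theorem14:
  fixes K :: "('k, 'x) ring_scheme" and B :: "('b, 'y) monoid_scheme"
  assumes "field K"
    and "left_regular_band_monoid B"
    and "finite (carrier B)"
  shows "gl_dim TYPE('m) TYPE('p) (monoid_algebra K B)
           \<le> leray_number K (order_complex (R_order B))"
proof -
  interpret lrb_algebra B K
    using assms by (simp add: lrb_algebra_def lrb_algebra_axioms_def)
  define L where "L = leray_number K (order_complex (R_order B))"
  let ?acyclic = "\<lambda>d. \<forall>i. d \<le> enat i \<longrightarrow> (\<forall>W. W \<subseteq> \<Union>(order_complex (R_order B)) \<longrightarrow>
    trivial_group (reduced_cohomology K (induced_subcomplex (order_complex (R_order B)) W) i))"
  \<comment> \<open>The least bound is attained: \<infinity> is always a bound, vacuously, as no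
    natural number reaches it.\<close>
  have "?acyclic L"
    unfolding L_def leray_number_def by (rule LeastI[of ?acyclic \<infinity>]) simp
  then have triv: "trivial_group (reduced_cohomology K (subposet_complex Y) i)" if "L \<le> enat i" "Y \<subseteq> carrier B" for i Y
    using that by (simp add: order_complex_vertices subposet_complex_def)
  show ?thesis
    unfolding gl_dim_def L_def[symmetric]
  proof (rule Least_le, intro allI impI)
    fix m and S1 S2 :: "('b \<Rightarrow> 'k, 'm) module"
    assume m: "L < enat m" and S: "simple_module A S1 \<and> simple_module A S2"
    \<comment> \<open>The strict inequality rules out \<open>m = 0\<close>, and the shift from
      \<open>m\<close> to \<open>j\<close> turns \<open>L < m\<close> into exactly the
      \<open>L \<le> j\<close> that the Leray number requires.\<close>
    then obtain j where j: "m = Suc j" by (cases m) (auto simp: enat_0)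
    then have Lj: "L \<le> enat j" using m by (cases L) simp_all
    show "ext_vanishes TYPE('p) A S1 S2 m"
      unfolding ext_vanishes_def j using ext_simple_trivial triv[OF Lj] S by blast
  qed
qed

end
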